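(* Let $z\in\mathbb{R}^N$ and let $\lambda_z>0$ be such that for every $\lambda\in(0,\lambda_z)$ there is an open ball $C_{z,\lambda}\ni z$ for which $u_\lambda$ and the maximal subsolution of $\lambda u+H(x,Du)=0$ in $C_{z,\lambda}$ coincide at $z$. Let $(\lambda_j)$ be a sequence in $(0,\lambda_z)$ with $\lambda_j\to0$, and for each $j$ let $\mu_j$ be a $(\lambda_j,z)$-Mather measure. Then, up to subsequences, $\mu_j$ narrowly converges to a Mather measure $\mu\in\mathfrak{M}$.
   Context: $H:\mathbb{R}^N\times\mathbb{R}^N\to\mathbb{R}$ satisfies: (A1) $H$ is continuous; (A2) $p\mapsto H(x,p)$ is convex for every $x$, and for every $R>0$, $\lim_{r\to+\infty}\inf\{H(x,p)\mid |x|<R,\ |p|\ge r\}=+\infty$; (A3) there is $\varepsilon>0$ with $\limsup_{|x|\to+\infty}\sup_{|p|<\varepsilon}H(x,p)<\max_{x\in\mathbb{R}^N}\min_{p\in\mathbb{R}^N}H(x,p)$; and, moreover, $\lim_{|p|\to+\infty}H(x,p)/|p|=+\infty$ for every $x$. Solutions and subsolutions of Hamilton--Jacobi equations are in the viscosity sense. The critical value $c=\inf\{a\in\mathbb{R}\mid H(x,Du)=a \text{ admits subsolutions in }\mathbb{R}^N\}$ is finite and is normalized to be $c=0$. For $\lambda>0$, $u_\lambda$ denotes the maximal subsolution (pointwise supremum of all subsolutions, itself a solution) of $\lambda u+H(x,Du)=0$ in $\mathbb{R}^N$; similarly the maximal subsolution in a ball is the pointwise supremum of all subsolutions in that ball.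 A number $\lambda_z$ as in the claim exists for every $z$. The Lagrangian is $L(x,q)=\max_{p}\,(p\cdot q-H(x,p))$. Let $\Phi\in C(\mathbb{R}^{2N})$. A locally Lipschitz $u:\mathbb{R}^N\to\mathbb{R}$ is a subsolution for $\Phi$ (resp. a $\lambda$-discounted subsolution for $\Phi$) if $Du(x)\cdot q\le\Phi(x,q)$ (resp. $\lambda u(x)+Du(x)\cdot q\le\Phi(x,q)$) for a.e. $x$ and every $q$. Write $\langle\mu,\Phi\rangle=\int\Phi\,d\mu$. For $0<\lambda<\lambda_z$, a $(\lambda,z)$-Mather measure is a Radon probability measure $\mu$ on $\mathbb{R}^{2N}$ with $\langle\mu,L\rangle=\lambda u_\lambda(z)$ and $\langle\mu,\Phi\rangle\ge\lambda u(z)$ for every $\Phi\in C(\mathbb{R}^{2N})$ bounded from below and every $\lambda$-discounted subsolution $u$ of $\Phi$. A Mather measure is a Radon probability measure $\mu$ on $\mathbb{R}^{2N}$ with $\langle\mu,L\rangle=0$ and $\langle\mu,\Phi\rangle\ge0$ for every $\Phi\in C(\mathbb{R}^{2N})$ bounded from below and admitting a subsolution; $\mathfrak{M}$ is the set of Mather measures. Narrow convergence $\mu_j\to\mu$ means $\int\Phi\,d\mu_j\to\int\Phi\,d\mu$ for every bounded continuous $\Phi$ on $\mathbb{R}^{2N}$. *)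

theory Defs
  imports "HOL-Probability.Probability"
begin

section \<open>Viscosity subsolutions\<close>

text \<open>
  \<open>F x r p\<close> stands for the left-hand side of a first-order equation \<open>F(x, u, Du) = 0\<close>
  on an open set \<open>U\<close>. Subsolutions are continuous on \<open>U\<close> and are tested from above with
  functions \<open>\<phi>\<close> of class \<open>C\<^sup>1\<close>, the vector field \<open>g\<close> being the gradient of \<open>\<phi>\<close>.
\<close>

definition viscosity_subsolution_on ::
    "'a::euclidean_space set \<Rightarrow> ('a \<Rightarrow> real \<Rightarrow> 'a \<Rightarrow> real) \<Rightarrow> ('a \<Rightarrow> real) \<Rightarrow> bool" where
  "viscosity_subsolution_on U F u \<longleftrightarrow>
     continuous_on U u \<and>
     (\<forall>\<phi> g x. (\<forall>y\<in>U. (\<phi> has_derivative (\<lambda>h. g y \<bullet> h)) (at y)) \<and> continuous_on U g \<and>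
        x \<in> U \<and> (\<forall>\<^sub>F y in nhds x. u y - \<phi> y \<le> u x - \<phi> x)
        \<longrightarrow> F x (u x) (g x) \<le> 0)"

text \<open>
  The critical value of \<open>H\<close>, taken in the extended reals so that an empty or
  unbounded set of levels is not confused with a finite value.
\<close>

definition critical_value :: "('a::euclidean_space \<Rightarrow> 'a \<Rightarrow> real) \<Rightarrow> ereal" where
  "critical_value H =
     (INF a\<in>{a. \<exists>u. viscosity_subsolution_on UNIV (\<lambda>x r p. H x p - a) u}. ereal a)"

text \<open>
  For coercive Hamiltonians, subsolutions of the discounted equation satisfy
  \<open>lam * u \<le> - min\<^sub>p H(\<cdot>, p)\<close>, so the real supremum below is over a set which is
  bounded above at each point of \<open>U\<close>.
\<close>

definition maximal_subsolution ::
    "'a::euclidean_space set \<Rightarrow> ('a \<Rightarrow> 'a \<Rightarrow> real) \<Rightarrow> real \<Rightarrow> 'a \<Rightarrow> real" where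
  "maximal_subsolution U H lam x =
     (SUP u\<in>{u. viscosity_subsolution_on U (\<lambda>y r p. lam * r + H y p) u}. u x)"

section \<open>Hypotheses on the Hamiltonian\<close>

definition locally_coercive :: "('a::euclidean_space \<Rightarrow> 'a \<Rightarrow> real) \<Rightarrow> bool" where
  "locally_coercive H \<longleftrightarrow>
     (\<forall>R>0. ((\<lambda>r. INF (x, p)\<in>{(x, p). norm x < R \<and> norm p \<ge> r}. ereal (H x p)) \<longlongrightarrow> \<infinity>) at_top)"

text \<open>
  The infimum in \<open>p\<close> is a minimum when \<open>H\<close> is continuous and locally coercive;
  the value \<open>m\<close> is required to be an attained maximum.
\<close>

definition nondegenerate_at_infinity :: "('a::euclidean_space \<Rightarrow> 'a \<Rightarrow> real) \<Rightarrow> bool" where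
  "nondegenerate_at_infinity H \<longleftrightarrow>
     (\<exists>\<epsilon>>0. \<exists>m. m \<in> range (\<lambda>x. INF p. H x p) \<and> (\<forall>x. (INF p. H x p) \<le> m) \<and>
        Limsup at_infinity (\<lambda>x. SUP p\<in>ball 0 \<epsilon>. ereal (H x p)) < ereal m)"

definition superlinear :: "('a::euclidean_space \<Rightarrow> 'a \<Rightarrow> real) \<Rightarrow> bool" where
  "superlinear H \<longleftrightarrow> (\<forall>x. filterlim (\<lambda>p. H x p / norm p) at_top at_infinity)"

text \<open>The supremum is a maximum when \<open>H\<close> is continuous and superlinear.\<close>

definition lagrangian :: "('a::euclidean_space \<Rightarrow> 'a \<Rightarrow> real) \<Rightarrow> 'a \<times> 'a \<Rightarrow> real" where
  "lagrangian H = (\<lambda>(x, q). SUP p. p \<bullet> q - H x p)"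

section \<open>Subsolutions for generalized Lagrangians\<close>

definition locally_lipschitz :: "('a::euclidean_space \<Rightarrow> real) \<Rightarrow> bool" where
  "locally_lipschitz u \<longleftrightarrow> (\<forall>x. \<exists>r>0. \<exists>K. K-lipschitz_on (ball x r) u)"

text \<open>
  The differential is part of the almost-everywhere statement; for locally Lipschitz
  functions its existence almost everywhere is no restriction (Rademacher).
\<close>

definition discounted_subsolution_for ::
    "real \<Rightarrow> ('a::euclidean_space \<times> 'a \<Rightarrow> real) \<Rightarrow> ('a \<Rightarrow> real) \<Rightarrow> bool" where
  "discounted_subsolution_for lam \<Phi> u \<longleftrightarrow>
     locally_lipschitz u \<and>
     (AE x in lborel. \<exists>D. (u has_derivative D) (at x) \<and> (\<forall>q. lam * u x + D q \<le> \<Phi> (x, q)))"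

definition subsolution_for ::
    "('a::euclidean_space \<times> 'a \<Rightarrow> real) \<Rightarrow> ('a \<Rightarrow> real) \<Rightarrow> bool" where
  "subsolution_for \<Phi> u \<longleftrightarrow>
     locally_lipschitz u \<and>
     (AE x in lborel. \<exists>D. (u has_derivative D) (at x) \<and> (\<forall>q. D q \<le> \<Phi> (x, q)))"

section \<open>Mather measures\<close>

text \<open>
  For \<open>\<Phi>\<close> bounded from below and a probability measure, the integral exists in
  \<open>(-\<infinity>, \<infinity>]\<close>. The Bochner integral would return 0 when the value is \<open>\<infinity>\<close>, hence
  the extended-real pairing.
\<close>

definition pairing :: "'b measure \<Rightarrow> ('b \<Rightarrow> real) \<Rightarrow> ereal" where
  "pairing \<mu> \<Phi> =
     enn2ereal (\<integral>\<^sup>+y. ennreal (\<Phi> y) \<partial>\<mu>) - enn2ereal (\<integral>\<^sup>+y. ennreal (- \<Phi> y) \<partial>\<mu>)"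

text \<open>On a Euclidean space every Borel probability measure is Radon.\<close>

definition radon_probability :: "'b::euclidean_space measure \<Rightarrow> bool" where
  "radon_probability \<mu> \<longleftrightarrow> sets \<mu> = sets borel \<and> prob_space \<mu>"

definition discounted_mather_measure ::
    "('a::euclidean_space \<Rightarrow> 'a \<Rightarrow> real) \<Rightarrow> real \<Rightarrow> 'a \<Rightarrow> ('a \<times> 'a) measure \<Rightarrow> bool" where
  "discounted_mather_measure H lam z \<mu> \<longleftrightarrow>
     radon_probability \<mu> \<and>
     pairing \<mu> (lagrangian H) = ereal (lam * maximal_subsolution UNIV H lam z) \<and>
     (\<forall>\<Phi> u. continuous_on UNIV \<Phi> \<and> bdd_below (range \<Phi>) \<and> discounted_subsolution_for lam \<Phi> u
        \<longrightarrow> pairing \<mu> \<Phi> \<ge> ereal (lam * u z))"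

definition mather_measures ::
    "('a::euclidean_space \<Rightarrow> 'a \<Rightarrow> real) \<Rightarrow> ('a \<times> 'a) measure set" where
  "mather_measures H = {\<mu>.
     radon_probability \<mu> \<and>
     pairing \<mu> (lagrangian H) = 0 \<and>
     (\<forall>\<Phi>. continuous_on UNIV \<Phi> \<and> bdd_below (range \<Phi>) \<and> (\<exists>u. subsolution_for \<Phi> u)
        \<longrightarrow> pairing \<mu> \<Phi> \<ge> 0)}"

definition narrowly_converges ::
    "(nat \<Rightarrow> 'b::euclidean_space measure) \<Rightarrow> 'b measure \<Rightarrow> bool" where
  "narrowly_converges \<mu> \<nu> \<longleftrightarrow>
     (\<forall>\<Phi>::'b \<Rightarrow> real. continuous_on UNIV \<Phi> \<and> bounded (range \<Phi>)
        \<longrightarrow> (\<lambda>j. \<integral>y. \<Phi> y \<partial>\<mu> j) \<longlonglongrightarrow> (\<integral>y. \<Phi> y \<partial>\<nu>))"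

end

theory Submission
  imports Defs
begin

text \<open>
  The functional \<open>\<Phi> \<mapsto> \<langle>\<mu>\<^sub>j, \<Phi>\<rangle>\<close> is controlled by testing with differentiable, nearly
  critical subsolutions. Two facts drive the argument.

  First, the discounted values satisfy \<open>limsup lam\<^sub>j u\<^bsub>lam\<^sub>j\<^esub>(z) \<le> 0\<close>
  (\<open>limsup_maximal_subsolution\<close>). Otherwise there would be discounted subsolutions \<open>u\<^sub>j\<close> with
  \<open>lam\<^sub>j u\<^sub>j(z) > a > 0\<close>. Raised to their maximum with a fixed critical subsolution, they are
  equi-Lipschitz on every ball, so \<open>lam\<^sub>j u\<^sub>j\<close> is almost constant there and \<open>H(x, Du\<^sub>j) \<le> - a/2\<close>; a limit would be a subsolution on the whole space at
  the level \<open>- a/2\<close>, below the critical value \<open>0\<close>.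

  Second, there are \<open>R, \<eta> > 0\<close> such that for every \<open>\<delta> > 0\<close> some differentiable \<open>V \<le> 0\<close> satisfies
  \<open>H(x, DV) \<le> \<delta>\<close> everywhere and \<open>H(x, DV) \<le> \<delta> - \<eta>\<close> for \<open>|x| \<ge> R + 1\<close>
  (\<open>smooth_strict_subsolution\<close>). It comes from a critical subsolution by truncating its values,
  replacing it near infinity by a slowly decreasing cone, and mollifying. Testing \<open>\<mu>\<^sub>j\<close> with \<open>V\<close>
  shows that the mass of \<open>\<mu>\<^sub>j\<close> over \<open>|x| \<ge> R + 1\<close> tends to \<open>0\<close>, and the linear growth of \<open>L\<close> in \<open>q\<close>
  bounds the velocities. Hence the sequence is tight (\<open>tight_sequence\<close>), a subsequence converges
  narrowly (\<open>prokhorov_euclidean\<close>), and the limit \<open>\<nu>\<close> is supported over a ball.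

  That support is what allows the passage to the limit in \<open>\<langle>\<mu>\<^sub>j, \<Phi>\<rangle> \<ge> lam\<^sub>j u(z)\<close> for a \<open>\<Phi>\<close> with
  an arbitrary subsolution \<open>u\<close>: one may cut \<open>u\<close> off outside the ball and replace \<open>\<Phi>\<close> by a
  function that is no larger over the ball, at most linear in \<open>q\<close>, and nonpositive for large \<open>x\<close>
  (\<open>cutoff_subsolution\<close>). For such functions the
  superlinearity of \<open>L\<close> gives uniform integrability, so \<open>\<langle>\<nu>, \<Phi>\<rangle> \<ge> 0\<close> (\<open>test_limit\<close>). Finally
  \<open>\<langle>\<nu>, L\<rangle> \<le> 0\<close> by lower semicontinuity and \<open>\<langle>\<nu>, L\<rangle> \<ge> 0\<close> by testing with \<open>V\<close>.

  Subsolutions are handled through the slopes of their increments (\<open>slopes_in\<close>). A viscosity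
  subsolution has, near every point, increments bounded by the support function of a sublevel
  set of \<open>H\<close>; conversely such a bound returns the viscosity inequality. The bound on increments passes
  trivially to maxima, minima, pointwise upper limits and averages. It therefore replaces both
  the almost everywhere differentiability of Lipschitz functions and the compactness theorem for
  equicontinuous families.
\<close>

section \<open>Slopes and test functions\<close>

text \<open>
  The increments of \<open>u\<close> are bounded by the support function of \<open>Z\<close>: informally, the closed convex
  hull of \<open>Z\<close> contains all gradients of \<open>u\<close>. Quantifying over upper bounds \<open>c\<close> keeps the notion
  meaningful for empty and for unbounded \<open>Z\<close>.
\<close>

definition slopes_in :: "'a::euclidean_space set \<Rightarrow> 'a set \<Rightarrow> ('a \<Rightarrow> real) \<Rightarrow> bool" where
  "slopes_in Z B u \<longleftrightarrow>
     (\<forall>x\<in>B. \<forall>y\<in>B. \<forall>c. (\<forall>p\<in>Z. p \<bullet> (y - x) \<le> c) \<longrightarrow> u y - u x \<le> c)"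

text \<open>
  Gradients of globally \<open>C\<^sup>1\<close> functions touching \<open>u\<close> from above; on the whole space a viscosity
  subsolution is a continuous function whose supergradients satisfy the inequality.
\<close>

definition supergradient :: "('a::euclidean_space \<Rightarrow> real) \<Rightarrow> 'a \<Rightarrow> 'a \<Rightarrow> bool" where
  "supergradient u x p \<longleftrightarrow>
     (\<exists>\<phi> g. (\<forall>y. (\<phi> has_derivative (\<lambda>h. g y \<bullet> h)) (at y)) \<and> continuous_on UNIV g \<and> g x = p \<and>
        (\<forall>\<^sub>F y in nhds x. u y - \<phi> y \<le> u x - \<phi> x))"

lemma slopes_inD:
  "slopes_in Z B u \<Longrightarrow> x \<in> B \<Longrightarrow> y \<in> B \<Longrightarrow> (\<And>p. p \<in> Z \<Longrightarrow> p \<bullet> (y - x) \<le> c) \<Longrightarrow> u y - u x \<le> c"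
  unfolding slopes_in_def by blast

lemma slopes_inI:
  "(\<And>x y c. x \<in> B \<Longrightarrow> y \<in> B \<Longrightarrow> (\<And>p. p \<in> Z \<Longrightarrow> p \<bullet> (y - x) \<le> c) \<Longrightarrow> u y - u x \<le> c) \<Longrightarrow> slopes_in Z B u"
  unfolding slopes_in_def by blast

lemma slopes_in_mono:
  assumes "slopes_in Z B u" "Z \<subseteq> Z'" "B' \<subseteq> B"
  shows "slopes_in Z' B' u"
  using assms unfolding slopes_in_def by (meson subsetD)

lemma slopes_in_cong:
  assumes "\<And>x. x \<in> B \<Longrightarrow> u x = v x"
  shows "slopes_in Z B u \<longleftrightarrow> slopes_in Z B v"
  unfolding slopes_in_def using assms by auto

lemma slopes_in_max:
  assumes "slopes_in Z B u" "slopes_in Z B v"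
  shows "slopes_in Z B (\<lambda>x. max (u x) (v x))"
proof (rule slopes_inI)
  fix x y c assume "x \<in> B" "y \<in> B" "\<And>p. p \<in> Z \<Longrightarrow> p \<bullet> (y - x) \<le> c"
  then have "u y - u x \<le> c" "v y - v x \<le> c"
    using assms by (blast intro: slopes_inD)+
  then show "max (u y) (v y) - max (u x) (v x) \<le> c" by linarith
qed

lemma slopes_in_min:
  assumes "slopes_in Z B u" "slopes_in Z B v"
  shows "slopes_in Z B (\<lambda>x. min (u x) (v x))"
proof (rule slopes_inI)
  fix x y c assume "x \<in> B" "y \<in> B" "\<And>p. p \<in> Z \<Longrightarrow> p \<bullet> (y - x) \<le> c"
  then have "u y - u x \<le> c" "v y - v x \<le> c"
    using assms by (blast intro: slopes_inD)+
  then show "min (u y) (v y) - min (u x) (v x) \<le> c" by linarith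
qed

lemma slopes_in_cball_iff:
  assumes "K \<ge> 0"
  shows "slopes_in (cball 0 K) B u \<longleftrightarrow> (\<forall>x\<in>B. \<forall>y\<in>B. u y - u x \<le> K * norm (y - x))"
proof (intro iffI ballI)
  fix x y assume u: "slopes_in (cball 0 K) B u" and xy: "x \<in> B" "y \<in> B"
  have "p \<bullet> (y - x) \<le> K * norm (y - x)" if "p \<in> cball 0 K" for p
  proof -
    have "p \<bullet> (y - x) \<le> norm p * norm (y - x)" by (rule norm_cauchy_schwarz)
    also have "\<dots> \<le> K * norm (y - x)" using that by (intro mult_right_mono) auto
    finally show ?thesis .
  qed
  with u xy show "u y - u x \<le> K * norm (y - x)" by (blast intro: slopes_inD)
next
  assume u: "\<forall>x\<in>B. \<forall>y\<in>B. u y - u x \<le> K * norm (y - x)"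
  show "slopes_in (cball 0 K) B u"
  proof (rule slopes_inI)
    fix x y c assume xy: "x \<in> B" "y \<in> B" and c: "\<And>p. p \<in> cball 0 K \<Longrightarrow> p \<bullet> (y - x) \<le> c"
    have "((K / norm (y - x)) *\<^sub>R (y - x)) \<bullet> (y - x) \<le> c"
      using \<open>K \<ge> 0\<close> by (intro c) auto
    then have "K * norm (y - x) \<le> c"
      by (cases "y = x") (auto simp: dot_square_norm power2_eq_square)
    moreover have "u y - u x \<le> K * norm (y - x)" using u xy by blast
    ultimately show "u y - u x \<le> c" by linarith
  qed
qed

lemma slopes_in_cball_lipschitz:
  assumes "K \<ge> 0" "slopes_in (cball 0 K) B u"
  shows "K-lipschitz_on B u"
proof (rule lipschitz_onI)
  fix x y assume "x \<in> B" "y \<in> B"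
  then have "u y - u x \<le> K * norm (y - x)" "u x - u y \<le> K * norm (x - y)"
    using assms(2) unfolding slopes_in_cball_iff[OF assms(1)] by blast+
  then show "dist (u x) (u y) \<le> K * dist x y"
    by (simp add: dist_norm norm_minus_commute abs_le_iff)
qed fact

text \<open>
  A function that rises by more than \<open>c\<close> along a segment has a supergradient of slope more than
  \<open>c\<close> along it. Maximise \<open>u - \<phi>\<close> over a thin tube around the segment, where \<open>\<phi>\<close> grows along the
  axis with slope at least \<open>s > c\<close>, quadratically across the tube, and steeply close to the far end.
  The start of the tube loses because \<open>u\<close> rises by more than \<open>s\<close>, the other faces because of
  the penalties, so the maximum is interior.
\<close>

lemma supergradient_slope:
  fixes u :: "'a::euclidean_space \<Rightarrow> real"
  assumes B: "open B" "convex B" and cont: "continuous_on B u" and xy: "x \<in> B" "y \<in> B" "x \<noteq> y"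
    and c: "c < u y - u x"
  shows "\<exists>w p. w \<in> B \<and> supergradient u w p \<and> p \<bullet> (y - x) > c"
proof -
  define q where "q = y - x"
  define n2 where "n2 = q \<bullet> q"
  have n2: "n2 > 0" using xy(3) by (simp add: n2_def q_def)
  obtain s where s: "c < s" "s < u y - u x" using c dense by blast
  define gap where "gap = u y - u x - s"
  have gap: "gap > 0" using s by (simp add: gap_def)
  define \<tau> where "\<tau> w = ((w - x) \<bullet> q) / n2" for w
  define perp where "perp w = w - x - \<tau> w *\<^sub>R q" for w
  have perp_q: "perp w \<bullet> q = 0" for w
    using n2 by (simp add: perp_def \<tau>_def inner_diff_left n2_def[symmetric])
  have seg: "x + t *\<^sub>R q \<in> B" if "0 \<le> t" "t \<le> 1" for t
  proof -
    have "x + t *\<^sub>R q = (1 - t) *\<^sub>R x + t *\<^sub>R y" by (simp add: q_def algebra_simps)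
    then show ?thesis using that B(2) xy by (simp add: convexD_alt)
  qed
  have cont_seg: "continuous_on {0..1} (\<lambda>t. u (x + t *\<^sub>R q) - s * t)"
    by (intro continuous_intros continuous_on_compose2[OF cont]) (auto intro: seg)
  \<comment> \<open>a point strictly before the far end, where the end penalty can still be made negligible\<close>
  obtain \<theta> where \<theta>: "0 < \<theta>" "\<theta> < 1" "u (x + \<theta> *\<^sub>R q) - s * \<theta> > u x + gap / 2"
  proof -
    have "((\<lambda>t. u (x + t *\<^sub>R q) - s * t) \<longlongrightarrow> u (x + 1 *\<^sub>R q) - s * 1) (at 1 within {0..1})"
      using cont_seg unfolding continuous_on_def by (rule bspec) simp
    moreover have "u (x + 1 *\<^sub>R q) - s * 1 > u x + gap / 2"
      using gap by (simp add: q_def gap_def field_simps)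
    ultimately have "\<forall>\<^sub>F t in at 1 within {0..1}. u (x + t *\<^sub>R q) - s * t > u x + gap / 2"
      by (rule order_tendstoD)
    then have "\<forall>\<^sub>F t in at_left 1. u (x + t *\<^sub>R q) - s * t > u x + gap / 2"
      by (simp add: at_within_Icc_at_left)
    moreover have "\<forall>\<^sub>F t in at_left (1::real). 0 < t \<and> t < 1"
      using eventually_at_left[of 0 "1::real"] by (auto intro!: exI[of _ 0])
    ultimately have "\<forall>\<^sub>F t in at_left 1. 0 < t \<and> t < 1 \<and> u (x + t *\<^sub>R q) - s * t > u x + gap / 2"
      by eventually_elim auto
    then show ?thesis using that eventually_happens' trivial_limit_at_left_real by blast
  qed
  define S where "S = (\<lambda>t. x + t *\<^sub>R q) ` {0..1}"
  have "compact S" unfolding S_def by (intro compact_continuous_image continuous_intros) auto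
  moreover have "S \<subseteq> B" unfolding S_def using seg by auto
  ultimately obtain \<rho>1 where \<rho>1: "\<rho>1 > 0" "(\<Union>w\<in>S. ball w \<rho>1) \<subseteq> B"
    using compact_subset_open_imp_ball_epsilon_subset[OF _ B(1)] by metis
  have "continuous (at x) u" using cont B(1) xy(1) continuous_on_eq_continuous_at by blast
  then obtain \<rho>2 where \<rho>2: "\<rho>2 > 0" "\<And>w. dist w x < \<rho>2 \<Longrightarrow> dist (u w) (u x) < gap / 4"
    using gap unfolding continuous_at_eps_delta by (metis divide_pos_pos zero_less_numeral)
  define \<rho> where "\<rho> = min \<rho>1 \<rho>2 / 2"
  have \<rho>: "\<rho> > 0" "\<rho> < \<rho>1" "\<rho> < \<rho>2" using \<rho>1 \<rho>2 by (auto simp: \<rho>_def)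
  define D where "D = {w. 0 \<le> \<tau> w \<and> \<tau> w \<le> 1 \<and> norm (perp w) \<le> \<rho>}"
  have cont_\<tau>: "continuous_on A \<tau>" for A unfolding \<tau>_def using n2 by (intro continuous_intros) auto
  have cont_perp: "continuous_on A perp" for A unfolding perp_def
    by (intro continuous_intros cont_\<tau>)
  have decomp: "w = (x + \<tau> w *\<^sub>R q) + perp w" for w by (simp add: perp_def)
  have D_B: "D \<subseteq> B"
  proof
    fix w assume "w \<in> D"
    then have "x + \<tau> w *\<^sub>R q \<in> S" "dist (x + \<tau> w *\<^sub>R q) w < \<rho>1"
      using \<rho> by (auto simp: D_def S_def dist_norm perp_def norm_minus_commute algebra_simps)
    then show "w \<in> B" using \<rho>1(2) mem_ball by blast
  qed
  have "closed D" unfolding D_def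
    by (intro closed_Collect_conj closed_Collect_le continuous_intros cont_\<tau> cont_perp)
  moreover have "bounded D"
  proof (rule boundedI)
    fix w assume w: "w \<in> D"
    have "norm w \<le> norm (x + \<tau> w *\<^sub>R q) + norm (perp w)" using norm_triangle_ineq decomp by metis
    also have "\<dots> \<le> norm x + norm (\<tau> w *\<^sub>R q) + norm (perp w)" by (intro add_right_mono norm_triangle_ineq)
    also have "\<dots> \<le> norm x + norm q + \<rho>"
      using w by (auto simp: D_def intro!: add_mono mult_left_le_one_le)
    finally show "norm w \<le> norm x + norm q + \<rho>" .
  qed
  ultimately have D_compact: "compact D" using compact_eq_bounded_closed by blast
  have cont_D: "continuous_on D u" using cont D_B continuous_on_subset by blast
  obtain M where M: "\<And>w. w \<in> D \<Longrightarrow> \<bar>u w\<bar> \<le> M"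
    using compact_imp_bounded[OF compact_continuous_image[OF cont_D D_compact]]
    unfolding bounded_iff by (metis imageI real_norm_def)
  have x_D: "x \<in> D" using \<rho> by (simp add: D_def \<tau>_def perp_def)
  \<comment> \<open>large enough to outweigh the oscillation of \<open>u\<close> and the linear term on the whole tube\<close>
  define A where "A = 2 * M + \<bar>s\<bar>"
  have A0: "A \<ge> 0" using M[OF x_D] by (simp add: A_def)
  obtain m where m: "A * \<theta> ^ m < gap / 4"
  proof -
    have "(\<lambda>m. A * \<theta> ^ m) \<longlonglongrightarrow> A * 0" using \<theta> by (intro tendsto_intros LIMSEQ_power_zero) auto
    then have "\<forall>\<^sub>F m in sequentially. A * \<theta> ^ m < gap / 4" using gap by (intro order_tendstoD) auto
    then show ?thesis using that eventually_happens' sequentially_bot by blast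
  qed
  have m': "A * \<theta> ^ Suc m < gap / 4"
  proof -
    have "A * \<theta> ^ Suc m \<le> A * \<theta> ^ m" using A0 \<theta> by (intro mult_left_mono) (auto intro: power_Suc_le_self mult_left_le_one_le)
    then show ?thesis using m by simp
  qed
  define N where "N = A / \<rho>\<^sup>2"
  have N0: "N \<ge> 0" using A0 by (simp add: N_def)
  define \<phi> where "\<phi> w = s * \<tau> w + A * \<tau> w ^ Suc m + N * (perp w \<bullet> perp w)" for w
  define g where "g w = ((s + A * real (Suc m) * \<tau> w ^ m) / n2) *\<^sub>R q + (2 * N) *\<^sub>R perp w" for w
  have d\<tau>: "(\<tau> has_derivative (\<lambda>h. (h \<bullet> q) / n2)) (at w)" for w
    unfolding \<tau>_def using n2 by (auto intro!: derivative_eq_intros)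
  have dperp: "(perp has_derivative (\<lambda>h. h - ((h \<bullet> q) / n2) *\<^sub>R q)) (at w)" for w
    unfolding perp_def by (auto intro!: derivative_eq_intros d\<tau>)
  have d\<phi>: "(\<phi> has_derivative (\<lambda>h. g w \<bullet> h)) (at w)" for w
    unfolding \<phi>_def
    by (rule derivative_eq_intros d\<tau> dperp refl)+
       (auto simp: g_def fun_eq_iff inner_add_left inner_add_right inner_diff_right inner_diff_left
         perp_q inner_commute[of _ "perp w"] inner_commute[of q] add_divide_distrib algebra_simps)
  have cont_g: "continuous_on UNIV g"
    unfolding g_def using n2 by (intro continuous_intros cont_\<tau> cont_perp) auto
  have cont_\<phi>: "continuous_on D \<phi>"
    unfolding \<phi>_def by (intro continuous_intros cont_\<tau> cont_perp)
  obtain w where w: "w \<in> D" "\<And>w'. w' \<in> D \<Longrightarrow> u w' - \<phi> w' \<le> u w - \<phi> w"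
    using continuous_attains_sup[OF D_compact, of "\<lambda>w. u w - \<phi> w"] x_D cont_D cont_\<phi>
    by (auto intro: continuous_intros)
  have "u w - \<phi> w > u x + gap / 4"
  proof -
    define w' where "w' = x + \<theta> *\<^sub>R q"
    have "\<tau> w' = \<theta>" using n2 by (simp add: w'_def \<tau>_def n2_def)
    moreover from this have "perp w' = 0" by (simp add: perp_def w'_def)
    ultimately have "w' \<in> D" "\<phi> w' = s * \<theta> + A * \<theta> ^ Suc m" using \<theta> \<rho> by (auto simp: D_def \<phi>_def)
    with w(2)[of w'] \<theta>(3) m' show ?thesis unfolding w'_def by linarith
  qed
  \<comment> \<open>each face of the tube is too low to carry the maximum\<close>
  have "norm (perp w) < \<rho>"
  proof (rule ccontr)
    assume "\<not> ?thesis"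
    then have "norm (perp w) = \<rho>" using w by (simp add: D_def)
    then have "N * (perp w \<bullet> perp w) = A" using \<rho> by (simp add: N_def dot_square_norm)
    moreover have "s * \<tau> w \<ge> - \<bar>s\<bar>"
    proof -
      have "\<bar>s * \<tau> w\<bar> \<le> \<bar>s\<bar> * 1" unfolding abs_mult using w by (intro mult_left_mono) (auto simp: D_def)
      then show ?thesis by linarith
    qed
    moreover have "A * \<tau> w ^ Suc m \<ge> 0" using A0 w by (auto simp: D_def)
    ultimately have "\<phi> w \<ge> 2 * M" by (simp add: \<phi>_def A_def)
    then show False using \<open>u w - \<phi> w > u x + gap / 4\<close> M[OF w(1)] M[OF x_D] gap by linarith
  qed
  moreover have "\<tau> w < 1"
  proof (rule ccontr)
    assume "\<not> ?thesis"
    then have "\<tau> w = 1" using w by (simp add: D_def)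
    then have "\<phi> w \<ge> s + A" using N0 by (simp add: \<phi>_def)
    then have "\<phi> w \<ge> 2 * M" by (simp add: A_def)
    then show False using \<open>u w - \<phi> w > u x + gap / 4\<close> M[OF w(1)] M[OF x_D] gap by linarith
  qed
  moreover have "\<tau> w > 0"
  proof (rule ccontr)
    assume "\<not> ?thesis"
    then have "\<tau> w = 0" using w by (simp add: D_def)
    then have "dist w x < \<rho>2" using decomp[of w] \<rho> w by (simp add: D_def dist_norm perp_def)
    then have "u w < u x + gap / 4" using \<rho>2(2)[of w] unfolding dist_real_def by linarith
    moreover have "\<phi> w \<ge> 0" using \<open>\<tau> w = 0\<close> N0 by (simp add: \<phi>_def)
    ultimately show False using \<open>u w - \<phi> w > u x + gap / 4\<close> by linarith
  qed
  ultimately have interior: "w \<in> {w. 0 < \<tau> w \<and> \<tau> w < 1 \<and> norm (perp w) < \<rho>}" by simp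
  have "open {w. 0 < \<tau> w \<and> \<tau> w < 1 \<and> norm (perp w) < \<rho>}"
    by (intro open_Collect_conj open_Collect_less continuous_intros cont_\<tau> cont_perp)
  then have "\<forall>\<^sub>F w' in nhds w. w' \<in> {w. 0 < \<tau> w \<and> \<tau> w < 1 \<and> norm (perp w) < \<rho>}"
    using interior by (rule eventually_nhds_in_open)
  then have "\<forall>\<^sub>F w' in nhds w. u w' - \<phi> w' \<le> u w - \<phi> w"
    by (rule eventually_mono) (auto intro!: w(2) simp: D_def)
  then have "supergradient u w (g w)" unfolding supergradient_def using d\<phi> cont_g by blast
  moreover have "g w \<bullet> q > c"
  proof -
    have "g w \<bullet> q = s + A * real (Suc m) * \<tau> w ^ m"
      using n2 by (simp add: g_def inner_add_left perp_q n2_def[symmetric])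
    moreover have "A * real (Suc m) * \<tau> w ^ m \<ge> 0" using A0 interior by simp
    ultimately show ?thesis using s by linarith
  qed
  ultimately show ?thesis using w(1) D_B q_def by blast
qed

text \<open>
  This turns pointwise viscosity inequalities into a bound on increments. For empty \<open>Z\<close> it says
  that every ball contains a point with a supergradient.
\<close>

lemma slopes_in_of_supergradients:
  fixes u :: "'a::euclidean_space \<Rightarrow> real"
  assumes B: "open B" "convex B" and cont: "continuous_on B u"
    and Z: "\<And>x p. x \<in> B \<Longrightarrow> supergradient u x p \<Longrightarrow> p \<in> Z"
  shows "slopes_in Z B u"
proof (rule slopes_inI, rule ccontr)
  fix x y c assume xy: "x \<in> B" "y \<in> B" and c: "\<And>p. p \<in> Z \<Longrightarrow> p \<bullet> (y - x) \<le> c"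
    and neg: "\<not> u y - u x \<le> c"
  show False
  proof (cases "x = y")
    case False
    then show False using supergradient_slope[OF B cont xy False, of c] neg c Z by fastforce
  next
    case True
    then have "Z = {}" using c neg by force
    obtain y' where "y' \<in> B" "y' \<noteq> x"
      using B(1) xy(1) by (metis insertI1 not_open_singleton singletonD subsetI subset_antisym empty_subsetI insert_subset)
    then show False
      using supergradient_slope[OF B cont xy(1), of y' "u y' - u x - 1"] Z \<open>Z = {}\<close> by force
  qed
qed

text \<open>
  If \<open>p\<close> were outside \<open>Z\<close>, a hyperplane would separate it from \<open>Z\<close>; moving from \<open>x\<close> in the normal
  direction, \<open>u\<close> would have to change at a rate that contradicts the contact with \<open>\<phi>\<close>. With
  \<open>\<phi> = u\<close> this locates the gradient of \<open>u\<close> wherever it exists.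
\<close>

lemma slopes_in_gradient:
  fixes u :: "'a::euclidean_space \<Rightarrow> real"
  assumes Z: "closed Z" "convex Z" and u: "slopes_in Z (ball x r) u" "r > 0"
    and \<phi>: "(\<phi> has_derivative (\<lambda>h. p \<bullet> h)) (at x)"
    and touch: "\<forall>\<^sub>F y in nhds x. u y - \<phi> y \<le> u x - \<phi> x"
  shows "p \<in> Z"
proof (rule ccontr)
  assume "p \<notin> Z"
  then obtain a b where ab: "a \<bullet> p < b" "\<And>z. z \<in> Z \<Longrightarrow> b < a \<bullet> z"
    using separating_hyperplane_closed_point[OF Z(2,1)] by blast
  have lim: "((\<lambda>t. x + t *\<^sub>R a) \<longlongrightarrow> x) (at_right 0)"
    by (auto intro!: tendsto_eq_intros)
  have "((\<lambda>t. \<phi> (x + t *\<^sub>R a)) has_derivative (\<lambda>t. p \<bullet> (t *\<^sub>R a))) (at 0)"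
    by (rule has_derivative_compose[where f="\<lambda>t. x + t *\<^sub>R a" and g=\<phi> and f'="\<lambda>t. t *\<^sub>R a"])
       (auto intro!: derivative_eq_intros simp: \<phi>)
  then have "((\<lambda>t. \<phi> (x + t *\<^sub>R a)) has_field_derivative (p \<bullet> a)) (at 0)"
    unfolding has_field_derivative_def by (rule has_derivative_eq_rhs) (auto simp: fun_eq_iff)
  then have "((\<lambda>t. (\<phi> (x + t *\<^sub>R a) - \<phi> x) / t) \<longlongrightarrow> p \<bullet> a) (at 0)"
    by (simp add: DERIV_def)
  then have "((\<lambda>t. (\<phi> (x + t *\<^sub>R a) - \<phi> x) / t) \<longlongrightarrow> p \<bullet> a) (at_right 0)"
    by (simp add: filterlim_at_split)
  moreover have "\<forall>\<^sub>F t in at_right 0. b \<le> (\<phi> (x + t *\<^sub>R a) - \<phi> x) / t"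
  proof -
    have "\<forall>\<^sub>F y in nhds x. y \<in> ball x r" using u(2) by (intro eventually_nhds_in_open) auto
    with touch have "\<forall>\<^sub>F y in nhds x. u y - \<phi> y \<le> u x - \<phi> x \<and> y \<in> ball x r"
      by eventually_elim auto
    then have "\<forall>\<^sub>F t in at_right 0. u (x + t *\<^sub>R a) - \<phi> (x + t *\<^sub>R a) \<le> u x - \<phi> x \<and> x + t *\<^sub>R a \<in> ball x r"
      using lim by (rule eventually_compose_filterlim)
    then show ?thesis
      using eventually_at_right_less[of "0::real"]
    proof eventually_elim
      case (elim t)
      have "u x - u (x + t *\<^sub>R a) \<le> - (t * b)"
      proof (rule slopes_inD[OF u(1)])
        fix z assume "z \<in> Z"
        then have "t * b \<le> t * (a \<bullet> z)" using ab(2)[of z] elim by simp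
        then show "z \<bullet> (x - (x + t *\<^sub>R a)) \<le> - (t * b)" by (simp add: inner_commute)
      qed (use elim u(2) in auto)
      then have "t * b \<le> \<phi> (x + t *\<^sub>R a) - \<phi> x" using elim by linarith
      then show ?case using elim by (simp add: field_simps)
    qed
  qed
  ultimately have "b \<le> p \<bullet> a" by (rule tendsto_lowerbound) simp
  then show False using ab(1) by (simp add: inner_commute)
qed

lemma supergradient_in_slopes:
  assumes "closed Z" "convex Z" "slopes_in Z (ball x r) u" "r > 0" "supergradient u x p"
  shows "p \<in> Z"
  using assms(5) slopes_in_gradient[OF assms(1-4)] unfolding supergradient_def by blast

lemma supergradient_max:
  assumes "supergradient (\<lambda>x. max (u x) (v x)) x p"
  shows "(supergradient u x p \<and> v x \<le> u x) \<or> (supergradient v x p \<and> u x \<le> v x)"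
proof -
  obtain \<phi> g where g: "\<forall>y. (\<phi> has_derivative (\<lambda>h. g y \<bullet> h)) (at y)" "continuous_on UNIV g" "g x = p"
    and touch: "\<forall>\<^sub>F y in nhds x. max (u y) (v y) - \<phi> y \<le> max (u x) (v x) - \<phi> x"
    using assms unfolding supergradient_def by blast
  show ?thesis
  proof (cases "v x \<le> u x")
    case True
    have "\<forall>\<^sub>F y in nhds x. u y - \<phi> y \<le> u x - \<phi> x"
      using touch by eventually_elim (use True in auto)
    then show ?thesis using g True unfolding supergradient_def by blast
  next
    case False
    have "\<forall>\<^sub>F y in nhds x. v y - \<phi> y \<le> v x - \<phi> x"
      using touch by eventually_elim (use False in auto)
    then show ?thesis using g False unfolding supergradient_def by force
  qed
qed

lemma viscosity_subsolution_on_UNIV_iff: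
  "viscosity_subsolution_on UNIV F u \<longleftrightarrow>
     continuous_on UNIV u \<and> (\<forall>x p. supergradient u x p \<longrightarrow> F x (u x) p \<le> 0)"
  unfolding viscosity_subsolution_on_def supergradient_def by auto

lemma slopes_in_shift: "slopes_in Z B (\<lambda>x. u x - c) \<longleftrightarrow> slopes_in Z B u"
  unfolding slopes_in_def by simp

lemma locally_lipschitz_of_slopes:
  assumes "K \<ge> 0" "\<And>x. \<exists>r>0. slopes_in (cball 0 K) (ball x r) u"
  shows "locally_lipschitz u"
  unfolding locally_lipschitz_def using slopes_in_cball_lipschitz assms by metis

lemma locally_lipschitz_imp_continuous:
  assumes "locally_lipschitz u"
  shows "continuous_on UNIV u"
proof -
  have "isCont u x" for x
  proof -
    obtain r K where "r > 0" "K-lipschitz_on (ball x r) u"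
      using assms unfolding locally_lipschitz_def by blast
    then show ?thesis
      using lipschitz_on_continuous_on continuous_on_eq_continuous_at[of "ball x r" u] by auto
  qed
  then show ?thesis by (simp add: continuous_at_imp_continuous_on)
qed

lemma continuous_bounded_on_cball:
  fixes f :: "'a::euclidean_space \<Rightarrow> real"
  assumes "continuous_on UNIV f"
  obtains B where "B \<ge> 0" "\<And>x. norm x \<le> R \<Longrightarrow> \<bar>f x\<bar> \<le> B"
proof -
  have "bounded (f ` cball 0 R)"
    using assms by (intro compact_imp_bounded compact_continuous_image compact_cball)
      (auto intro: continuous_on_subset)
  then obtain B where B: "\<forall>y\<in>f ` cball 0 R. norm y \<le> B" unfolding bounded_iff by blast
  have "\<bar>f x\<bar> \<le> max B 0" if "norm x \<le> R" for x
    using that B by (auto simp: le_max_iff_disj)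
  then show ?thesis using that[of "max B 0"] by auto
qed

section \<open>Convex coercive Hamiltonians\<close>

locale convex_hamiltonian =
  fixes H :: "'a::euclidean_space \<Rightarrow> 'a \<Rightarrow> real"
  assumes cont_H: "continuous_on UNIV (\<lambda>(x, p). H x p)"
    and convex_H: "\<And>x. convex_on UNIV (H x)"
    and coercive_H: "locally_coercive H"
begin

lemma continuous_on_H [continuous_intros]:
  assumes "continuous_on S f" "continuous_on S g"
  shows "continuous_on S (\<lambda>t. H (f t) (g t))"
proof -
  have "continuous_on S (\<lambda>t. (f t, g t))" using assms by (intro continuous_intros)
  then have "continuous_on S (\<lambda>t. (\<lambda>(x, p). H x p) (f t, g t))"
    using continuous_on_compose2[OF cont_H] by blast
  then show ?thesis by simp
qed

lemma closed_sublevel: "closed {p. H x p \<le> b}"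
  by (intro closed_Collect_le continuous_intros)

lemma convex_sublevel: "convex {p. H x p \<le> b}"
  unfolding convex_def
proof (intro ballI allI impI, clarsimp)
  fix p q and s t :: real
  assume *: "H x p \<le> b" "H x q \<le> b" "0 \<le> s" "0 \<le> t" "s + t = 1"
  then have "H x (s *\<^sub>R p + t *\<^sub>R q) \<le> s * H x p + t * H x q"
    using convex_H[of x] unfolding convex_on_def by blast
  also have "\<dots> \<le> b" using * by (intro convex_bound_le) auto
  finally show "H x (s *\<^sub>R p + t *\<^sub>R q) \<le> b" .
qed

lemma sublevel_bounded:
  obtains K where "K \<ge> 0" "\<And>x p. norm x \<le> R \<Longrightarrow> H x p \<le> b \<Longrightarrow> norm p \<le> K"
proof -
  define R' where "R' = \<bar>R\<bar> + 1"
  have "R' > 0" by (simp add: R'_def)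
  then have "((\<lambda>r. INF (x, p)\<in>{(x, p). norm x < R' \<and> norm p \<ge> r}. ereal (H x p)) \<longlongrightarrow> \<infinity>) at_top"
    using coercive_H unfolding locally_coercive_def by blast
  then have "\<forall>\<^sub>F r in at_top. ereal b < (INF (x, p)\<in>{(x, p). norm x < R' \<and> norm p \<ge> r}. ereal (H x p))"
    by (rule order_tendstoD) simp
  then obtain K0 where K0: "\<And>r. r \<ge> K0 \<Longrightarrow> ereal b < (INF (x, p)\<in>{(x, p). norm x < R' \<and> norm p \<ge> r}. ereal (H x p))"
    unfolding eventually_at_top_linorder by blast
  define K where "K = max 0 K0"
  have "norm p \<le> K" if "norm x \<le> R" "H x p \<le> b" for x p
  proof (rule ccontr)
    assume "\<not> norm p \<le> K"
    then have "(x, p) \<in> {(x, p). norm x < R' \<and> norm p \<ge> K}" using that by (auto simp: R'_def)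
    then have "(INF (x, p)\<in>{(x, p). norm x < R' \<and> norm p \<ge> K}. ereal (H x p)) \<le> ereal (H x p)"
      by (rule INF_lower2) simp
    with K0[of K] have "ereal b < ereal (H x p)" unfolding K_def by (metis less_le_trans max.cobounded2)
    then show False using that by simp
  qed
  moreover have "K \<ge> 0" by (simp add: K_def)
  ultimately show ?thesis using that by blast
qed

text \<open>
  Coercivity confines the sublevel sets over a ball to a compact set, on which \<open>H\<close> is uniformly
  continuous; the radius therefore depends on \<open>H\<close> and on the ball only. This uniformity is what
  survives limits of subsolutions and mollification.
\<close>

lemma sublevel_perturb:
  assumes "\<omega> > 0"
  obtains r where "r > 0" "r \<le> 1"
    "\<And>x y p. norm x \<le> R \<Longrightarrow> norm y \<le> R \<Longrightarrow> dist x y < r \<Longrightarrow> H x p \<le> b \<Longrightarrow> H y p \<le> b + \<omega>"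
proof -
  obtain K where K: "K \<ge> 0" "\<And>x p. norm x \<le> R \<Longrightarrow> H x p \<le> b \<Longrightarrow> norm p \<le> K"
    using sublevel_bounded by blast
  have "uniformly_continuous_on (cball 0 R \<times> cball 0 K) (\<lambda>(x, p). H x p)"
    by (intro compact_uniformly_continuous compact_Times compact_cball continuous_on_subset[OF cont_H]) auto
  then obtain r where r: "r > 0"
    "\<And>a a'. a \<in> cball 0 R \<times> cball 0 K \<Longrightarrow> a' \<in> cball 0 R \<times> cball 0 K \<Longrightarrow> dist a' a < r \<Longrightarrow>
      dist ((\<lambda>(x, p). H x p) a') ((\<lambda>(x, p). H x p) a) < \<omega>"
    using \<open>\<omega> > 0\<close> unfolding uniformly_continuous_on_def by metis
  show ?thesis
  proof
    fix x y p assume *: "norm x \<le> R" "norm y \<le> R" "dist x y < min r 1" "H x p \<le> b"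
    have "dist (H x p) (H y p) < \<omega>"
      using r(2)[of "(y, p)" "(x, p)"] * K(2)[of x p] by (simp add: dist_Pair_Pair)
    then show "H y p \<le> b + \<omega>" using *(4) unfolding dist_real_def by linarith
  qed (use r in auto)
qed

text \<open>
  Continuity and test functions are global, only the inequality is local, so that a discounted
  subsolution on the whole space can be used at different levels on different balls.
\<close>

definition subsolution_in_ball :: "real \<Rightarrow> real \<Rightarrow> ('a \<Rightarrow> real) \<Rightarrow> bool" where
  "subsolution_in_ball R b u \<longleftrightarrow>
     continuous_on UNIV u \<and> (\<forall>x p. norm x < R \<longrightarrow> supergradient u x p \<longrightarrow> H x p \<le> b)"

lemma subsolution_slopes_cball:
  obtains K where "K \<ge> 0" "\<And>u. subsolution_in_ball R b u \<Longrightarrow> slopes_in (cball 0 K) (ball 0 R) u"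
proof -
  obtain K where K: "K \<ge> 0" "\<And>x p. norm x \<le> R \<Longrightarrow> H x p \<le> b \<Longrightarrow> norm p \<le> K"
    using sublevel_bounded by blast
  show ?thesis
  proof
    fix u assume u: "subsolution_in_ball R b u"
    show "slopes_in (cball 0 K) (ball 0 R) u"
      by (rule slopes_in_of_supergradients)
         (use u K(2) in \<open>auto simp: subsolution_in_ball_def dist_norm intro: continuous_on_subset less_imp_le\<close>)
  qed fact
qed

lemma subsolution_slopes_sublevel:
  fixes R b :: real
  assumes "\<omega> > 0"
  obtains r where "r > 0" "r \<le> 1"
    "\<And>u (x::'a). subsolution_in_ball (R + 1) b u \<Longrightarrow> norm x \<le> R \<Longrightarrow> slopes_in {p. H x p \<le> b + \<omega>} (ball x r) u"
proof -
  obtain r where r: "r > 0" "r \<le> 1"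
    "\<And>x y p. norm x \<le> R + 1 \<Longrightarrow> norm y \<le> R + 1 \<Longrightarrow> dist x y < r \<Longrightarrow> H x p \<le> b \<Longrightarrow> H y p \<le> b + \<omega>"
    using sublevel_perturb[OF assms, of "R + 1" b] by blast
  show ?thesis
  proof
    fix u and x :: 'a assume u: "subsolution_in_ball (R + 1) b u" and x: "norm x \<le> R"
    show "slopes_in {p. H x p \<le> b + \<omega>} (ball x r) u"
    proof (rule slopes_in_of_supergradients)
      fix y p assume y: "y \<in> ball x r" and p: "supergradient u y p"
      have "norm y \<le> norm x + dist x y" by (metis dist_norm norm_minus_commute norm_triangle_sub)
      then have "norm y < R + 1" using x y r by simp
      then show "p \<in> {p. H x p \<le> b + \<omega>}"
        using u p y r(3)[of y x p] x by (auto simp: subsolution_in_ball_def dist_commute)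
    qed (use u in \<open>auto simp: subsolution_in_ball_def intro: continuous_on_subset\<close>)
  qed (use r in auto)
qed

text \<open>
  Conversely, local slopes in slightly larger sublevel sets of
  \<open>H x\<close> are enough to recover the viscosity inequality at \<open>x\<close>.
\<close>

lemma level_from_slopes:
  assumes "\<And>\<omega>. \<omega> > 0 \<Longrightarrow> \<exists>r>0. slopes_in {p. H x p \<le> b + \<omega>} (ball x r) u"
    and "supergradient u x p"
  shows "H x p \<le> b"
proof (rule field_le_epsilon)
  fix \<omega> :: real assume "\<omega> > 0"
  then obtain r where "r > 0" "slopes_in {p. H x p \<le> b + \<omega>} (ball x r) u" using assms(1) by blast
  then show "H x p \<le> b + \<omega>"
    using supergradient_in_slopes[OF closed_sublevel convex_sublevel _ _ assms(2)] by blast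
qed

text \<open>
  The pointwise upper limit of \<open>u n - u n 0\<close> has the required property: it is finite by the local
  Lipschitz bounds, and every bound on increments that holds for large \<open>n\<close> is inherited. No
  subsequence has to be extracted.
\<close>
lemma subsolution_limit:
  assumes u: "\<And>R b'. b < b' \<Longrightarrow> \<forall>\<^sub>F n in sequentially. subsolution_in_ball R b' (u n)"
  shows "\<exists>w. continuous_on UNIV w \<and> (\<forall>x p. supergradient w x p \<longrightarrow> H x p \<le> b)"
proof -
  define d where "d n x = u n x - u n 0" for n x
  have local_lip: "\<exists>K\<ge>0. \<forall>\<^sub>F n in sequentially. slopes_in (cball 0 K) (ball 0 R) (u n)" for R
  proof -
    obtain K where K: "K \<ge> 0" "\<And>u. subsolution_in_ball R (b + 1) u \<Longrightarrow> slopes_in (cball 0 K) (ball 0 R) u"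
      using subsolution_slopes_cball by blast
    have "\<forall>\<^sub>F n in sequentially. subsolution_in_ball R (b + 1) (u n)" using u by simp
    then have "\<forall>\<^sub>F n in sequentially. slopes_in (cball 0 K) (ball 0 R) (u n)"
      by (rule eventually_mono) (rule K(2))
    then show ?thesis using K(1) by blast
  qed
  define U where "U x = {M. \<forall>\<^sub>F n in sequentially. d n x \<le> M}" for x
  define w where "w x = Inf (U x)" for x
  have bounded_d: "\<exists>M. \<forall>\<^sub>F n in sequentially. \<bar>d n x\<bar> \<le> M" for x
  proof -
    obtain K where K: "K \<ge> 0" "\<forall>\<^sub>F n in sequentially. slopes_in (cball 0 K) (ball 0 (norm x + 1)) (u n)"
      using local_lip by blast
    have "\<forall>\<^sub>F n in sequentially. \<bar>d n x\<bar> \<le> K * norm x"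
      using K(2)
    proof eventually_elim
      case (elim n)
      have "x \<in> ball 0 (norm x + 1)" "0 \<in> ball (0::'a) (norm x + 1)"
        by (auto intro: add_nonneg_pos)
      with elim have "u n x - u n 0 \<le> K * norm (x - 0)" "u n 0 - u n x \<le> K * norm (0 - x)"
        unfolding slopes_in_cball_iff[OF K(1)] by blast+
      then show ?case by (simp add: d_def abs_le_iff)
    qed
    then show ?thesis by blast
  qed
  have U_ne: "U x \<noteq> {}" and U_bdd: "bdd_below (U x)" for x
  proof -
    obtain M where M: "\<forall>\<^sub>F n in sequentially. \<bar>d n x\<bar> \<le> M" using bounded_d by blast
    then have "\<forall>\<^sub>F n in sequentially. d n x \<le> M" by eventually_elim auto
    then show "U x \<noteq> {}" unfolding U_def by blast
    show "bdd_below (U x)"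
    proof (rule bdd_belowI)
      fix M' assume "M' \<in> U x"
      then have "\<forall>\<^sub>F n in sequentially. d n x \<le> M'" by (simp add: U_def)
      with M have "\<forall>\<^sub>F n in sequentially. - M \<le> M'" by eventually_elim auto
      then show "- M \<le> M'" by simp
    qed
  qed
  have limit_slopes: "slopes_in Z B w" if "\<forall>\<^sub>F n in sequentially. slopes_in Z B (u n)" for Z B
  proof (rule slopes_inI)
    fix x y c assume *: "x \<in> B" "y \<in> B" "\<And>p. p \<in> Z \<Longrightarrow> p \<bullet> (y - x) \<le> c"
    have "w y - c \<le> w x" unfolding w_def[of x]
    proof (rule cInf_greatest[OF U_ne])
      fix M assume "M \<in> U x"
      then have "\<forall>\<^sub>F n in sequentially. d n x \<le> M" by (simp add: U_def)
      with that have "\<forall>\<^sub>F n in sequentially. d n y \<le> M + c"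
      proof eventually_elim
        case (elim n)
        have "u n y - u n x \<le> c" using elim * by (blast intro: slopes_inD)
        then show ?case using elim by (simp add: d_def)
      qed
      then have "M + c \<in> U y" by (simp add: U_def)
      then have "w y \<le> M + c" unfolding w_def using U_bdd by (rule cInf_lower)
      then show "w y - c \<le> M" by simp
    qed
    then show "w y - w x \<le> c" by simp
  qed
  have "continuous_on (ball 0 R) w" for R
  proof -
    obtain K where K: "K \<ge> 0" "\<forall>\<^sub>F n in sequentially. slopes_in (cball 0 K) (ball 0 R) (u n)"
      using local_lip by blast
    show ?thesis
      using slopes_in_cball_lipschitz[OF K(1) limit_slopes[OF K(2)]] by (rule lipschitz_on_continuous_on)
  qed
  then have "isCont w x" for x
    using continuous_on_eq_continuous_at[of "ball 0 (norm x + 1)" w] by simp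
  then have "continuous_on UNIV w" by (simp add: continuous_at_imp_continuous_on)
  moreover have "H x p \<le> b" if "supergradient w x p" for x p
    using _ that
  proof (rule level_from_slopes)
    fix \<omega> :: real assume "\<omega> > 0"
    then have half: "\<omega> / 2 > 0" by simp
    obtain r where r: "r > 0"
      "\<And>u y. subsolution_in_ball (norm x + 1) (b + \<omega> / 2) u \<Longrightarrow> norm y \<le> norm x \<Longrightarrow>
         slopes_in {p. H y p \<le> b + \<omega> / 2 + \<omega> / 2} (ball y r) u"
      using subsolution_slopes_sublevel[OF half] by metis
    have "\<forall>\<^sub>F n in sequentially. subsolution_in_ball (norm x + 1) (b + \<omega> / 2) (u n)"
      using u half by simp
    then have "\<forall>\<^sub>F n in sequentially. slopes_in {p. H x p \<le> b + \<omega>} (ball x r) (u n)"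
      by (rule eventually_mono) (use r(2)[of _ x] in \<open>simp add: add.commute\<close>)
    then show "\<exists>r>0. slopes_in {p. H x p \<le> b + \<omega>} (ball x r) w"
      using limit_slopes r(1) by blast
  qed
  ultimately show ?thesis by blast
qed

text \<open>
  Supergradients exist in every ball, so the level bounds \<open>min\<^sub>p H(y, p)\<close> at points \<open>y\<close> arbitrarily
  close to \<open>x\<close>.
\<close>

lemma min_H_le_level:
  assumes w: "continuous_on UNIV w" "\<And>x p. supergradient w x p \<Longrightarrow> H x p \<le> b"
  shows "(INF p. H x p) \<le> b"
proof -
  have bdd: "bdd_below (range (H x))"
  proof -
    obtain K where K: "\<And>y p. norm y \<le> norm x \<Longrightarrow> H y p \<le> 0 \<Longrightarrow> norm p \<le> K" "K \<ge> 0" using sublevel_bounded by metis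
    have "continuous_on (cball 0 K) (H x)" by (intro continuous_on_H continuous_on_const continuous_on_id)
    then have "compact (H x ` cball 0 K)" using compact_cball by (rule compact_continuous_image)
    then have "bdd_below (H x ` cball 0 K)" by (intro bounded_imp_bdd_below compact_imp_bounded)
    then obtain m where "\<And>p. p \<in> cball 0 K \<Longrightarrow> m \<le> H x p"
      unfolding bdd_below_def by blast
    then have "H x p \<le> 0 \<Longrightarrow> m \<le> H x p" for p
      using K(1)[of x p] by simp
    then have "min m 0 \<le> H x p" for p
      by (cases "H x p \<le> 0") (simp_all add: min_le_iff_disj)
    then show ?thesis by (intro bdd_belowI[of _ "min m 0"]) auto
  qed
  show ?thesis
  proof (rule field_le_epsilon)
    fix \<omega> :: real assume "\<omega> > 0"
    obtain r where r: "r > 0" "r \<le> 1" "\<And>y z p. norm y \<le> norm x + 1 \<Longrightarrow> norm z \<le> norm x + 1 \<Longrightarrow> dist y z < r \<Longrightarrow>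
        H y p \<le> b \<Longrightarrow> H z p \<le> b + \<omega>" using sublevel_perturb[OF \<open>\<omega> > 0\<close>] by blast
    have "\<exists>y p. y \<in> ball x r \<and> supergradient w y p"
    proof (rule ccontr)
      assume "\<not> ?thesis"
      then have "slopes_in {} (ball x r) w"
        using w(1) by (intro slopes_in_of_supergradients) (auto intro: continuous_on_subset)
      then have "w x - w x \<le> -1" using r(1) by (intro slopes_inD) auto
      then show False by simp
    qed
    then obtain y p where yp: "dist y x < r" "supergradient w y p" by (auto simp: dist_commute)
    have "norm y \<le> norm x + dist y x" by (simp add: dist_norm norm_triangle_sub)
    then have "H x p \<le> b + \<omega>" using r(2) r(3)[of y x p] yp w(2) by simp
    moreover have "(INF p. H x p) \<le> H x p" using bdd by (intro cINF_lower) auto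
    ultimately show "(INF p. H x p) \<le> b + \<omega>" by linarith
  qed
qed

end

section \<open>Truncated Lagrangians\<close>

text \<open>
  Restricting the maximum to \<open>|p| \<le> K\<close> gives functions that are continuous, grow linearly in \<open>q\<close> and
  increase to the Lagrangian. A function with gradients bounded by \<open>K\<close> cannot distinguish
  between the two, so all tests can be made with truncations.
\<close>

definition truncated_lagrangian :: "('a::euclidean_space \<Rightarrow> 'a \<Rightarrow> real) \<Rightarrow> real \<Rightarrow> 'a \<times> 'a \<Rightarrow> real" where
  "truncated_lagrangian H K = (\<lambda>(x, q). SUP p\<in>cball 0 K. p \<bullet> q - H x p)"

context convex_hamiltonian
begin

lemma truncated_lagrangian_upper:
  assumes "norm p \<le> K"
  shows "p \<bullet> q - H x p \<le> truncated_lagrangian H K (x, q)"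
proof -
  have "compact ((\<lambda>p. p \<bullet> q - H x p) ` cball 0 K)"
    by (intro compact_continuous_image continuous_on_diff continuous_on_inner continuous_on_H
          continuous_on_const continuous_on_id compact_cball)
  then have "bdd_above ((\<lambda>p. p \<bullet> q - H x p) ` cball 0 K)"
    by (intro bounded_imp_bdd_above compact_imp_bounded)
  then show ?thesis
    unfolding truncated_lagrangian_def using assms by (auto intro: cSUP_upper)
qed

lemma truncated_lagrangian_least:
  assumes "K \<ge> 0" "\<And>p. norm p \<le> K \<Longrightarrow> p \<bullet> q - H x p \<le> c"
  shows "truncated_lagrangian H K (x, q) \<le> c"
  unfolding truncated_lagrangian_def prod.case
  by (rule cSUP_least) (use assms in auto)

lemma continuous_on_truncated_lagrangian:
  assumes "K \<ge> 0"
  shows "continuous_on UNIV (truncated_lagrangian H K)"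
proof -
  define h where "h z = snd z \<bullet> snd (fst z) - H (fst (fst z)) (snd z)" for z :: "('a \<times> 'a) \<times> 'a"
  have cont_h: "continuous_on S h" for S
    unfolding h_def by (intro continuous_intros)
  have "isCont (truncated_lagrangian H K) (x0, q0)" for x0 q0
    unfolding continuous_at_eps_delta
  proof (intro allI impI)
    fix \<epsilon> :: real assume \<epsilon>: "\<epsilon> > 0"
    have "uniformly_continuous_on (cball (x0, q0) 1 \<times> cball 0 K) h"
      by (intro compact_uniformly_continuous cont_h compact_Times compact_cball)
    moreover have "\<epsilon> / 2 > 0" using \<epsilon> by simp
    ultimately obtain r where r: "r > 0" "\<And>z z'. z \<in> cball (x0, q0) 1 \<times> cball 0 K \<Longrightarrow>
        z' \<in> cball (x0, q0) 1 \<times> cball 0 K \<Longrightarrow> dist z' z < r \<Longrightarrow> dist (h z') (h z) < \<epsilon> / 2"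
      unfolding uniformly_continuous_on_def by metis
    have "dist (truncated_lagrangian H K y) (truncated_lagrangian H K (x0, q0)) < \<epsilon>"
      if "dist y (x0, q0) < min r 1" for y
    proof -
      obtain x q where y: "y = (x, q)" by (cases y)
      have close: "\<bar>h (y, p) - h ((x0, q0), p)\<bar> < \<epsilon> / 2" if "norm p \<le> K" for p
        using r(2)[of "((x0, q0), p)" "(y, p)"] \<open>dist y (x0, q0) < min r 1\<close> that
        by (simp add: dist_Pair_Pair[of y] dist_commute dist_real_def)
      have "truncated_lagrangian H K (x, q) \<le> truncated_lagrangian H K (x0, q0) + \<epsilon> / 2"
      proof (rule truncated_lagrangian_least[OF assms])
        fix p :: 'a assume "norm p \<le> K"
        from close[OF this] truncated_lagrangian_upper[OF this, of q0 x0]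
        show "p \<bullet> q - H x p \<le> truncated_lagrangian H K (x0, q0) + \<epsilon> / 2"
          unfolding h_def y fst_conv snd_conv by linarith
      qed
      moreover have "truncated_lagrangian H K (x0, q0) \<le> truncated_lagrangian H K (x, q) + \<epsilon> / 2"
      proof (rule truncated_lagrangian_least[OF assms])
        fix p :: 'a assume "norm p \<le> K"
        from close[OF this] truncated_lagrangian_upper[OF this, of q x]
        show "p \<bullet> q0 - H x0 p \<le> truncated_lagrangian H K (x, q) + \<epsilon> / 2"
          unfolding h_def y fst_conv snd_conv by linarith
      qed
      ultimately show ?thesis using \<epsilon> unfolding y dist_real_def by linarith
    qed
    then show "\<exists>d>0. \<forall>y. dist y (x0, q0) < d \<longrightarrow>
        dist (truncated_lagrangian H K y) (truncated_lagrangian H K (x0, q0)) < \<epsilon>"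
      using r(1) by (intro exI[of _ "min r 1"]) auto
  qed
  then show ?thesis by (auto intro: continuous_at_imp_continuous_on)
qed

lemma truncated_lagrangian_mono:
  assumes "0 \<le> K" "K \<le> K'"
  shows "truncated_lagrangian H K y \<le> truncated_lagrangian H K' y"
  using assms by (cases y) (auto intro!: truncated_lagrangian_least truncated_lagrangian_upper)

lemma truncated_lagrangian_growth:
  assumes "K \<ge> 0" "\<And>p. norm p \<le> K \<Longrightarrow> H x p \<le> c"
  shows "K * norm q - c \<le> truncated_lagrangian H K (x, q)"
proof -
  define p where "p = (K / norm q) *\<^sub>R q"
  have "p \<bullet> q = K * norm q" "norm p \<le> K"
    using assms(1) by (cases "q = 0"; simp add: p_def dot_square_norm power2_eq_square)+
  then show ?thesis using truncated_lagrangian_upper[of p K q x] assms(2)[of p] by linarith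
qed

end

locale superlinear_hamiltonian = convex_hamiltonian +
  assumes superlinear_H: "superlinear H"
begin

lemma bdd_above_lagrangian: "bdd_above (range (\<lambda>p. p \<bullet> q - H x p))"
proof -
  have "filterlim (\<lambda>p. H x p / norm p) at_top at_infinity"
    using superlinear_H by (simp add: superlinear_def)
  then have "\<forall>\<^sub>F p in at_infinity. norm q \<le> H x p / norm p"
    unfolding filterlim_at_top by blast
  then obtain B where B: "\<And>p. norm p \<ge> B \<Longrightarrow> norm q \<le> H x p / norm p"
    unfolding eventually_at_infinity by blast
  define B' where "B' = max B 1"
  have "p \<bullet> q - H x p \<le> max 0 (truncated_lagrangian H B' (x, q))" for p
  proof (cases "norm p \<le> B'")
    case False
    then have "norm p > 0" "norm q \<le> H x p / norm p" using B[of p] by (auto simp: B'_def)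
    then have "norm p * norm q \<le> H x p" by (simp add: field_simps)
    then show ?thesis using norm_cauchy_schwarz[of p q] by linarith
  qed (use truncated_lagrangian_upper[of p B' q x] in linarith)
  then show ?thesis by (intro bdd_aboveI) auto
qed

lemma truncated_le_lagrangian:
  assumes "K \<ge> 0"
  shows "truncated_lagrangian H K y \<le> lagrangian H y"
  using assms bdd_above_lagrangian
  by (cases y) (auto intro!: truncated_lagrangian_least cSUP_upper simp: lagrangian_def)

lemma truncated_tendsto_lagrangian:
  "(\<lambda>n. truncated_lagrangian H (real n) y) \<longlonglongrightarrow> lagrangian H y"
proof (rule increasing_LIMSEQ)
  fix e :: real assume "e > 0"
  obtain x q where y: "y = (x, q)" by (cases y)
  have "(SUP p. p \<bullet> q - H x p) - e < (SUP p. p \<bullet> q - H x p)" using \<open>e > 0\<close> by simp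
  then obtain p where "(SUP p. p \<bullet> q - H x p) - e < p \<bullet> q - H x p"
    using less_cSUP_iff[OF _ bdd_above_lagrangian] by blast
  moreover obtain n where "norm p \<le> real n" using real_arch_simple by blast
  ultimately show "\<exists>n. lagrangian H y \<le> truncated_lagrangian H (real n) y + e"
    using truncated_lagrangian_upper[of p "real n" q x]
    unfolding y lagrangian_def prod.case by (intro exI[of _ n]) linarith
qed (auto intro: truncated_lagrangian_mono truncated_le_lagrangian)

lemma borel_measurable_lagrangian [measurable]: "lagrangian H \<in> borel_measurable borel"
  by (rule borel_measurable_LIMSEQ_real[OF truncated_tendsto_lagrangian])
     (intro borel_measurable_continuous_onI continuous_on_truncated_lagrangian, simp)

end

section \<open>Mollification\<close>

text \<open>
  An even kernel of class \<open>C\<^sup>1\<close> supported in the ball of radius \<open>e\<close>.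
\<close>

definition bump :: "real \<Rightarrow> 'a::euclidean_space \<Rightarrow> real" where
  "bump e w = (max 0 (e\<^sup>2 - w \<bullet> w))\<^sup>2"

lemma bump_nonneg: "bump e w \<ge> 0"
  by (simp add: bump_def)

lemma continuous_on_bump [continuous_intros]:
  "continuous_on S f \<Longrightarrow> continuous_on S (\<lambda>x. bump e (f x))"
  unfolding bump_def by (intro continuous_intros)

lemma bump_eq_0:
  assumes "e > 0" "norm w \<ge> e"
  shows "bump e w = 0"
proof -
  have "e\<^sup>2 \<le> (norm w)\<^sup>2" using assms by (intro power_mono) auto
  then show ?thesis by (simp add: bump_def dot_square_norm)
qed

lemma has_field_derivative_pos_part_square:
  "((\<lambda>s::real. (max 0 s)\<^sup>2) has_field_derivative 2 * max 0 s) (at s)"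
proof (cases s "0::real" rule: linorder_cases)
  case less
  have "((\<lambda>s::real. 0) has_field_derivative 0) (at s)" by simp
  then have "((\<lambda>s::real. (max 0 s)\<^sup>2) has_field_derivative 0) (at s)"
    by (rule has_field_derivative_transform_within_open[where S="{..<0}"]) (use less in auto)
  then show ?thesis using less by simp
next
  case greater
  have "((\<lambda>s::real. s\<^sup>2) has_field_derivative 2 * s) (at s)"
    by (auto intro!: derivative_eq_intros)
  then have "((\<lambda>s::real. (max 0 s)\<^sup>2) has_field_derivative 2 * s) (at s)"
    by (rule has_field_derivative_transform_within_open[where S="{0<..}"]) (use greater in auto)
  then show ?thesis using greater by simp
next
  case equal
  have "((\<lambda>h::real. (max 0 h)\<^sup>2 / h) \<longlongrightarrow> 0) (at 0)"
  proof (rule Lim_null_comparison)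
    show "\<forall>\<^sub>F h in at 0. norm ((max 0 h)\<^sup>2 / h) \<le> \<bar>h::real\<bar>"
      by (rule always_eventually) (auto simp: max_def power2_eq_square)
    show "((\<lambda>h::real. \<bar>h\<bar>) \<longlongrightarrow> 0) (at 0)" by (auto intro!: tendsto_eq_intros)
  qed
  then show ?thesis using equal by (simp add: DERIV_def)
qed

lemma bump_has_derivative:
  fixes t x :: "'a::euclidean_space"
  shows "((\<lambda>x. bump e (t - x)) has_derivative (\<lambda>h. ((4 * max 0 (e\<^sup>2 - (t - x) \<bullet> (t - x))) *\<^sub>R (t - x)) \<bullet> h)) (at x within S)"
proof -
  have "((\<lambda>x. e\<^sup>2 - (t - x) \<bullet> (t - x)) has_derivative (\<lambda>h. 2 * ((t - x) \<bullet> h))) (at x within S)"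
    by (auto intro!: derivative_eq_intros simp: inner_commute algebra_simps)
  from has_derivative_compose[OF this has_field_derivative_pos_part_square[unfolded has_field_derivative_def]]
  show ?thesis unfolding bump_def
    by (rule has_derivative_eq_rhs) (auto simp: fun_eq_iff)
qed

definition mollify :: "real \<Rightarrow> ('a::euclidean_space \<Rightarrow> real) \<Rightarrow> 'a \<Rightarrow> real" where
  "mollify e v x =
     integral (cbox (- (e *\<^sub>R One)) (e *\<^sub>R One)) (\<lambda>w. bump e w * v (x + w)) /
     integral (cbox (- (e *\<^sub>R One)) (e *\<^sub>R One :: 'a)) (bump e)"

lemma norm_le_imp_in_cube:
  fixes w :: "'a::euclidean_space"
  assumes "norm w \<le> e"
  shows "w \<in> cbox (- (e *\<^sub>R One)) (e *\<^sub>R One)"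
  unfolding mem_box
proof (intro ballI)
  fix i :: 'a assume "i \<in> Basis"
  then have "\<bar>w \<bullet> i\<bar> \<le> e" using Basis_le_norm[of i w] assms by simp
  then show "- (e *\<^sub>R One) \<bullet> i \<le> w \<bullet> i \<and> w \<bullet> i \<le> (e *\<^sub>R One) \<bullet> i"
    using \<open>i \<in> Basis\<close> by (auto simp: abs_le_iff)
qed

lemma integral_bump_pos:
  assumes "e > 0"
  shows "integral (cbox (- (e *\<^sub>R One)) (e *\<^sub>R One :: 'a::euclidean_space)) (bump e) > 0"
proof -
  let ?I = "cbox (- (e *\<^sub>R One)) (e *\<^sub>R One :: 'a)"
  have cont: "continuous_on ?I (bump e)" by (intro continuous_on_bump continuous_on_id)
  then have int: "bump e integrable_on ?I" by (rule integrable_continuous)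
  have "integral ?I (bump e) \<ge> 0" by (rule integral_nonneg[OF int]) (rule bump_nonneg)
  moreover have "integral ?I (bump e) \<noteq> 0"
  proof
    assume "integral ?I (bump e) = 0"
    then have "(bump e has_integral 0) ?I" using integrable_integral[OF int] by simp
    moreover have "box (- (e *\<^sub>R One)) (e *\<^sub>R One :: 'a) \<noteq> {}"
      using assms by (auto simp: box_ne_empty)
    moreover have "(0::'a) \<in> ?I" using assms by (intro norm_le_imp_in_cube) auto
    ultimately have "bump e (0::'a) = 0"
      by (intro has_integral_0_cbox_imp_0[OF cont]) (auto simp: bump_nonneg)
    then show False using assms by (simp add: bump_def)
  qed
  ultimately show ?thesis by simp
qed

lemma mollify_bounds:
  assumes "e > 0" and v: "continuous_on UNIV v"
    and le: "\<And>w. norm w < e \<Longrightarrow> v (x + w) - v (y + w) \<le> c"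
  shows "mollify e v x - mollify e v y \<le> c"
proof -
  let ?I = "cbox (- (e *\<^sub>R One)) (e *\<^sub>R One :: 'a)"
  have int: "(\<lambda>w. bump e w * v (x + w)) integrable_on ?I" for x
    by (intro integrable_continuous continuous_intros continuous_on_compose2[OF v]) auto
  have intb: "(\<lambda>w. bump e w * c) integrable_on ?I"
    by (intro integrable_continuous continuous_intros)
  have "integral ?I (\<lambda>w. bump e w * v (x + w)) - integral ?I (\<lambda>w. bump e w * v (y + w))
      = integral ?I (\<lambda>w. bump e w * v (x + w) - bump e w * v (y + w))"
    by (rule integral_diff[symmetric]) (rule int)+
  also have "\<dots> \<le> integral ?I (\<lambda>w. bump e w * c)"
  proof (rule integral_le)
    fix w assume "w \<in> ?I"
    show "bump e w * v (x + w) - bump e w * v (y + w) \<le> bump e w * c"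
    proof (cases "norm w < e")
      case True
      then show ?thesis using mult_left_mono[OF le bump_nonneg] by (simp add: algebra_simps)
    qed (use assms(1) in \<open>simp add: bump_eq_0\<close>)
  qed (intro integrable_diff int intb)+
  also have "\<dots> = integral ?I (bump e) * c" by simp
  finally show ?thesis
    using integral_bump_pos[OF assms(1), where 'a='a]
    by (simp add: mollify_def diff_divide_distrib[symmetric] divide_le_eq mult.commute)
qed

lemma mollify_nonpos:
  assumes "e > 0" and v: "continuous_on UNIV v" and le: "\<And>w. v w \<le> 0"
  shows "mollify e v x \<le> 0"
proof -
  let ?I = "cbox (- (e *\<^sub>R One)) (e *\<^sub>R One :: 'a)"
  have int: "(\<lambda>w. bump e w * v (x + w)) integrable_on ?I"
    by (intro integrable_continuous continuous_intros continuous_on_compose2[OF v]) auto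
  have "integral ?I (\<lambda>w. bump e w * v (x + w)) \<le> integral ?I (\<lambda>w. 0)"
    by (rule integral_le[OF int]) (auto intro: mult_nonneg_nonpos bump_nonneg le)
  then show ?thesis using integral_bump_pos[OF assms(1), where 'a='a]
    by (simp add: mollify_def divide_nonpos_pos)
qed

text \<open>
  An average of translates of \<open>v\<close> has the same bound on its increments.
\<close>

lemma slopes_in_mollify:
  fixes v :: "'a::euclidean_space \<Rightarrow> real"
  assumes "e > 0" "continuous_on UNIV v" "slopes_in Z (ball x (r + e)) v"
  shows "slopes_in Z (ball x r) (mollify e v)"
proof (rule slopes_inI)
  fix y z :: 'a and c assume *: "y \<in> ball x r" "z \<in> ball x r" "\<And>p. p \<in> Z \<Longrightarrow> p \<bullet> (z - y) \<le> c"
  show "mollify e v z - mollify e v y \<le> c"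
  proof (rule mollify_bounds[OF assms(1,2)])
    fix w :: 'a assume "norm w < e"
    then have "y + w \<in> ball x (r + e)" "z + w \<in> ball x (r + e)"
      using *(1,2) norm_triangle_ineq4[of "x - y" w] norm_triangle_ineq4[of "x - z" w]
      by (auto simp: dist_norm algebra_simps)
    then show "v (z + w) - v (y + w) \<le> c"
      using *(3) by (intro slopes_inD[OF assms(3)]) auto
  qed
qed

lemma has_derivative_imp_gradient:
  fixes f :: "'a::euclidean_space \<Rightarrow> real"
  assumes "(f has_derivative D) F"
  obtains p where "D = (\<lambda>h. p \<bullet> h)"
proof
  have "linear D" using assms has_derivative_linear by blast
  from adjoint_works[OF this, of _ 1] show "D = (\<lambda>h. adjoint D 1 \<bullet> h)"
    by (auto simp: fun_eq_iff inner_commute)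
qed

text \<open>
  The derivative falls on the kernel: after a translation the integral runs over a box that does
  not depend on \<open>x\<close>, and one may differentiate under it.
\<close>

lemma mollify_differentiable:
  fixes v :: "'a::euclidean_space \<Rightarrow> real"
  assumes e: "e > 0" and v: "continuous_on UNIV v"
  obtains p where "(mollify e v has_derivative (\<lambda>h. p \<bullet> h)) (at x0)"
proof -
  define I where "I = cbox (- (e *\<^sub>R One)) (e *\<^sub>R One :: 'a)"
  define A B where "A = x0 - (e + 1) *\<^sub>R One" and "B = x0 + (e + 1) *\<^sub>R One"
  define f where "f x y = bump e (y - x) * v y" for x y
  define fx where "fx x y = blinfun_inner_right ((v y * (4 * max 0 (e\<^sup>2 - (y - x) \<bullet> (y - x)))) *\<^sub>R (y - x))" for x y
  have shift: "integral I (\<lambda>w. bump e w * v (x + w)) = integral (cbox A B) (f x)" if "x \<in> ball x0 1" for x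
  proof -
    have "continuous_on (cbox (- (e *\<^sub>R One) + x) (e *\<^sub>R One + x)) (f x)"
      unfolding f_def by (intro continuous_intros continuous_on_subset[OF v]) auto
    then have "(f x has_integral integral (cbox (- (e *\<^sub>R One) + x) (e *\<^sub>R One + x)) (f x)) (cbox (- (e *\<^sub>R One) + x) (e *\<^sub>R One + x))"
      using integrable_continuous integrable_integral by blast
    then have "(f x has_integral integral (cbox (- (e *\<^sub>R One) + x) (e *\<^sub>R One + x)) (f x)) (cbox A B)"
    proof (rule has_integral_on_superset)
      fix y assume "y \<notin> cbox (- (e *\<^sub>R One) + x) (e *\<^sub>R One + x)"
      then have "y - x \<notin> I" by (auto simp: I_def mem_box inner_diff_left inner_add_left algebra_simps)
      then have "\<not> norm (y - x) \<le> e" using norm_le_imp_in_cube unfolding I_def by blast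
      then show "f x y = 0" using e by (simp add: f_def bump_eq_0)
    next
      have "\<bar>(x - x0) \<bullet> i\<bar> \<le> 1" if "i \<in> Basis" for i
        using Basis_le_norm[OF that, of "x - x0"] \<open>x \<in> ball x0 1\<close> by (simp add: dist_norm norm_minus_commute)
      then have "- 1 \<le> (x - x0) \<bullet> i \<and> (x - x0) \<bullet> i \<le> 1" if "i \<in> Basis" for i
        using that by (simp add: abs_le_iff)
      then show "cbox (- (e *\<^sub>R One) + x) (e *\<^sub>R One + x) \<subseteq> cbox A B"
        unfolding A_def B_def by (intro subset_box_imp) (auto simp: inner_add_left inner_diff_left algebra_simps)
    qed
    then have "integral (cbox A B) (f x) = integral (cbox (- (e *\<^sub>R One) + x) (e *\<^sub>R One + x)) (f x)"
      by (rule integral_unique)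
    also have "\<dots> = integral I (f x \<circ> (+) x)" unfolding I_def by (rule integral_shift_cbox_plus[symmetric])
    finally show ?thesis by (simp add: f_def o_def)
  qed
  have "((\<lambda>x. integral (cbox A B) (f x)) has_derivative integral (cbox A B) (fx x0)) (at x0 within ball x0 1)"
  proof (rule leibniz_rule)
    fix x t
    show "((\<lambda>x. f x t) has_derivative blinfun_apply (fx x t)) (at x within ball x0 1)"
      unfolding f_def fx_def
      by (rule has_derivative_eq_rhs[OF has_derivative_mult_left[OF bump_has_derivative]])
         (auto simp: fun_eq_iff algebra_simps)
  next
    fix x show "f x integrable_on cbox A B"
      unfolding f_def by (intro integrable_continuous continuous_intros continuous_on_subset[OF v]) auto
  next
    have "continuous_on S (\<lambda>z. v (snd z))" for S :: "('a \<times> 'a) set"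
      by (rule continuous_on_compose2[OF v]) (auto intro: continuous_intros)
    then show "continuous_on (ball x0 1 \<times> cbox A B) (\<lambda>(x, t). fx x t)"
      unfolding fx_def case_prod_beta
      by (intro bounded_linear.continuous_on[OF bounded_linear_blinfun_inner_right] continuous_intros)
  qed auto
  then have "((\<lambda>x. integral (cbox A B) (f x)) has_derivative integral (cbox A B) (fx x0)) (at x0)"
    using at_within_open[of x0 "ball x0 1"] by simp
  then have "((\<lambda>x. integral I (\<lambda>w. bump e w * v (x + w))) has_derivative integral (cbox A B) (fx x0)) (at x0)"
    by (rule has_derivative_transform_within_open[of _ _ _ _ "ball x0 1"]) (auto simp: shift)
  then have "(mollify e v has_derivative (\<lambda>h. integral (cbox A B) (fx x0) h / integral I (bump e))) (at x0)"
    unfolding mollify_def[abs_def] I_def by (rule bounded_linear.has_derivative[OF bounded_linear_divide])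
  then show ?thesis using has_derivative_imp_gradient that by metis
qed

section \<open>Critical subsolutions and vanishing discount\<close>

locale critical_hamiltonian = superlinear_hamiltonian +
  assumes nondegenerate_H: "nondegenerate_at_infinity H"
    and critical_H: "critical_value H = 0"
begin

text \<open>
  The critical level is attained: take a limit of subsolutions at the levels \<open>1 / (n + 1)\<close>.
\<close>

lemma critical_subsolution:
  obtains w where "continuous_on UNIV w" "\<And>x p. supergradient w x p \<Longrightarrow> H x p \<le> 0"
proof -
  have "\<exists>u. continuous_on UNIV u \<and> (\<forall>x p. supergradient u x p \<longrightarrow> H x p \<le> 1 / real (Suc n))" for n
  proof -
    have "critical_value H < ereal (1 / real (Suc n))" by (simp add: critical_H)
    then obtain a u where "viscosity_subsolution_on UNIV (\<lambda>x r p. H x p - a) u" "ereal a < ereal (1 / real (Suc n))"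
      unfolding critical_value_def INF_less_iff by blast
    then show ?thesis unfolding viscosity_subsolution_on_UNIV_iff by (intro exI[of _ u]) force
  qed
  then obtain u where u: "\<And>n. continuous_on UNIV (u n)"
    "\<And>n x p. supergradient (u n) x p \<Longrightarrow> H x p \<le> 1 / real (Suc n)" by metis
  have "\<forall>\<^sub>F n in sequentially. subsolution_in_ball R b (u n)" if "0 < b" for R b
  proof -
    have "(\<lambda>n. 1 / real (Suc n)) \<longlonglongrightarrow> 0" by (rule LIMSEQ_Suc) (rule lim_1_over_n)
    then have "\<forall>\<^sub>F n in sequentially. 1 / real (Suc n) < b" using that by (rule order_tendstoD)
    then show ?thesis
      by eventually_elim (use u in \<open>fastforce simp: subsolution_in_ball_def\<close>)
  qed
  from subsolution_limit[OF this] show ?thesis using that by blast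
qed

lemma no_strict_subsolution:
  assumes "continuous_on UNIV w" "\<And>x p. supergradient w x p \<Longrightarrow> H x p \<le> a"
  shows "a \<ge> 0"
proof -
  have "viscosity_subsolution_on UNIV (\<lambda>x r p. H x p - a) w"
    unfolding viscosity_subsolution_on_UNIV_iff using assms by simp
  then have "critical_value H \<le> ereal a"
    unfolding critical_value_def by (intro INF_lower) blast
  then show ?thesis by (simp add: critical_H)
qed

text \<open>
  A subsolution at the level \<open>0\<close> forces \<open>max\<^sub>x min\<^sub>p H \<le> 0\<close>, so the condition at infinity makes all
  small \<open>p\<close> strictly subcritical far away.
\<close>

lemma strict_outside_ball:
  obtains \<kappa> \<eta> R where "\<kappa> > 0" "\<eta> > 0" "R > 0"
    "\<And>x p. norm x \<ge> R \<Longrightarrow> norm p \<le> \<kappa> \<Longrightarrow> H x p \<le> - \<eta>"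
proof -
  obtain w where w: "continuous_on UNIV w" "\<And>x p. supergradient w x p \<Longrightarrow> H x p \<le> 0"
    using critical_subsolution by blast
  obtain \<epsilon> m xm where \<epsilon>: "\<epsilon> > 0" and m: "m = (INF p. H xm p)"
    and lim: "Limsup at_infinity (\<lambda>x. SUP p\<in>ball 0 \<epsilon>. ereal (H x p)) < ereal m"
    using nondegenerate_H unfolding nondegenerate_at_infinity_def by blast
  have "m \<le> 0" unfolding m by (rule min_H_le_level[OF w])
  obtain c where c: "Limsup at_infinity (\<lambda>x. SUP p\<in>ball 0 \<epsilon>. ereal (H x p)) < ereal c" "ereal c < ereal m"
    using ereal_dense2[OF lim] by blast
  have "\<forall>\<^sub>F x in at_infinity. (SUP p\<in>ball 0 \<epsilon>. ereal (H x p)) < ereal c"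
    using c(1) by (rule Limsup_lessD)
  then obtain R where R: "\<And>x. norm x \<ge> R \<Longrightarrow> (SUP p\<in>ball 0 \<epsilon>. ereal (H x p)) < ereal c"
    unfolding eventually_at_infinity by blast
  show ?thesis
  proof
    fix x p :: 'a assume x: "norm x \<ge> max R 1" and p: "norm p \<le> \<epsilon> / 2"
    have "ereal (H x p) \<le> (SUP p\<in>ball 0 \<epsilon>. ereal (H x p))"
      using p \<epsilon> by (intro SUP_upper) auto
    also have "\<dots> < ereal c" using x by (intro R) simp
    finally show "H x p \<le> - (- c)" by simp
  qed (use \<epsilon> c(2) \<open>m \<le> 0\<close> in auto)
qed

lemma H_bounded_above:
  obtains \<kappa> c where "\<kappa> > 0" "c \<ge> 0" "\<And>x p. norm p \<le> \<kappa> \<Longrightarrow> H x p \<le> c"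
proof -
  obtain \<kappa> \<eta> R where *: "\<kappa> > 0" "\<eta> > 0" "\<And>x p. norm x \<ge> R \<Longrightarrow> norm p \<le> \<kappa> \<Longrightarrow> H x p \<le> - \<eta>"
    using strict_outside_ball by metis
  have "compact ((\<lambda>(x, p). H x p) ` (cball 0 R \<times> cball 0 \<kappa>))"
    by (intro compact_continuous_image continuous_on_subset[OF cont_H] compact_Times compact_cball) auto
  then have "bdd_above ((\<lambda>(x, p). H x p) ` (cball 0 R \<times> cball 0 \<kappa>))"
    by (intro bounded_imp_bdd_above compact_imp_bounded)
  then obtain M where M: "\<And>x p. norm x \<le> R \<Longrightarrow> norm p \<le> \<kappa> \<Longrightarrow> H x p \<le> M"
    unfolding bdd_above_def by fastforce
  show ?thesis
  proof
    fix x p :: 'a assume "norm p \<le> \<kappa>"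
    then show "H x p \<le> max M 0" using M[of x p] *(3)[of x p] *(2) by (cases "norm x \<le> R") auto
  qed (use * in auto)
qed

text \<open>
  Start from a critical subsolution \<open>w\<close> with \<open>|w| \<le> C\<close> on a large ball. Outside that ball constants
  and cones of small slope are strict subsolutions. Cutting \<open>w\<close> from below at \<open>- C\<close> and from above
  with a cone \<open>\<psi>\<close> that starts at height \<open>C\<close> leaves \<open>w\<close> unchanged on the ball, and far away, where
  \<open>\<psi> < - C\<close>, only the strict cone remains. Bounds on slopes survive both operations. The final shift by
  \<open>C\<close> makes the result nonpositive.
\<close>

lemma strict_critical_subsolution:
  obtains v R \<kappa> \<eta> where "\<kappa> > 0" "\<eta> > 0" "R > 0" "continuous_on UNIV v" "\<And>x. v x \<le> 0"
    "\<And>x p. supergradient v x p \<Longrightarrow> H x p \<le> 0"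
    "\<And>\<rho> \<omega>. \<omega> > 0 \<Longrightarrow> \<exists>r>0. \<forall>x. norm x \<le> \<rho> \<longrightarrow> slopes_in {p. H x p \<le> \<omega>} (ball x r) v"
    "slopes_in (cball 0 \<kappa>) {x. norm x > R} v"
    "\<And>x p. norm x \<ge> R \<Longrightarrow> norm p \<le> \<kappa> \<Longrightarrow> H x p \<le> - \<eta>"
proof -
  obtain w where w: "continuous_on UNIV w" "\<And>x p. supergradient w x p \<Longrightarrow> H x p \<le> 0"
    using critical_subsolution by blast
  obtain \<kappa> \<eta> R0 where *: "\<kappa> > 0" "\<eta> > 0" "R0 > 0"
    "\<And>x p. norm x \<ge> R0 \<Longrightarrow> norm p \<le> \<kappa> \<Longrightarrow> H x p \<le> - \<eta>"
    using strict_outside_ball by metis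
  obtain C where C0: "C \<ge> 0" and C: "\<And>x. norm x \<le> R0 + 1 \<Longrightarrow> \<bar>w x\<bar> \<le> C"
    using continuous_bounded_on_cball[OF w(1)] by blast
  define \<psi> where "\<psi> x = C - \<kappa> * max 0 (norm x - (R0 + 1))" for x :: 'a
  define v where "v x = min (max (w x) (- C)) (\<psi> x) - C" for x
  define R where "R = R0 + 1 + 2 * C / \<kappa>"
  have R_R0: "R \<ge> R0 + 1" using C0 * by (simp add: R_def)
  have slopes_\<psi>: "slopes_in (cball 0 \<kappa>) B \<psi>" for B
    unfolding slopes_in_cball_iff[OF less_imp_le[OF *(1)]]
  proof (intro ballI)
    fix x y :: 'a
    have "max 0 (norm x - (R0 + 1)) - max 0 (norm y - (R0 + 1)) \<le> norm (y - x)"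
      using norm_triangle_ineq2[of x y] norm_ge_zero[of "x - y"]
      unfolding norm_minus_commute[of y x] max_def by (smt (verit))
    from mult_left_mono[OF this less_imp_le[OF *(1)]]
    show "\<psi> y - \<psi> x \<le> \<kappa> * norm (y - x)" by (simp add: \<psi>_def algebra_simps)
  qed
  have slopes_const: "slopes_in (cball 0 \<kappa>) B (\<lambda>x. - C)" for B
    using * by (simp add: slopes_in_cball_iff)
  have inner: "v x = w x - C" if "norm x \<le> R0 + 1" for x
    using C[OF that] that by (auto simp: v_def \<psi>_def abs_le_iff)
  have outer: "v x = \<psi> x - C" if "norm x > R" for x
  proof -
    have "2 * C / \<kappa> < norm x - (R0 + 1)" using that by (simp add: R_def)
    then have "2 * C < \<kappa> * (norm x - (R0 + 1))" using * by (simp add: field_simps)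
    moreover have "norm x > R0 + 1" using that R_R0 by simp
    ultimately have "\<psi> x < - C" by (simp add: \<psi>_def)
    then show ?thesis by (simp add: v_def)
  qed
  have cont: "continuous_on UNIV v"
    unfolding v_def \<psi>_def by (intro continuous_intros w)
  have slopes: "\<exists>r>0. \<forall>x. norm x \<le> \<rho> \<longrightarrow> slopes_in {p. H x p \<le> \<omega>} (ball x r) v" if \<omega>: "\<omega> > 0" for \<rho> \<omega>
  proof -
    obtain r where r0: "r > 0" "\<And>u x. subsolution_in_ball (\<rho> + 1) 0 u \<Longrightarrow> norm x \<le> \<rho> \<Longrightarrow>
        slopes_in {p. H x p \<le> 0 + \<omega>} (ball x r) u"
      using subsolution_slopes_sublevel[OF \<omega>] by metis
    have "subsolution_in_ball (\<rho> + 1) 0 w" using w by (simp add: subsolution_in_ball_def)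
    then have r: "r > 0" "\<And>x. norm x \<le> \<rho> \<Longrightarrow> slopes_in {p. H x p \<le> \<omega>} (ball x r) w"
      using r0 by simp_all
    have "slopes_in {p. H x p \<le> \<omega>} (ball x (min r (1/2))) v" if x: "norm x \<le> \<rho>" for x
    proof -
      have sw: "slopes_in {p. H x p \<le> \<omega>} (ball x (min r (1/2))) w"
        using r(2)[OF x] by (rule slopes_in_mono) auto
      show ?thesis
      proof (cases "norm x \<le> R0 + 1/2")
        case True
        have "norm y \<le> R0 + 1" if "y \<in> ball x (min r (1/2))" for y
          using that True norm_triangle_sub[of y x] by (simp add: dist_norm norm_minus_commute)
        then have "slopes_in {p. H x p \<le> \<omega>} (ball x (min r (1/2))) v \<longleftrightarrow>
            slopes_in {p. H x p \<le> \<omega>} (ball x (min r (1/2))) (\<lambda>x. w x - C)"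
          by (intro slopes_in_cong inner)
        then show ?thesis using sw by (simp add: slopes_in_shift)
      next
        case False
        have "cball 0 \<kappa> \<subseteq> {p. H x p \<le> \<omega>}"
        proof
          fix p :: 'a assume "p \<in> cball 0 \<kappa>"
          then show "p \<in> {p. H x p \<le> \<omega>}" using *(4)[of x p] *(2) False \<open>\<omega> > 0\<close> by simp
        qed
        then show ?thesis
          unfolding v_def slopes_in_shift
          by (intro slopes_in_min slopes_in_max sw)
             (auto intro: slopes_in_mono[OF slopes_const] slopes_in_mono[OF slopes_\<psi>])
      qed
    qed
    then show ?thesis using r(1) by (intro exI[of _ "min r (1/2)"]) auto
  qed
  show ?thesis
  proof (rule that[OF *(1,2) _ cont _ _ slopes])
    show "R > 0" using R_R0 * by simp
    show "v x \<le> 0" for x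
    proof -
      have "\<psi> x \<le> C" using * by (simp add: \<psi>_def)
      then show ?thesis by (simp add: v_def min_le_iff_disj)
    qed
    show "H x p \<le> 0" if "supergradient v x p" for x p
      using _ that by (rule level_from_slopes) (use slopes[of _ "norm x"] in auto)
    have "slopes_in (cball 0 \<kappa>) {x. norm x > R} v \<longleftrightarrow> slopes_in (cball 0 \<kappa>) {x. norm x > R} (\<lambda>x. \<psi> x - C)"
      by (intro slopes_in_cong outer) simp
    then show "slopes_in (cball 0 \<kappa>) {x. norm x > R} v" using slopes_\<psi> by (simp add: slopes_in_shift)
    show "H x p \<le> - \<eta>" if "R \<le> norm x" "norm p \<le> \<kappa>" for x p
      using *(4)[of x p] R_R0 that by simp
  qed
qed

text \<open>
  The radius \<open>R\<close> and the gain \<open>\<eta>\<close> do not depend on the error \<open>\<delta>\<close>: mollification costs \<open>\<delta>\<close> only on a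
  ball, whereas outside it the gradients keep the bound \<open>\<kappa>\<close> of the cone and \<open>H\<close> stays below \<open>- \<eta>\<close>.
\<close>
lemma smooth_strict_subsolution:
  obtains R \<eta> where "R > 0" "\<eta> > 0"
    "\<And>\<delta>. \<delta> > 0 \<Longrightarrow> \<exists>V K. K \<ge> 0 \<and> locally_lipschitz V \<and> (\<forall>x. V x \<le> 0) \<and>
       (\<forall>x. \<exists>p. (V has_derivative (\<lambda>h. p \<bullet> h)) (at x) \<and> norm p \<le> K \<and>
          H x p \<le> \<delta> - \<eta> * max 0 (min 1 (norm x - R)))"
proof -
  obtain v R \<kappa> \<eta> where v: "\<kappa> > 0" "\<eta> > 0" "R > 0" "continuous_on UNIV v" "\<And>x. v x \<le> 0"
    and slopes: "\<And>\<rho> \<omega>. \<omega> > 0 \<Longrightarrow> \<exists>r>0. \<forall>x. norm x \<le> \<rho> \<longrightarrow> slopes_in {p. H x p \<le> \<omega>} (ball x r) v"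
    and outer: "slopes_in (cball 0 \<kappa>) {x. norm x > R} v"
    and strict: "\<And>x p. norm x \<ge> R \<Longrightarrow> norm p \<le> \<kappa> \<Longrightarrow> H x p \<le> - \<eta>"
    using strict_critical_subsolution by metis
  show ?thesis
  proof (rule that[of "R + 1" \<eta>])
    fix \<delta> :: real assume \<delta>: "\<delta> > 0"
    obtain r where r: "r > 0" "\<And>x. norm x \<le> R + 1 \<Longrightarrow> slopes_in {p. H x p \<le> \<delta>} (ball x r) v"
      using slopes[OF \<delta>] by blast
    define e where "e = min (r / 2) (1 / 4)"
    have e: "e > 0" "e \<le> r / 2" "e \<le> 1 / 4" using r by (auto simp: e_def)
    define V where "V = mollify e v"
    obtain K0 where K0: "K0 \<ge> 0" "\<And>x p. norm x \<le> R + 1 \<Longrightarrow> H x p \<le> \<delta> \<Longrightarrow> norm p \<le> K0"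
      using sublevel_bounded by blast
    define K where "K = max K0 \<kappa>"
    define Z where "Z x = (if norm x \<le> R + 1 then {p. H x p \<le> \<delta>} else cball 0 \<kappa>)" for x
    have V_slopes: "\<exists>r>0. slopes_in (Z x) (ball x r) V" for x
    proof (cases "norm x \<le> R + 1")
      case True
      have "slopes_in {p. H x p \<le> \<delta>} (ball x (r / 2)) V"
        unfolding V_def using r(2)[OF True] e(1) v(4) e(2)
        by (intro slopes_in_mollify) (auto intro: slopes_in_mono[OF _ order_refl])
      then show ?thesis using r(1) True by (intro exI[of _ "r / 2"]) (simp add: Z_def)
    next
      case False
      have "ball x (1/2 + e) \<subseteq> {x. norm x > R}"
      proof
        fix y assume "y \<in> ball x (1/2 + e)"
        then show "y \<in> {x. norm x > R}"
          using False e norm_triangle_sub[of x y] by (simp add: dist_norm)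
      qed
      then have "slopes_in (cball 0 \<kappa>) (ball x (1/2)) V"
        unfolding V_def using e(1) v(4) by (intro slopes_in_mollify slopes_in_mono[OF outer order_refl])
      then show ?thesis using False by (intro exI[of _ "1/2"]) (simp add: Z_def)
    qed
    have Z: "closed (Z x)" "convex (Z x)" "Z x \<subseteq> cball 0 K" for x
      using K0(2)[of x] by (auto simp: Z_def closed_sublevel convex_sublevel K_def le_max_iff_disj)
    have "\<exists>r>0. slopes_in (cball 0 K) (ball x r) V" for x
      using V_slopes[of x] slopes_in_mono[OF _ Z(3) order_refl] by blast
    then have "locally_lipschitz V" using K0(1) by (intro locally_lipschitz_of_slopes[of K]) (auto simp: K_def)
    moreover have "\<forall>x. V x \<le> 0" unfolding V_def using mollify_nonpos e(1) v by blast
    moreover have "\<exists>p. (V has_derivative (\<lambda>h. p \<bullet> h)) (at x) \<and> norm p \<le> K \<and>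
          H x p \<le> \<delta> - \<eta> * max 0 (min 1 (norm x - (R + 1)))" for x
    proof -
      obtain p where p: "(V has_derivative (\<lambda>h. p \<bullet> h)) (at x)"
        unfolding V_def using mollify_differentiable[OF e(1) v(4)] by blast
      have "p \<in> Z x"
        using V_slopes[of x] slopes_in_gradient[OF Z(1,2) _ _ p] by auto
      moreover have "H x p \<le> \<delta> - \<eta> * max 0 (min 1 (norm x - (R + 1)))"
      proof (cases "norm x \<le> R + 1")
        case True
        then show ?thesis using \<open>p \<in> Z x\<close> by (simp add: Z_def max_def)
      next
        case False
        have "\<eta> * max 0 (min 1 (norm x - (R + 1))) \<le> \<eta> * 1" using v(2) by (intro mult_left_mono) auto
        moreover have "H x p \<le> - \<eta>" using False \<open>p \<in> Z x\<close> by (intro strict) (auto simp: Z_def)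
        ultimately show ?thesis using \<delta> by linarith
      qed
      ultimately show ?thesis using p Z(3)[of x] by (intro exI[of _ p]) auto
    qed
    ultimately show "\<exists>V K. K \<ge> 0 \<and> locally_lipschitz V \<and> (\<forall>x. V x \<le> 0) \<and>
       (\<forall>x. \<exists>p. (V has_derivative (\<lambda>h. p \<bullet> h)) (at x) \<and> norm p \<le> K \<and>
          H x p \<le> \<delta> - \<eta> * max 0 (min 1 (norm x - (R + 1))))"
      using K0(1) by (intro exI[of _ V] exI[of _ K]) (auto simp: K_def)
  qed (use v in auto)
qed

text \<open>
  Replace \<open>u\<^sub>n\<close> by \<open>max(u\<^sub>n, v)\<close> with a nonpositive critical subsolution \<open>v\<close>. Then \<open>l\<^sub>n u\<^sub>n\<close> is bounded
  from below on balls, hence the slopes there are bounded uniformly in \<open>n\<close>. As \<open>l\<^sub>n\<close> tends to \<open>0\<close>, the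
  values \<open>l\<^sub>n u\<^sub>n\<close>
  stay above \<open>a / 2\<close> on any given ball from some index on, and the limit is a subsolution
  strictly below the critical level.
\<close>

lemma discounted_values_not_bounded_away:
  assumes l: "\<And>n. l n > 0" "l \<longlonglongrightarrow> 0" and a: "a > 0"
    and u: "\<And>n. viscosity_subsolution_on UNIV (\<lambda>y r p. l n * r + H y p) (u n)"
    and big: "\<And>n. l n * u n z > a"
  shows False
proof -
  obtain v where v: "continuous_on UNIV v" "\<And>x. v x \<le> 0" "\<And>x p. supergradient v x p \<Longrightarrow> H x p \<le> 0"
    using strict_critical_subsolution by metis
  define u' where "u' n x = max (u n x) (v x)" for n x
  have cont: "continuous_on UNIV (u' n)" for n
    using u[of n] v unfolding u'_def viscosity_subsolution_on_UNIV_iff by (intro continuous_intros) auto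
  have sub: "l n * u' n x + H x p \<le> 0" if "supergradient (u' n) x p" for n x p
  proof -
    have "(supergradient (u n) x p \<and> v x \<le> u n x) \<or> (supergradient v x p \<and> u n x \<le> v x)"
      using that unfolding u'_def by (rule supergradient_max)
    then show ?thesis
    proof
      assume "supergradient (u n) x p \<and> v x \<le> u n x"
      then show ?thesis using u[of n] unfolding viscosity_subsolution_on_UNIV_iff by (auto simp: u'_def)
    next
      assume *: "supergradient v x p \<and> u n x \<le> v x"
      then have "l n * v x \<le> 0" using v(2)[of x] less_imp_le[OF l(1)] by (intro mult_nonneg_nonpos) auto
      then show ?thesis using * v(3) by (fastforce simp: u'_def)
    qed
  qed
  obtain lmax where lmax: "\<And>n. l n \<le> lmax"
    using l(2) convergent_imp_Bseq[of l] unfolding convergent_def Bseq_def real_norm_def by (metis abs_le_iff)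
  have lip: "\<exists>K\<ge>0. \<forall>n. slopes_in (cball 0 K) (ball 0 R) (u' n)" for R
  proof -
    obtain B where B: "B \<ge> 0" "\<And>x. norm x \<le> R \<Longrightarrow> \<bar>v x\<bar> \<le> B"
      using continuous_bounded_on_cball[OF v(1)] by blast
    have "subsolution_in_ball R (lmax * B) (u' n)" for n
      unfolding subsolution_in_ball_def
    proof (intro conjI cont allI impI)
      fix x p assume x: "norm x < R" and p: "supergradient (u' n) x p"
      have "H x p \<le> l n * (- u' n x)" using sub[OF p] by simp
      also have "\<dots> \<le> l n * B"
        using B(2)[of x] x less_imp_le[OF l(1)] by (intro mult_left_mono) (auto simp: u'_def)
      also have "\<dots> \<le> lmax * B" using B(1) by (intro mult_right_mono lmax)
      finally show "H x p \<le> lmax * B" .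
    qed
    then show ?thesis using subsolution_slopes_cball[of R "lmax * B"] by metis
  qed
  have "\<forall>\<^sub>F n in sequentially. subsolution_in_ball R b (u' n)" if "- (a / 2) < b" for R b
  proof -
    define R' where "R' = max R (norm z + 1)"
    obtain K where K: "K \<ge> 0" "\<And>n. slopes_in (cball 0 K) (ball 0 R') (u' n)" using lip by blast
    have "(\<lambda>n. l n * (K * (2 * R'))) \<longlonglongrightarrow> 0 * (K * (2 * R'))" using l(2) by (rule tendsto_mult_right)
    then have "\<forall>\<^sub>F n in sequentially. l n * (K * (2 * R')) < a / 2" using a by (intro order_tendstoD(2)[of _ 0]) auto
    then show ?thesis
    proof eventually_elim
      case (elim n)
      show ?case unfolding subsolution_in_ball_def
      proof (intro conjI cont allI impI)
        fix x p assume x: "norm x < R" and p: "supergradient (u' n) x p"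
        have in_ball: "x \<in> ball 0 R'" "z \<in> ball 0 R'" using x by (auto simp: R'_def)
        then have "u' n z - u' n x \<le> K * norm (z - x)"
          using K(2)[of n] unfolding slopes_in_cball_iff[OF K(1)] by blast
        also have "\<dots> \<le> K * (2 * R')"
          using in_ball K(1) norm_triangle_ineq4[of z x] by (intro mult_left_mono) auto
        finally have "l n * (u' n z - u' n x) \<le> l n * (K * (2 * R'))"
          using less_imp_le[OF l(1)] by (rule mult_left_mono)
        moreover have "l n * u n z \<le> l n * u' n z"
          using less_imp_le[OF l(1)] by (intro mult_left_mono) (auto simp: u'_def)
        ultimately have "l n * u' n x > a / 2" using elim big[of n] by (simp add: algebra_simps)
        then show "H x p \<le> b" using sub[OF p] that by linarith
      qed
    qed
  qed
  from subsolution_limit[OF this] obtain w where "continuous_on UNIV w" "\<And>x p. supergradient w x p \<Longrightarrow> H x p \<le> - (a / 2)"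
    by blast
  then have "- (a / 2) \<ge> 0" by (rule no_strict_subsolution)
  then show False using a by simp
qed

lemma limsup_maximal_subsolution:
  assumes l: "\<And>n. l n > 0" "l \<longlonglongrightarrow> 0" and a: "a > 0"
  shows "\<forall>\<^sub>F n in sequentially. l n * maximal_subsolution UNIV H (l n) z \<le> a"
proof (rule ccontr)
  assume "\<not> ?thesis"
  then have "infinite {n. l n * maximal_subsolution UNIV H (l n) z > a}"
    by (simp add: not_eventually not_le frequently_cofinite flip: cofinite_eq_sequentially)
  then obtain s :: "nat \<Rightarrow> nat" where s: "strict_mono s" "\<And>k. l (s k) * maximal_subsolution UNIV H (l (s k)) z > a"
    using infinite_enumerate[of "{n. l n * maximal_subsolution UNIV H (l n) z > a}"] by blast
  obtain v where v: "continuous_on UNIV v" "\<And>x. v x \<le> 0" "\<And>x p. supergradient v x p \<Longrightarrow> H x p \<le> 0"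
    using strict_critical_subsolution by metis
  have "\<exists>u. viscosity_subsolution_on UNIV (\<lambda>y r p. l (s k) * r + H y p) u \<and> l (s k) * u z > a" for k
  proof -
    let ?S = "{u. viscosity_subsolution_on UNIV (\<lambda>y r p. l (s k) * r + H y p) u}"
    have "l (s k) * v x + H x p \<le> 0" if "supergradient v x p" for x p
      using v(3)[OF that] mult_nonneg_nonpos[OF less_imp_le[OF l(1)] v(2)] by (simp add: add_nonpos_nonpos)
    then have "v \<in> ?S" using v(1) by (simp add: viscosity_subsolution_on_UNIV_iff)
    moreover have "a / l (s k) < (SUP u\<in>?S. u z)"
      using s(2)[of k] l(1)[of "s k"] by (simp add: maximal_subsolution_def field_simps)
    ultimately obtain u where "u \<in> ?S" "a / l (s k) < u z"
      using less_cSupE[of "a / l (s k)" "(\<lambda>u. u z) ` ?S"] by blast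
    then show ?thesis using l(1)[of "s k"] by (auto simp: field_simps)
  qed
  then obtain u where "\<And>k. viscosity_subsolution_on UNIV (\<lambda>y r p. l (s k) * r + H y p) (u k)" "\<And>k. l (s k) * u k z > a"
    by metis
  moreover have "(\<lambda>k. l (s k)) \<longlonglongrightarrow> 0" using LIMSEQ_subseq_LIMSEQ[OF l(2) s(1)] by (simp add: o_def)
  ultimately show False using discounted_values_not_bounded_away[of "\<lambda>k. l (s k)" a u z] l(1) a by blast
qed

end

section \<open>Prokhorov's theorem in Euclidean space\<close>

text \<open>
  The distance to the nearest even integer. Writing it with trigonometric functions gives
  continuity and periodicity at once.
\<close>
definition tri :: "real \<Rightarrow> real" where
  "tri t = arccos (cos (pi * t)) / pi"

lemma continuous_on_tri [continuous_intros]: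
  fixes f :: "real \<Rightarrow> real"
  shows "continuous_on S f \<Longrightarrow> continuous_on S (\<lambda>x. tri (f x))"
  unfolding tri_def by (auto intro!: continuous_intros)

lemma tri_periodic: "tri (2 * real n + t) = tri t"
proof -
  have "cos (pi * (2 * real n + t)) = cos (2 * real n * pi + pi * t)" by (simp add: algebra_simps)
  also have "\<dots> = cos (pi * t)" unfolding cos_add by (simp add: cos_2npi sin_2npi)
  finally show ?thesis by (simp add: tri_def)
qed

lemma tri_id: "0 \<le> t \<Longrightarrow> t \<le> 1 \<Longrightarrow> tri t = t"
  by (simp add: tri_def arccos_cos mult_left_le)

text \<open>
  Schoenberg's function: it reads off a ternary digit \<open>0\<close> or \<open>2\<close>, halved, and interpolates in between.
\<close>
definition digit_wave :: "real \<Rightarrow> real" where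
  "digit_wave t = max 0 (min 1 (3 * tri t - 1))"

lemma digit_wave_bounds: "0 \<le> digit_wave t" "digit_wave t \<le> 1"
  by (auto simp: digit_wave_def)

lemma digit_wave_eq:
  assumes "b \<in> {0, 1}" "0 \<le> r" "r \<le> 1/3"
  shows "digit_wave (2 * real n + (2 * b / 3 + r)) = b"
proof -
  have "tri (2 * real n + (2 * b / 3 + r)) = 2 * b / 3 + r"
    unfolding tri_periodic using assms by (intro tri_id) auto
  then show ?thesis using assms by (auto simp: digit_wave_def)
qed

definition ternary :: "(nat \<Rightarrow> nat) \<Rightarrow> real" where
  "ternary b = (\<Sum>n. 2 * real (b n) / 3 ^ Suc n)"

lemma ternary_summable:
  assumes "\<And>n. b n \<le> 1"
  shows "summable (\<lambda>n. 2 * real (b n) / 3 ^ Suc n)"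
proof (rule summable_comparison_test')
  show "summable (\<lambda>n. 2 * (1/3::real) ^ Suc n)" by (intro summable_mult summable_Suc_iff[THEN iffD2] summable_geometric) auto
  show "norm (2 * real (b n) / 3 ^ Suc n) \<le> 2 * (1/3) ^ Suc n" if "n \<ge> 0" for n
    using assms[of n] by (simp add: power_divide field_simps)
qed

lemma ternary_bounds:
  assumes "\<And>n. b n \<le> 1"
  shows "0 \<le> ternary b" "ternary b \<le> 1"
proof -
  show "0 \<le> ternary b" unfolding ternary_def by (intro suminf_nonneg ternary_summable assms) auto
  have "(\<lambda>n. 2 / 3 * (1/3::real) ^ n) sums (2 / 3 * (1 / (1 - 1/3)))"
    by (intro sums_mult geometric_sums) auto
  then have s: "(\<lambda>n. 2 * 1 / 3 ^ Suc n) sums (1::real)" by (simp add: power_divide field_simps)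
  have "ternary b \<le> (\<Sum>n. 2 * 1 / 3 ^ Suc n)"
    unfolding ternary_def
    by (intro suminf_le ternary_summable assms sums_summable[OF s]) (use assms in \<open>simp add: field_simps\<close>)
  then show "ternary b \<le> 1" using sums_unique[OF s] by simp
qed

lemma ternary_shift:
  assumes "\<And>n. b n \<le> 1"
  shows "ternary b = 2 * real (b 0) / 3 + ternary (\<lambda>n. b (Suc n)) / 3"
proof -
  have "ternary b = 2 * real (b 0) / 3 + (\<Sum>n. 2 * real (b (Suc n)) / 3 ^ Suc (Suc n))"
    unfolding ternary_def using suminf_split_head[OF ternary_summable[of b]] assms by simp
  also have "(\<Sum>n. 2 * real (b (Suc n)) / 3 ^ Suc (Suc n)) = (\<Sum>n. 2 * real (b (Suc n)) / 3 ^ Suc n / 3)"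
    by simp
  also have "\<dots> = ternary (\<lambda>n. b (Suc n)) / 3"
    unfolding ternary_def by (intro suminf_divide ternary_summable assms)
  finally show ?thesis .
qed

lemma ternary_scaled:
  assumes "\<And>n. b n \<le> 1"
  shows "\<exists>m::nat. 3 ^ n * ternary b = 2 * real m + ternary (\<lambda>k. b (n + k))"
proof (induction n)
  case 0 show ?case by (auto intro: exI[of _ 0])
next
  case (Suc n)
  then obtain m where "3 ^ n * ternary b = 2 * real m + ternary (\<lambda>k. b (n + k))" by blast
  then have "3 ^ Suc n * ternary b = 2 * real (3 * m + b n) + ternary (\<lambda>k. b (Suc n + k))"
    using ternary_shift[of "\<lambda>k. b (n + k)"] assms by simp
  then show ?case by blast
qed

text \<open>
  Multiplication by \<open>3 ^ n\<close> moves the first \<open>n\<close> digits into an even integer, which the period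
  absorbs, and the digit \<open>b n\<close> to the front.
\<close>

lemma digit_wave_ternary:
  assumes "\<And>n. b n \<le> 1"
  shows "digit_wave (3 ^ n * (2 * real N + ternary b)) = real (b n)"
proof -
  obtain m where m: "3 ^ n * ternary b = 2 * real m + ternary (\<lambda>k. b (n + k))"
    using ternary_scaled[of b n] assms by blast
  have eq: "3 ^ n * (2 * real N + ternary b) = 2 * real (3 ^ n * N + m) + (2 * real (b n) / 3 + ternary (\<lambda>k. b (n + Suc k)) / 3)"
    using m ternary_shift[of "\<lambda>k. b (n + k)"] assms by (simp add: algebra_simps)
  have "b n \<in> {0, 1}" using assms[of n] by auto
  then show ?thesis
    unfolding eq using ternary_bounds[of "\<lambda>k. b (n + Suc k)"] assms by (intro digit_wave_eq) auto
qed

definition binary_digit :: "real \<Rightarrow> nat \<Rightarrow> nat" where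
  "binary_digit y k = nat (\<lfloor>2 ^ Suc k * y\<rfloor> mod 2)"

lemma binary_digit_le: "binary_digit y k \<le> 1"
  by (simp add: binary_digit_def)

lemma binary_digit_partial_sum:
  assumes "0 \<le> y" "y < 1"
  shows "(\<Sum>k<n. real (binary_digit y k) / 2 ^ Suc k) = of_int \<lfloor>2 ^ n * y\<rfloor> / 2 ^ n"
proof (induction n)
  case 0
  have "\<lfloor>y\<rfloor> = 0" using assms by (simp add: floor_eq_iff)
  then show ?case by simp
next
  case (Suc n)
  have "\<lfloor>2 ^ Suc n * y\<rfloor> div 2 = \<lfloor>2 ^ Suc n * y / 2\<rfloor>"
    using floor_divide_of_int_eq floor_divide_real_eq_div[of 2 "2 ^ Suc n * y"] by simp
  also have "\<dots> = \<lfloor>2 ^ n * y\<rfloor>" by simp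
  finally have "\<lfloor>2 ^ Suc n * y\<rfloor> = 2 * \<lfloor>2 ^ n * y\<rfloor> + int (binary_digit y n)"
    unfolding binary_digit_def by (metis mult.commute div_mult_mod_eq int_nat_eq pos_mod_sign zero_less_numeral)
  then have "real_of_int \<lfloor>2 ^ Suc n * y\<rfloor> = 2 * real_of_int \<lfloor>2 ^ n * y\<rfloor> + real (binary_digit y n)" by simp
  with Suc show ?case by (simp add: field_simps)
qed

lemma binary_digit_sums:
  assumes "0 \<le> y" "y < 1"
  shows "(\<lambda>k. real (binary_digit y k) / 2 ^ Suc k) sums y"
  unfolding sums_def binary_digit_partial_sum[OF assms]
proof (rule tendsto_sandwich)
  show "\<forall>\<^sub>F n in sequentially. y - (1/2) ^ n \<le> of_int \<lfloor>2 ^ n * y\<rfloor> / 2 ^ n"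
  proof (rule always_eventually, rule allI)
    fix n
    have "2 ^ n * y - 1 \<le> of_int \<lfloor>2 ^ n * y\<rfloor>" by linarith
    then have "(2 ^ n * y - 1) / 2 ^ n \<le> of_int \<lfloor>2 ^ n * y\<rfloor> / 2 ^ n" by (rule divide_right_mono) auto
    then show "y - (1/2) ^ n \<le> of_int \<lfloor>2 ^ n * y\<rfloor> / 2 ^ n" by (simp add: diff_divide_distrib power_divide)
  qed
  show "\<forall>\<^sub>F n in sequentially. of_int \<lfloor>2 ^ n * y\<rfloor> / 2 ^ n \<le> y"
    by (rule always_eventually) (auto simp: divide_le_eq mult.commute)
  have "(\<lambda>n. y - (1/2) ^ n) \<longlonglongrightarrow> y - 0" by (intro tendsto_intros LIMSEQ_power_zero) auto
  then show "(\<lambda>n. y - (1/2) ^ n) \<longlonglongrightarrow> y" by simp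
qed auto

text \<open>
  The \<open>i\<close>-th coordinate of Schoenberg's space-filling curve in dimension \<open>d\<close>: the digits of \<open>t\<close> at
  the positions congruent to \<open>i\<close> modulo \<open>d\<close>, read as a binary expansion.
\<close>
definition schoenberg :: "nat \<Rightarrow> nat \<Rightarrow> real \<Rightarrow> real" where
  "schoenberg d i t = (\<Sum>k. digit_wave (3 ^ (d * k + i) * t) / 2 ^ Suc k)"

lemma summable_half_powers: "summable (\<lambda>k. 1 / 2 ^ Suc k :: real)"
  using summable_mult[OF summable_geometric[of "1/2::real"], of "1/2"] by (simp add: power_divide)

lemma continuous_on_schoenberg: "continuous_on UNIV (schoenberg d i)"
proof -
  have "uniform_limit UNIV (\<lambda>n t. \<Sum>k<n. digit_wave (3 ^ (d * k + i) * t) / 2 ^ Suc k) (schoenberg d i) sequentially"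
    unfolding schoenberg_def[abs_def]
    by (rule Weierstrass_m_test[OF _ summable_half_powers]) (auto simp: digit_wave_bounds divide_right_mono)
  then show ?thesis
    by (rule uniform_limit_theorem[rotated])
       (auto intro!: always_eventually continuous_intros simp: digit_wave_def)
qed

text \<open>
  Continuous and equal to \<open>n\<close> on \<open>[2n, 2n + 1]\<close>. Used as a scaling factor, it lets the curve fill larger
  and larger cubes on successive intervals.
\<close>
definition plateau :: "real \<Rightarrow> real" where
  "plateau t = (t - tri t) / 2"

lemma plateau_eq: "0 \<le> r \<Longrightarrow> r \<le> 1 \<Longrightarrow> plateau (2 * real n + r) = real n"
  by (simp add: plateau_def tri_periodic tri_id)

text \<open>
  A continuous curve through all of Euclidean space with a Borel right inverse that is bounded on
  bounded sets. A point \<open>x\<close> with \<open>n - 1 \<le> |x| < n\<close> is encoded in \<open>[2n, 2n + 1]\<close> by the interleaved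
  binary digits of its coordinates, rescaled from \<open>(-n, n)\<close> to \<open>(0, 1)\<close>.
\<close>
lemma space_filling_curve:
  obtains g :: "real \<Rightarrow> 'b::euclidean_space" and S :: "'b \<Rightarrow> real"
  where "continuous_on UNIV g" "S \<in> borel_measurable borel" "\<And>x. g (S x) = x"
    "\<And>x. 0 \<le> S x \<and> S x \<le> 2 * norm x + 3"
proof -
  define d where "d = DIM('b)"
  have d: "d > 0" by (simp add: d_def)
  obtain e :: "nat \<Rightarrow> 'b" where e: "bij_betw e {..<d} Basis"
    unfolding d_def using ex_bij_betw_nat_finite[OF finite_Basis] by (auto simp: atLeast0LessThan)
  define N where "N x = nat \<lfloor>norm x\<rfloor> + 1" for x :: 'b
  define Y where "Y x i = (x \<bullet> e i / real (N x) + 1) / 2" for x i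
  define b where "b x n = binary_digit (Y x (n mod d)) (n div d)" for x n
  define S where "S x = 2 * real (N x) + ternary (b x)" for x
  define g where "g t = (\<Sum>i<d. (plateau t * (2 * schoenberg d i t - 1)) *\<^sub>R e i)" for t
  have b1: "b x n \<le> 1" for x n unfolding b_def by (rule binary_digit_le)
  have N: "norm x < real (N x)" "real (N x) \<le> norm x + 1" for x
    unfolding N_def using norm_ge_zero[of x] by linarith+
  have N0: "0 < real (N x)" for x using N(1)[of x] norm_ge_zero[of x] by linarith
  show ?thesis
  proof
    show "continuous_on UNIV g"
      unfolding g_def plateau_def by (intro continuous_intros continuous_on_schoenberg) auto
    have [measurable]: "N \<in> borel \<rightarrow>\<^sub>M count_space UNIV" unfolding N_def by measurable
    have [measurable]: "(\<lambda>x. real (b x n)) \<in> borel_measurable borel" for n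
      unfolding b_def binary_digit_def Y_def by measurable
    show "S \<in> borel_measurable borel"
      unfolding S_def ternary_def by measurable
    show "0 \<le> S x \<and> S x \<le> 2 * norm x + 3" for x
      using ternary_bounds[of "b x"] b1 N[of x] by (simp add: S_def)
    show "g (S x) = x" for x
    proof -
      have "plateau (S x) = real (N x)"
        unfolding S_def using ternary_bounds[of "b x"] b1 by (intro plateau_eq) auto
      moreover have "schoenberg d i (S x) = Y x i" if "i < d" for i
      proof -
        have "\<bar>x \<bullet> e i\<bar> \<le> norm x"
          using e that by (intro Basis_le_norm) (auto simp: bij_betw_def)
        then have "\<bar>x \<bullet> e i\<bar> < real (N x)" using N(1)[of x] by linarith
        then have "0 \<le> Y x i" "Y x i < 1"
          unfolding Y_def using N0[of x] by (auto simp: field_simps abs_less_iff)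
        then have "(\<lambda>k. real (binary_digit (Y x i) k) / 2 ^ Suc k) sums Y x i" by (rule binary_digit_sums)
        moreover have "digit_wave (3 ^ (d * k + i) * S x) = real (binary_digit (Y x i) k)" for k
          unfolding S_def using digit_wave_ternary[of "b x", OF b1] that by (simp add: b_def)
        ultimately show ?thesis unfolding schoenberg_def by (simp add: sums_iff)
      qed
      ultimately have "g (S x) = (\<Sum>i<d. (real (N x) * (2 * Y x i - 1)) *\<^sub>R e i)"
        unfolding g_def by (intro sum.cong) auto
      also have "\<dots> = (\<Sum>i<d. (x \<bullet> e i) *\<^sub>R e i)"
        using N0[of x] by (intro sum.cong) (auto simp: Y_def field_simps)
      also have "\<dots> = (\<Sum>v\<in>Basis. (x \<bullet> v) *\<^sub>R v)"
        by (rule sum.reindex_bij_betw[OF e])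
      also have "\<dots> = x" by (rule euclidean_representation)
      finally show ?thesis .
    qed
  qed
qed

text \<open>
  Needed to absorb the finitely many members of a sequence for which an eventual tightness
  estimate says nothing.
\<close>

lemma radon_probability_tight:
  assumes "radon_probability (\<mu> :: 'b::euclidean_space measure)" "\<epsilon> > 0"
  shows "\<forall>\<^sub>F R in at_top. measure \<mu> {y. norm y > R} < \<epsilon>"
proof -
  interpret prob_space \<mu> using assms by (simp add: radon_probability_def)
  have [measurable_cong]: "sets \<mu> = sets borel" using assms by (simp add: radon_probability_def)
  have space: "space \<mu> = UNIV" using sets_eq_imp_space_eq[of \<mu> borel] assms by (simp add: radon_probability_def)
  have "(\<lambda>n. measure \<mu> {y. norm y > real n}) \<longlonglongrightarrow> measure \<mu> (\<Inter>n. {y. norm y > real n})"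
    by (rule finite_Lim_measure_decseq) (auto simp: decseq_def)
  moreover have "(\<Inter>n. {y::'b. norm y > real n}) = {}"
  proof (rule equals0I)
    fix y :: 'b assume "y \<in> (\<Inter>n. {y. norm y > real n})"
    moreover obtain n where "norm y < real n" using reals_Archimedean2 by blast
    ultimately show False by (auto dest: spec[of _ n])
  qed
  ultimately have "(\<lambda>n. measure \<mu> {y. norm y > real n}) \<longlonglongrightarrow> 0" by simp
  then have "\<forall>\<^sub>F n in sequentially. measure \<mu> {y. norm y > real n} < \<epsilon>" using assms(2) by (rule order_tendstoD)
  then obtain n where n: "measure \<mu> {y. norm y > real n} < \<epsilon>" using eventually_happens' sequentially_bot by blast
  have "measure \<mu> {y. norm y > R} < \<epsilon>" if "R \<ge> real n" for R
  proof -
    have "measure \<mu> {y. norm y > R} \<le> measure \<mu> {y. norm y > real n}"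
      using that by (intro finite_measure_mono) auto
    then show ?thesis using n by simp
  qed
  then show ?thesis unfolding eventually_at_top_linorder by blast
qed

text \<open>
  The Borel right inverse \<open>S\<close> of a space-filling curve \<open>g\<close> transports the measures to the real line,
  where Helly's selection theorem applies. The weak limit is pushed forward by the continuous
  map \<open>g\<close>; since \<open>g \<circ> S\<close> is the identity, integrals of bounded continuous functions converge.
\<close>

theorem prokhorov_euclidean:
  fixes \<mu> :: "nat \<Rightarrow> 'b::euclidean_space measure"
  assumes rp: "\<And>j. radon_probability (\<mu> j)"
    and tight: "\<And>\<epsilon>. \<epsilon> > 0 \<Longrightarrow> \<exists>R. \<forall>\<^sub>F j in sequentially. measure (\<mu> j) {y. norm y > R} < \<epsilon>"
  shows "\<exists>s \<nu>. strict_mono s \<and> radon_probability \<nu> \<and> narrowly_converges (\<lambda>k. \<mu> (s k)) \<nu>"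
proof -
  obtain g :: "real \<Rightarrow> 'b" and S :: "'b \<Rightarrow> real" where g: "continuous_on UNIV g" and S [measurable]: "S \<in> borel_measurable borel"
    and gS: "\<And>x. g (S x) = x" and S_bd: "\<And>x. 0 \<le> S x \<and> S x \<le> 2 * norm x + 3"
    using space_filling_curve by blast
  have [measurable]: "g \<in> borel_measurable borel" using g by (rule borel_measurable_continuous_onI)
  have sets_\<mu> [measurable_cong]: "sets (\<mu> j) = sets borel" for j using rp by (simp add: radon_probability_def)
  have space_\<mu>: "space (\<mu> j) = UNIV" for j using sets_eq_imp_space_eq[OF sets_\<mu>] by simp
  have P: "prob_space (\<mu> j)" for j using rp by (simp add: radon_probability_def)
  define m where "m j = distr (\<mu> j) borel S" for j
  have rd: "real_distribution (m j)" for j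
    unfolding m_def by (intro real_distribution.intro prob_space.prob_space_distr P) (auto simp: real_distribution_axioms_def)
  have "tight m"
    unfolding tight_def
  proof (intro conjI allI impI)
    fix \<epsilon> :: real assume \<epsilon>: "\<epsilon> > 0"
    obtain R0 j0 where R0: "\<And>j. j \<ge> j0 \<Longrightarrow> measure (\<mu> j) {y. norm y > R0} < \<epsilon>"
      using tight[OF \<epsilon>] unfolding eventually_sequentially by blast
    have "\<forall>\<^sub>F R in at_top. \<forall>j\<in>{..<j0}. measure (\<mu> j) {y. norm y > R} < \<epsilon>"
      using radon_probability_tight[OF rp \<epsilon>] by (intro eventually_ball_finite) auto
    moreover have "\<forall>\<^sub>F R in at_top. R \<ge> max R0 0" by (rule eventually_ge_at_top)
    ultimately have "\<forall>\<^sub>F R in at_top. R \<ge> max R0 0 \<and> (\<forall>j\<in>{..<j0}. measure (\<mu> j) {y. norm y > R} < \<epsilon>)"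
      by eventually_elim auto
    then obtain R where R: "R \<ge> max R0 0" "\<And>j. j < j0 \<Longrightarrow> measure (\<mu> j) {y. norm y > R} < \<epsilon>"
      using eventually_happens' trivial_limit_at_top_linorder by (metis (no_types, lifting) lessThan_iff)
    have "measure (m j) {-1<..2 * R + 3} > 1 - \<epsilon>" for j
    proof -
      interpret prob_space "\<mu> j" by (rule P)
      have "measure (\<mu> j) {y. norm y > R} < \<epsilon>"
      proof (cases "j < j0")
        case False
        have "measure (\<mu> j) {y. norm y > R} \<le> measure (\<mu> j) {y. norm y > R0}"
          using R(1) by (intro finite_measure_mono) auto
        then show ?thesis using R0[of j] False by simp
      qed (use R in auto)
      moreover have "measure (\<mu> j) {y. norm y \<le> R} = 1 - measure (\<mu> j) {y. norm y > R}"
      proof -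
        have "{y. norm y \<le> R} = space (\<mu> j) - {y. norm y > R}" by (auto simp: space_\<mu>)
        then show ?thesis using prob_compl[of "{y. norm y > R}"] by simp
      qed
      moreover have "measure (\<mu> j) {y. norm y \<le> R} \<le> measure (\<mu> j) (S -` {-1<..2 * R + 3} \<inter> space (\<mu> j))"
      proof (rule finite_measure_mono)
        show "{y. norm y \<le> R} \<subseteq> S -` {-1<..2 * R + 3} \<inter> space (\<mu> j)"
        proof
          fix y :: 'b assume "y \<in> {y. norm y \<le> R}"
          then show "y \<in> S -` {-1<..2 * R + 3} \<inter> space (\<mu> j)"
            using S_bd[of y] by (auto simp: space_\<mu>)
        qed
      qed measurable
      moreover have "measure (m j) {-1<..2 * R + 3} = measure (\<mu> j) (S -` {-1<..2 * R + 3} \<inter> space (\<mu> j))"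
        unfolding m_def by (intro measure_distr) auto
      ultimately show ?thesis by linarith
    qed
    moreover have "-1 < 2 * R + 3" using R(1) by simp
    ultimately show "\<exists>a b. a < b \<and> (\<forall>n. 1 - \<epsilon> < measure (m n) {a<..b})" by blast
  qed (rule rd)
  then obtain s M where s: "strict_mono (s :: nat \<Rightarrow> nat)" and M: "real_distribution M"
    and conv: "weak_conv_m (m \<circ> id \<circ> s) M"
    using tight_imp_convergent_subsubsequence[of m id] strict_mono_id by (metis id_def strict_mono_def)
  interpret M: real_distribution M by (rule M)
  define \<nu> where "\<nu> = distr M borel g"
  have "radon_probability \<nu>"
    unfolding radon_probability_def \<nu>_def by (auto intro!: M.prob_space_distr)
  moreover have "narrowly_converges (\<lambda>k. \<mu> (s k)) \<nu>"
    unfolding narrowly_converges_def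
  proof (intro allI impI, elim conjE)
    fix \<Phi> :: "'b \<Rightarrow> real" assume cont: "continuous_on UNIV \<Phi>" and bdd: "bounded (range \<Phi>)"
    have [measurable]: "\<Phi> \<in> borel_measurable borel" using cont by (rule borel_measurable_continuous_onI)
    obtain B where B: "\<And>y. norm (\<Phi> y) \<le> B" using bdd unfolding bounded_iff by auto
    have "continuous_on UNIV (\<lambda>t. \<Phi> (g t))" using continuous_on_compose2[OF cont g] by simp
    then have "isCont (\<lambda>t. \<Phi> (g t)) t" for t by (simp add: continuous_on_eq_continuous_at)
    then have "(\<lambda>k. \<integral>t. \<Phi> (g t) \<partial>m (s k)) \<longlonglongrightarrow> (\<integral>t. \<Phi> (g t) \<partial>M)"
      using weak_conv_imp_integral_bdd_continuous_conv[of "m \<circ> id \<circ> s" M "\<lambda>t. \<Phi> (g t)" B] rd M conv B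
      by simp
    moreover have "(\<integral>t. \<Phi> (g t) \<partial>m (s k)) = (\<integral>y. \<Phi> y \<partial>\<mu> (s k))" for k
      unfolding m_def by (subst integral_distr) (auto simp: gS)
    moreover have "(\<integral>t. \<Phi> (g t) \<partial>M) = (\<integral>y. \<Phi> y \<partial>\<nu>)"
      unfolding \<nu>_def by (subst integral_distr) auto
    ultimately show "(\<lambda>k. \<integral>y. \<Phi> y \<partial>\<mu> (s k)) \<longlonglongrightarrow> (\<integral>y. \<Phi> y \<partial>\<nu>)" by simp
  qed
  ultimately show ?thesis using s by blast
qed

section \<open>Pairings with Borel probability measures\<close>

lemma pairing_mono:
  assumes "AE y in \<mu>. f y \<le> g y"
  shows "pairing \<mu> f \<le> pairing \<mu> g"
  unfolding pairing_def
proof (rule ereal_minus_mono)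
  show "enn2ereal (\<integral>\<^sup>+ y. ennreal (f y) \<partial>\<mu>) \<le> enn2ereal (\<integral>\<^sup>+ y. ennreal (g y) \<partial>\<mu>)"
    unfolding less_eq_ennreal.rep_eq[symmetric]
    by (rule nn_integral_mono_AE) (use assms in \<open>auto simp: ennreal_leI\<close>)
  show "enn2ereal (\<integral>\<^sup>+ y. ennreal (- g y) \<partial>\<mu>) \<le> enn2ereal (\<integral>\<^sup>+ y. ennreal (- f y) \<partial>\<mu>)"
    unfolding less_eq_ennreal.rep_eq[symmetric]
    by (rule nn_integral_mono_AE) (use assms in \<open>auto simp: ennreal_leI\<close>)
qed

lemma pairing_eq_integral:
  assumes "integrable \<mu> f"
  shows "pairing \<mu> f = ereal (\<integral>y. f y \<partial>\<mu>)"
proof -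
  obtain r q where rq: "0 \<le> r" "0 \<le> q" "(\<integral>\<^sup>+ y. ennreal (f y) \<partial>\<mu>) = ennreal r"
    "(\<integral>\<^sup>+ y. ennreal (- f y) \<partial>\<mu>) = ennreal q" "(\<integral>y. f y \<partial>\<mu>) = r - q"
    using integrableE[OF assms] by metis
  then show ?thesis by (simp add: pairing_def enn2ereal_ennreal)
qed

text \<open>
  The negative part is bounded, so a finite pairing leaves no room for an infinite positive part.
\<close>

lemma integrable_of_pairing:
  assumes "prob_space \<mu>" "f \<in> borel_measurable \<mu>" "\<And>y. f y \<ge> - c" "pairing \<mu> f = ereal a"
  shows "integrable \<mu> f"
proof -
  interpret prob_space \<mu> by fact
  have "(\<integral>\<^sup>+ y. ennreal (- f y) \<partial>\<mu>) \<le> (\<integral>\<^sup>+ y. ennreal c \<partial>\<mu>)"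
    using assms(3) by (intro nn_integral_mono ennreal_leI) (simp add: minus_le_iff)
  also have "\<dots> < \<infinity>" by (simp add: emeasure_space_1)
  finally have N: "(\<integral>\<^sup>+ y. ennreal (- f y) \<partial>\<mu>) \<noteq> \<infinity>" by simp
  moreover have "(\<integral>\<^sup>+ y. ennreal (f y) \<partial>\<mu>) \<noteq> \<infinity>"
  proof
    assume "(\<integral>\<^sup>+ y. ennreal (f y) \<partial>\<mu>) = \<infinity>"
    moreover obtain n where "(\<integral>\<^sup>+ y. ennreal (- f y) \<partial>\<mu>) = ennreal n" "n \<ge> 0"
      using N by (cases "\<integral>\<^sup>+ y. ennreal (- f y) \<partial>\<mu>") auto
    ultimately show False using assms(4) by (simp add: pairing_def enn2ereal_ennreal)
  qed
  ultimately show ?thesis using assms(2) unfolding real_integrable_def by simp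
qed

lemma ereal_nonneg_of_epsilon:
  fixes x :: ereal
  assumes "\<And>e. e > 0 \<Longrightarrow> x \<ge> ereal (- e)"
  shows "x \<ge> 0"
proof (rule ccontr)
  assume "\<not> ?thesis"
  then obtain r where "x < ereal r" "ereal r < 0" using ereal_dense2[of x 0] by (metis not_le)
  then show False using assms[of "- r"] by simp
qed

lemma radon_probabilityD:
  assumes "radon_probability \<mu>"
  shows "prob_space \<mu>" "sets \<mu> = sets borel" "space \<mu> = UNIV"
  using assms sets_eq_imp_space_eq[of \<mu> borel] by (auto simp: radon_probability_def)

lemma continuous_borel_measurable:
  assumes "radon_probability \<mu>" "continuous_on UNIV (f :: _ \<Rightarrow> real)"
  shows "f \<in> borel_measurable \<mu>"
  using borel_measurable_continuous_onI[OF assms(2)] radon_probabilityD(2)[OF assms(1)]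
  by (simp cong: measurable_cong_sets)

lemma integrable_continuous_bounded:
  fixes f :: "'b::euclidean_space \<Rightarrow> real"
  assumes "radon_probability \<mu>" "continuous_on UNIV f" "\<And>y. \<bar>f y\<bar> \<le> B"
  shows "integrable \<mu> f"
proof -
  interpret prob_space \<mu> using assms radon_probabilityD by blast
  show ?thesis
    by (rule integrable_const_bound[where B=B]) (use assms continuous_borel_measurable in auto)
qed

section \<open>Cutting off subsolutions\<close>

text \<open>
  Finitely many balls on which \<open>u\<close> is Lipschitz cover the closed ball, and a Lipschitz constant
  bounds every derivative on its ball.
\<close>

lemma gradient_bound_on_cball:
  fixes u :: "'a::euclidean_space \<Rightarrow> real"
  assumes "locally_lipschitz u"
  obtains M where "M \<ge> 0" "\<And>x D q. norm x \<le> R \<Longrightarrow> (u has_derivative D) (at x) \<Longrightarrow> D q \<le> M * norm q"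
proof -
  obtain r k where rk: "\<And>y. r y > 0" "\<And>y. (k y)-lipschitz_on (ball y (r y)) u"
    using assms unfolding locally_lipschitz_def by metis
  have "cball 0 R \<subseteq> (\<Union>y\<in>cball 0 R. ball y (r y))" using rk(1) by force
  then obtain C where C: "finite C" "C \<subseteq> cball 0 R" "cball 0 R \<subseteq> (\<Union>y\<in>C. ball y (r y))"
    using compactE_image[OF compact_cball, of "cball 0 R" "\<lambda>y. ball y (r y)" 0 R] open_ball by metis
  define M where "M = Max (insert 0 (k ` C))"
  show ?thesis
  proof
    show "M \<ge> 0" using C(1) by (simp add: M_def)
    fix x D and q :: 'a assume x: "norm x \<le> R" and D: "(u has_derivative D) (at x)"
    obtain p where p: "D = (\<lambda>h. p \<bullet> h)" using has_derivative_imp_gradient[OF D] by blast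
    have "x \<in> cball 0 R" using x by simp
    then obtain y where y: "y \<in> C" "x \<in> ball y (r y)" using C(3) by blast
    obtain e where e: "e > 0" "ball x e \<subseteq> ball y (r y)" using y(2) openE open_ball by metis
    have k0: "k y \<ge> 0" using rk(2) lipschitz_on_nonneg by blast
    have "slopes_in (cball 0 (k y)) (ball x e) u"
      unfolding slopes_in_cball_iff[OF k0]
    proof (intro ballI)
      fix a b assume "a \<in> ball x e" "b \<in> ball x e"
      then have "dist (u b) (u a) \<le> k y * dist b a" using e(2) rk(2)[of y] by (intro lipschitz_onD) auto
      then show "u b - u a \<le> k y * norm (b - a)" by (simp add: dist_norm)
    qed
    then have "p \<in> cball 0 (k y)"
      using e(1) D unfolding p by (intro slopes_in_gradient[of _ x e u u]) auto
    moreover have "k y \<le> M" using C(1) y(1) by (simp add: M_def)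
    ultimately have "norm p * norm q \<le> M * norm q" by (intro mult_right_mono) auto
    then show "D q \<le> M * norm q" using norm_cauchy_schwarz[of p q] unfolding p by linarith
  qed
qed

lemma locally_lipschitz_mult:
  assumes u: "locally_lipschitz u" and \<theta>: "K-lipschitz_on UNIV \<theta>"
  shows "locally_lipschitz (\<lambda>x. \<theta> x * u x)"
  unfolding locally_lipschitz_def
proof
  fix x
  obtain r k where rk: "r > 0" "k-lipschitz_on (ball x r) u" using u unfolding locally_lipschitz_def by blast
  obtain B1 where B1: "B1 \<ge> 0" "\<And>y. norm y \<le> norm x + r \<Longrightarrow> \<bar>u y\<bar> \<le> B1"
    using continuous_bounded_on_cball[OF locally_lipschitz_imp_continuous[OF u]] by blast
  obtain B2 where B2: "B2 \<ge> 0" "\<And>y. norm y \<le> norm x + r \<Longrightarrow> \<bar>\<theta> y\<bar> \<le> B2"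
    using continuous_bounded_on_cball[OF lipschitz_on_continuous_on[OF \<theta>]] by blast
  have "(K * B1 + B2 * k)-lipschitz_on (ball x r) (\<lambda>x. \<theta> x * u x)"
  proof (rule lipschitz_onI)
    fix a b assume ab: "a \<in> ball x r" "b \<in> ball x r"
    have in_cball: "norm y \<le> norm x + r" if "y \<in> ball x r" for y
      using that norm_triangle_sub[of y x] by (simp add: dist_norm norm_minus_commute)
    have "\<theta> a * u a - \<theta> b * u b = (\<theta> a - \<theta> b) * u a + \<theta> b * (u a - u b)" by (simp add: algebra_simps)
    then have "dist (\<theta> a * u a) (\<theta> b * u b) \<le> \<bar>\<theta> a - \<theta> b\<bar> * \<bar>u a\<bar> + \<bar>\<theta> b\<bar> * \<bar>u a - u b\<bar>"
      unfolding dist_real_def by (metis abs_mult abs_triangle_ineq)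
    also have "\<dots> \<le> (K * dist a b) * B1 + B2 * (k * dist a b)"
      using lipschitz_onD[OF \<theta>, of a b] lipschitz_onD[OF rk(2) ab] B1 B2 in_cball ab
        lipschitz_on_nonneg[OF \<theta>] lipschitz_on_nonneg[OF rk(2)]
      by (intro add_mono mult_mono) (auto simp: dist_real_def)
    finally show "dist (\<theta> a * u a) (\<theta> b * u b) \<le> (K * B1 + B2 * k) * dist a b" by (simp add: algebra_simps)
  qed (use B1 B2 lipschitz_on_nonneg[OF \<theta>] lipschitz_on_nonneg[OF rk(2)] in auto)
  then show "\<exists>r>0. \<exists>K. K-lipschitz_on (ball x r) (\<lambda>x. \<theta> x * u x)" using rk(1) by blast
qed

definition cutoff :: "real \<Rightarrow> 'a::euclidean_space \<Rightarrow> real" where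
  "cutoff \<rho> x = max 0 (min 1 (\<rho> + 1 - norm x))"

lemma cutoff_bounds: "0 \<le> cutoff \<rho> x" "cutoff \<rho> x \<le> 1"
  by (auto simp: cutoff_def)

lemma cutoff_eq_1: "norm x \<le> \<rho> \<Longrightarrow> cutoff \<rho> x = 1"
  by (simp add: cutoff_def)

lemma cutoff_eq_0: "norm x \<ge> \<rho> + 1 \<Longrightarrow> cutoff \<rho> x = 0"
  by (simp add: cutoff_def)

lemma continuous_on_cutoff [continuous_intros]:
  "continuous_on S f \<Longrightarrow> continuous_on S (\<lambda>y. cutoff \<rho> (f y))"
  unfolding cutoff_def by (intro continuous_intros)

lemma cutoff_lipschitz: "1-lipschitz_on UNIV (cutoff \<rho>)"
proof (rule lipschitz_onI)
  fix x y :: 'a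
  have "\<bar>cutoff \<rho> x - cutoff \<rho> y\<bar> \<le> \<bar>norm x - norm y\<bar>" unfolding cutoff_def by linarith
  then show "dist (cutoff \<rho> x) (cutoff \<rho> y) \<le> 1 * dist x y"
    using norm_triangle_ineq3[of x y] by (simp add: dist_norm)
qed simp

lemma cutoff_differentiable:
  fixes x :: "'a::euclidean_space"
  assumes "norm x \<noteq> \<rho>" "norm x \<noteq> \<rho> + 1" "\<rho> \<ge> 0"
  shows "\<exists>D. (cutoff \<rho> has_derivative D) (at x)"
proof -
  consider "norm x < \<rho>" | "\<rho> < norm x" "norm x < \<rho> + 1" | "norm x > \<rho> + 1" using assms by linarith
  then show ?thesis
  proof cases
    case 1
    have "((\<lambda>_. 1) has_derivative (\<lambda>_. 0)) (at x)" by simp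
    then have "(cutoff \<rho> has_derivative (\<lambda>_. 0)) (at x)"
      by (rule has_derivative_transform_within_open[of _ _ _ _ "{x. norm x < \<rho>}"])
         (use 1 in \<open>auto simp: cutoff_def intro!: open_Collect_less continuous_intros\<close>)
    then show ?thesis by blast
  next
    case 2
    then have "x \<noteq> 0" using assms(3) by auto
    then have "((\<lambda>y. \<rho> + 1 - norm y) has_derivative (\<lambda>h. 0 - h \<bullet> sgn x)) (at x)"
      by (intro has_derivative_diff has_derivative_const has_derivative_norm) auto
    then have "(cutoff \<rho> has_derivative (\<lambda>h. 0 - h \<bullet> sgn x)) (at x)"
      by (rule has_derivative_transform_within_open[of _ _ _ _ "{x. \<rho> < norm x \<and> norm x < \<rho> + 1}"])
         (use 2 in \<open>auto simp: cutoff_def intro!: open_Collect_conj open_Collect_less continuous_intros\<close>)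
    then show ?thesis by blast
  next
    case 3
    have "((\<lambda>_. 0) has_derivative (\<lambda>_. 0)) (at x)" by simp
    then have "(cutoff \<rho> has_derivative (\<lambda>_. 0)) (at x)"
      by (rule has_derivative_transform_within_open[of _ _ _ _ "{x. norm x > \<rho> + 1}"])
         (use 3 in \<open>auto simp: cutoff_def intro!: open_Collect_less continuous_intros\<close>)
    then show ?thesis by blast
  qed
qed

lemma AE_norm_neq: "AE x in lborel. norm (x::'a::euclidean_space) \<noteq> r"
proof -
  have "sphere (0::'a) r \<in> null_sets lborel"
    using negligible_sphere[of "0::'a" r] closed_sphere[of "0::'a" r]
    by (simp add: negligible_iff_null_sets null_sets_completion_iff borel_closed)
  then have "AE x in lborel. x \<notin> sphere (0::'a) r" by (rule AE_not_in)
  then show ?thesis by simp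
qed

text \<open>
  The product \<open>w\<close> of \<open>u\<close> with a cutoff function agrees with \<open>u\<close> for \<open>|x| \<le> R + 1\<close>, vanishes for
  \<open>|x| \<ge> R + 2\<close>, and its gradient is bounded by some \<open>M\<close>. Where \<open>w\<close> agrees with \<open>u\<close>, both \<open>\<Phi>\<close> and \<open>M|q|\<close>
  dominate \<open>Dw \<bullet> q\<close>; elsewhere only \<open>M|q|\<close> does. Hence \<open>\<Psi>\<close> is chosen as \<open>min(\<Phi>, M|q|)\<close> for
  \<open>|x| \<le> R\<close>, passes continuously to \<open>M|q|\<close> up to \<open>|x| = R + 1\<close>, and is faded out between
  \<open>|x| = R + 2\<close> and \<open>|x| = R + 3\<close>.
\<close>
lemma cutoff_subsolution:
  fixes u :: "'a::euclidean_space \<Rightarrow> real" and \<Phi> :: "'a \<times> 'a \<Rightarrow> real"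
  assumes R: "R > 0" and cont: "continuous_on UNIV \<Phi>" and bdd: "bdd_below (range \<Phi>)" and u: "subsolution_for \<Phi> u"
  obtains w \<Psi> B M where "subsolution_for \<Psi> w" "continuous_on UNIV \<Psi>" "bdd_below (range \<Psi>)" "M \<ge> 0"
    "\<And>x. \<bar>w x\<bar> \<le> B" "\<And>x q. norm x \<le> R \<Longrightarrow> \<Psi> (x, q) \<le> \<Phi> (x, q)"
    "\<And>x q. \<Psi> (x, q) \<le> M * norm q" "\<And>x q. norm x \<ge> R + 3 \<Longrightarrow> \<Psi> (x, q) \<le> 0"
proof -
  define w where "w x = cutoff (R + 1) x * u x" for x
  have lip_u: "locally_lipschitz u" using u by (simp add: subsolution_for_def)
  then have lip_w: "locally_lipschitz w" unfolding w_def using cutoff_lipschitz by (rule locally_lipschitz_mult)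
  obtain M where M: "M \<ge> 0" "\<And>x D q. norm x \<le> R + 3 \<Longrightarrow> (w has_derivative D) (at x) \<Longrightarrow> D q \<le> M * norm q"
    using gradient_bound_on_cball[OF lip_w] by blast
  obtain B where B: "B \<ge> 0" "\<And>x. norm x \<le> R + 2 \<Longrightarrow> \<bar>u x\<bar> \<le> B"
    using continuous_bounded_on_cball[OF locally_lipschitz_imp_continuous[OF lip_u]] by blast
  have w_bd: "\<bar>w x\<bar> \<le> B" for x
  proof (cases "norm x \<le> R + 2")
    case True
    have "\<bar>w x\<bar> \<le> 1 * \<bar>u x\<bar>"
      unfolding w_def abs_mult using cutoff_bounds[of "R + 1" x] by (intro mult_right_mono) auto
    then show ?thesis using B(2)[OF True] by simp
  qed (use B(1) in \<open>simp add: w_def cutoff_eq_0\<close>)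
  define \<Psi> where "\<Psi> y = cutoff (R + 2) (fst y) * (M * norm (snd y))
      - cutoff R (fst y) * max 0 (M * norm (snd y) - \<Phi> y)" for y
  have cont_\<Psi>: "continuous_on UNIV \<Psi>"
    unfolding \<Psi>_def by (intro continuous_intros cont)
  have \<Psi>_ge: "min (M * norm q) (\<Phi> (x, q)) \<le> \<Psi> (x, q)" if "norm x \<le> R + 2" for x q
  proof -
    have "cutoff R x * max 0 (M * norm q - \<Phi> (x, q)) \<le> 1 * max 0 (M * norm q - \<Phi> (x, q))"
      using cutoff_bounds[of R x] by (intro mult_right_mono) auto
    then show ?thesis using that by (simp add: \<Psi>_def cutoff_eq_1 min_def max_def split: if_splits)
  qed
  have \<Psi>_ge0: "cutoff (R + 2) x * (M * norm q) \<le> \<Psi> (x, q)" if "norm x \<ge> R + 1" for x q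
    using that by (simp add: \<Psi>_def cutoff_eq_0)
  obtain b where b: "\<And>y. b \<le> \<Phi> y" using bdd unfolding bdd_below_def by auto
  have "min 0 b \<le> \<Psi> y" for y
  proof (cases "norm (fst y) \<le> R + 2")
    case True
    have "0 \<le> M * norm (snd y)" using M(1) by simp
    then show ?thesis using \<Psi>_ge[OF True, of "snd y"] b[of y] by (auto simp: min_def split: if_splits)
  next
    case False
    have "0 \<le> cutoff (R + 2) (fst y) * (M * norm (snd y))" using M(1) cutoff_bounds by (intro mult_nonneg_nonneg) auto
    then show ?thesis using \<Psi>_ge0[of "fst y" "snd y"] False by auto
  qed
  then have bdd_\<Psi>: "bdd_below (range \<Psi>)" by (intro bdd_belowI[of _ "min 0 b"]) auto
  have "AE x in lborel. \<exists>D. (u has_derivative D) (at x) \<and> (\<forall>q. D q \<le> \<Phi> (x, q))"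
    using u by (simp add: subsolution_for_def)
  with AE_norm_neq[of "R + 1"] AE_norm_neq[of "R + 2"]
  have "AE x in lborel. \<exists>D. (w has_derivative D) (at x) \<and> (\<forall>q. D q \<le> \<Psi> (x, q))"
  proof eventually_elim
    case (elim x)
    then obtain D where D: "(u has_derivative D) (at x)" "\<And>q. D q \<le> \<Phi> (x, q)" by blast
    consider "norm x < R + 1" | "R + 1 < norm x" "norm x < R + 2" | "norm x > R + 2" using elim by linarith
    then show ?case
    proof cases
      case 1
      have "(w has_derivative D) (at x)"
        using D(1) by (rule has_derivative_transform_within_open[of _ _ _ _ "{x. norm x < R + 1}"])
          (use 1 in \<open>auto simp: w_def cutoff_eq_1 intro!: open_Collect_less continuous_intros\<close>)
      moreover have "D q \<le> \<Psi> (x, q)" for q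
        using M(2)[OF _ \<open>(w has_derivative D) (at x)\<close>, of q] D(2)[of q] \<Psi>_ge[of x q] 1 by simp
      ultimately show ?thesis by blast
    next
      case 2
      obtain D' where "(cutoff (R + 1) has_derivative D') (at x)"
        using cutoff_differentiable[of x "R + 1"] 2 R by auto
      then have "(w has_derivative (\<lambda>h. cutoff (R + 1) x * D h + D' h * u x)) (at x)" (is "(_ has_derivative ?E) _")
        unfolding w_def using D(1) by (rule has_derivative_mult)
      moreover from this have "?E q \<le> \<Psi> (x, q)" for q
        using M(2)[of x ?E q] \<Psi>_ge0[of x q] 2 by (simp add: cutoff_eq_1)
      ultimately show ?thesis by blast
    next
      case 3
      have "((\<lambda>_. 0) has_derivative (\<lambda>_. 0)) (at x)" by simp
      then have "(w has_derivative (\<lambda>_. 0)) (at x)"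
        by (rule has_derivative_transform_within_open[of _ _ _ _ "{x. norm x > R + 2}"])
          (use 3 in \<open>auto simp: w_def cutoff_eq_0 intro!: open_Collect_less continuous_intros\<close>)
      moreover have "0 \<le> \<Psi> (x, q)" for q
      proof -
        have "0 \<le> cutoff (R + 2) x * (M * norm q)" using M(1) cutoff_bounds by (intro mult_nonneg_nonneg) auto
        then show ?thesis using \<Psi>_ge0[of x q] 3 by linarith
      qed
      ultimately show ?thesis by blast
    qed
  qed
  then have "subsolution_for \<Psi> w" using lip_w by (simp add: subsolution_for_def)
  moreover have "\<Psi> (x, q) \<le> \<Phi> (x, q)" if "norm x \<le> R" for x q
    using that by (simp add: \<Psi>_def cutoff_eq_1)
  moreover have \<Psi>_le: "\<Psi> (x, q) \<le> cutoff (R + 2) x * (M * norm q)" for x q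
    using cutoff_bounds[of R x] by (simp add: \<Psi>_def)
  moreover have "\<Psi> (x, q) \<le> M * norm q" for x q
  proof -
    have "cutoff (R + 2) x * (M * norm q) \<le> 1 * (M * norm q)"
      using cutoff_bounds[of "R + 2" x] M(1) by (intro mult_right_mono) auto
    then show ?thesis using \<Psi>_le[of x q] by simp
  qed
  moreover have "\<Psi> (x, q) \<le> 0" if "norm x \<ge> R + 3" for x q
    using \<Psi>_le[of x q] cutoff_eq_0[of "R + 2" x] that by simp
  ultimately show ?thesis using that cont_\<Psi> bdd_\<Psi> M(1) w_bd by blast
qed

section \<open>Sequences of discounted Mather measures\<close>

locale discounted_mather_sequence = critical_hamiltonian H
  for H :: "'a::euclidean_space \<Rightarrow> 'a \<Rightarrow> real" +
  fixes lam :: "nat \<Rightarrow> real" and z :: 'a and \<mu> :: "nat \<Rightarrow> ('a \<times> 'a) measure"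
  assumes lam_pos: "\<And>j. lam j > 0" and lam_lim: "lam \<longlonglongrightarrow> 0"
    and mather: "\<And>j. discounted_mather_measure H (lam j) z (\<mu> j)"
begin

lemma radon_\<mu>: "radon_probability (\<mu> j)"
  using mather by (simp add: discounted_mather_measure_def)

lemma lagrangian_bounds:
  obtains \<kappa> c where "\<kappa> > 0" "c \<ge> 0" "\<And>K y. K \<ge> 0 \<Longrightarrow> - c \<le> truncated_lagrangian H K y"
    "\<And>x q. \<kappa> * norm q - c \<le> lagrangian H (x, q)"
proof -
  obtain \<kappa> c where *: "\<kappa> > 0" "c \<ge> 0" "\<And>x p. norm p \<le> \<kappa> \<Longrightarrow> H x p \<le> c"
    using H_bounded_above by blast
  show ?thesis
  proof
    fix K :: real and y :: "'a \<times> 'a" assume "K \<ge> 0"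
    then show "- c \<le> truncated_lagrangian H K y"
      using truncated_lagrangian_upper[of 0 K "snd y" "fst y"] *(3)[of 0 "fst y"] *(1) by simp
  next
    fix x q
    show "\<kappa> * norm q - c \<le> lagrangian H (x, q)"
      using truncated_lagrangian_growth[of \<kappa> x c q] truncated_le_lagrangian[of \<kappa> "(x, q)"] * by simp
  qed (use * in auto)
qed

lemma integrable_lagrangian: "integrable (\<mu> j) (lagrangian H)"
proof -
  obtain \<kappa> c where *: "\<kappa> > 0" "c \<ge> 0" "\<And>x q. \<kappa> * norm q - c \<le> lagrangian H (x, q)"
    using lagrangian_bounds by metis
  have "- c \<le> lagrangian H y" for y
  proof -
    have "0 \<le> \<kappa> * norm (snd y)" using *(1) by simp
    then show ?thesis using *(3)[of "snd y" "fst y"] by simp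
  qed
  moreover have "lagrangian H \<in> borel_measurable (\<mu> j)"
    using borel_measurable_lagrangian radon_probabilityD(2)[OF radon_\<mu>] by (simp cong: measurable_cong_sets)
  moreover have "pairing (\<mu> j) (lagrangian H) = ereal (lam j * maximal_subsolution UNIV H (lam j) z)"
    using mather by (simp add: discounted_mather_measure_def)
  ultimately show ?thesis using integrable_of_pairing radon_probabilityD(1)[OF radon_\<mu>] by blast
qed

lemma integral_lagrangian_eventually_le:
  assumes "a > 0"
  shows "\<forall>\<^sub>F j in sequentially. (\<integral>y. lagrangian H y \<partial>\<mu> j) \<le> a"
proof -
  have "(\<integral>y. lagrangian H y \<partial>\<mu> j) = lam j * maximal_subsolution UNIV H (lam j) z" for j
    using mather[of j] pairing_eq_integral[OF integrable_lagrangian[of j]]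
    by (simp add: discounted_mather_measure_def)
  then show ?thesis using limsup_maximal_subsolution[OF lam_pos lam_lim assms] by simp
qed

lemma integrable_truncated_lagrangian:
  assumes "K \<ge> 0"
  shows "integrable (\<mu> j) (truncated_lagrangian H K)"
proof -
  interpret prob_space "\<mu> j" using radon_probabilityD(1)[OF radon_\<mu>] .
  obtain c where c: "c \<ge> 0" "\<And>y. - c \<le> truncated_lagrangian H K y"
    using lagrangian_bounds assms by metis
  show ?thesis
  proof (rule Bochner_Integration.integrable_bound)
    show "integrable (\<mu> j) (\<lambda>y. \<bar>lagrangian H y\<bar> + c)" using integrable_lagrangian by simp
    show "truncated_lagrangian H K \<in> borel_measurable (\<mu> j)"
      using continuous_borel_measurable[OF radon_\<mu> continuous_on_truncated_lagrangian[OF assms]] .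
    have "\<bar>truncated_lagrangian H K y\<bar> \<le> \<bar>lagrangian H y\<bar> + c" for y
      using c truncated_le_lagrangian[OF assms, of y] c(2)[of y] by linarith
    then show "AE y in \<mu> j. norm (truncated_lagrangian H K y) \<le> norm (\<bar>lagrangian H y\<bar> + c)"
      using c(1) by simp
  qed
qed

lemma integral_truncated_le:
  assumes "K \<ge> 0"
  shows "(\<integral>y. truncated_lagrangian H K y \<partial>\<mu> j) \<le> (\<integral>y. lagrangian H y \<partial>\<mu> j)"
  using assms by (intro integral_mono integrable_truncated_lagrangian integrable_lagrangian truncated_le_lagrangian)

lemma test_discounted:
  assumes "continuous_on UNIV \<Phi>" "bdd_below (range \<Phi>)" "discounted_subsolution_for (lam j) \<Phi> u"
    and "integrable (\<mu> j) \<Phi>"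
  shows "lam j * u z \<le> (\<integral>y. \<Phi> y \<partial>\<mu> j)"
proof -
  have "ereal (lam j * u z) \<le> pairing (\<mu> j) \<Phi>"
    using mather[of j] assms by (auto simp: discounted_mather_measure_def)
  then show ?thesis by (simp add: pairing_eq_integral[OF assms(4)])
qed

text \<open>
  Test \<open>\<mu>\<^sub>j\<close> with the function \<open>V\<close> that is strict outside a ball. As \<open>V \<le> 0\<close>, it is a discounted
  subsolution for \<open>L + \<delta> - f\<close>, where \<open>f\<close> is the gain \<open>\<eta>\<close> far out and \<open>0\<close> on the ball. Therefore
  \<open>\<langle>\<mu>\<^sub>j, f\<rangle> \<le> \<langle>\<mu>\<^sub>j, L\<rangle> + \<delta> - lam\<^sub>j V(z)\<close>, whose upper limit is at most \<open>\<delta>\<close>. The same \<open>V\<close> shows that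
  \<open>L + \<delta>\<close> admits a subsolution.
\<close>

lemma mass_outside_vanishes:
  obtains R \<eta> where "R > 0" "\<eta> > 0"
    "\<And>a. a > 0 \<Longrightarrow> \<forall>\<^sub>F j in sequentially. (\<integral>y. \<eta> * (1 - cutoff R (fst y)) \<partial>\<mu> j) \<le> a"
    "\<And>\<delta>. \<delta> > 0 \<Longrightarrow> \<exists>V K. K \<ge> 0 \<and> subsolution_for (\<lambda>y. truncated_lagrangian H K y + \<delta>) V"
proof -
  obtain R \<eta> where R: "R > 0" "\<eta> > 0" and
    V: "\<And>\<delta>. \<delta> > 0 \<Longrightarrow> \<exists>V K. K \<ge> 0 \<and> locally_lipschitz V \<and> (\<forall>x. V x \<le> 0) \<and>
       (\<forall>x. \<exists>p. (V has_derivative (\<lambda>h. p \<bullet> h)) (at x) \<and> norm p \<le> K \<and>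
          H x p \<le> \<delta> - \<eta> * max 0 (min 1 (norm x - R)))"
    using smooth_strict_subsolution by metis
  have reward: "max 0 (min 1 (norm x - R)) = 1 - cutoff R x" for x :: 'a
    by (simp add: cutoff_def max_def min_def)
  have V': "\<exists>V K. K \<ge> 0 \<and> locally_lipschitz V \<and> (\<forall>x. V x \<le> 0) \<and>
       (\<forall>x. \<exists>p. (V has_derivative (\<lambda>h. p \<bullet> h)) (at x) \<and>
          (\<forall>q. p \<bullet> q \<le> truncated_lagrangian H K (x, q) + \<delta> - \<eta> * (1 - cutoff R x)))"
    if \<delta>: "\<delta> > 0" for \<delta>
  proof -
    obtain V K where VK: "K \<ge> 0" "locally_lipschitz V" "\<forall>x. V x \<le> 0"
      "\<And>x. \<exists>p. (V has_derivative (\<lambda>h. p \<bullet> h)) (at x) \<and> norm p \<le> K \<and> H x p \<le> \<delta> - \<eta> * (1 - cutoff R x)"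
      using V[OF \<delta>] unfolding reward by metis
    have "\<exists>p. (V has_derivative (\<lambda>h. p \<bullet> h)) (at x) \<and>
          (\<forall>q. p \<bullet> q \<le> truncated_lagrangian H K (x, q) + \<delta> - \<eta> * (1 - cutoff R x))" for x
    proof -
      obtain p where p: "(V has_derivative (\<lambda>h. p \<bullet> h)) (at x)" "norm p \<le> K" "H x p \<le> \<delta> - \<eta> * (1 - cutoff R x)"
        using VK(4) by blast
      have "p \<bullet> q \<le> truncated_lagrangian H K (x, q) + \<delta> - \<eta> * (1 - cutoff R x)" for q
        using truncated_lagrangian_upper[OF p(2), of q x] p(3) by linarith
      then show ?thesis using p(1) by blast
    qed
    then show ?thesis using VK by blast
  qed
  have reward_bounds: "0 \<le> \<eta> * (1 - cutoff R x)" "\<eta> * (1 - cutoff R x) \<le> \<eta>" for x :: 'a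
    using R(2) cutoff_bounds[of R x] by (auto simp: mult_left_le)
  show ?thesis
  proof (rule that[OF R])
    fix a :: real assume "a > 0"
    then have "a / 3 > 0" by simp
    obtain V K where VK: "K \<ge> 0" "locally_lipschitz V" "\<And>x. V x \<le> 0"
      "\<And>x. \<exists>p. (V has_derivative (\<lambda>h. p \<bullet> h)) (at x) \<and>
          (\<forall>q. p \<bullet> q \<le> truncated_lagrangian H K (x, q) + a / 3 - \<eta> * (1 - cutoff R x))"
      using V'[OF \<open>a / 3 > 0\<close>] by metis
    define \<Phi> where "\<Phi> y = truncated_lagrangian H K y + a / 3 - \<eta> * (1 - cutoff R (fst y))" for y :: "'a \<times> 'a"
    have cont_r: "continuous_on UNIV (\<lambda>y :: 'a \<times> 'a. \<eta> * (1 - cutoff R (fst y)))"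
      by (intro continuous_intros)
    have cont: "continuous_on UNIV \<Phi>"
      unfolding \<Phi>_def by (intro continuous_on_diff continuous_on_add continuous_on_const
        continuous_on_truncated_lagrangian VK(1) cont_r)
    obtain c where c: "\<And>y. - c \<le> truncated_lagrangian H K y" using lagrangian_bounds VK(1) by metis
    have "- c - \<eta> \<le> \<Phi> y" for y
      unfolding \<Phi>_def using c[of y] reward_bounds(2)[of "fst y"] \<open>a > 0\<close> by simp
    then have bdd: "bdd_below (range \<Phi>)" by (intro bdd_belowI[of _ "- c - \<eta>"]) auto
    have disc: "discounted_subsolution_for (lam j) \<Phi> V" for j
      unfolding discounted_subsolution_for_def
    proof (intro conjI VK(2) AE_I2)
      fix x
      obtain p where p: "(V has_derivative (\<lambda>h. p \<bullet> h)) (at x)"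
        "\<And>q. p \<bullet> q \<le> truncated_lagrangian H K (x, q) + a / 3 - \<eta> * (1 - cutoff R x)" using VK(4) by blast
      have "lam j * V x \<le> 0" using less_imp_le[OF lam_pos] VK(3) by (rule mult_nonneg_nonpos)
      then have "lam j * V x + p \<bullet> q \<le> \<Phi> (x, q)" for q
        using p(2)[of q] unfolding \<Phi>_def fst_conv by linarith
      then show "\<exists>D. (V has_derivative D) (at x) \<and> (\<forall>q. lam j * V x + D q \<le> \<Phi> (x, q))"
        using p(1) by blast
    qed
    have main: "(\<integral>y. \<eta> * (1 - cutoff R (fst y)) \<partial>\<mu> j) \<le> (\<integral>y. lagrangian H y \<partial>\<mu> j) + a / 3 - lam j * V z" for j
    proof -
      interpret prob_space "\<mu> j" using radon_probabilityD(1)[OF radon_\<mu>] .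
      have int_r: "integrable (\<mu> j) (\<lambda>y. \<eta> * (1 - cutoff R (fst y)))"
        using reward_bounds by (intro integrable_continuous_bounded[OF radon_\<mu> cont_r, of \<eta>]) (simp add: abs_le_iff)
      have int_T: "integrable (\<mu> j) (truncated_lagrangian H K)" by (rule integrable_truncated_lagrangian[OF VK(1)])
      have "integrable (\<mu> j) \<Phi>" unfolding \<Phi>_def using int_r int_T by simp
      then have "lam j * V z \<le> (\<integral>y. \<Phi> y \<partial>\<mu> j)" by (rule test_discounted[OF cont bdd disc])
      also have "\<dots> = (\<integral>y. truncated_lagrangian H K y \<partial>\<mu> j) + a / 3 - (\<integral>y. \<eta> * (1 - cutoff R (fst y)) \<partial>\<mu> j)"
        unfolding \<Phi>_def using int_T
        by (subst Bochner_Integration.integral_diff[OF _ int_r]) (simp_all add: prob_space)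
      finally show ?thesis using integral_truncated_le[OF VK(1), of j] by linarith
    qed
    have "(\<lambda>j. lam j * V z) \<longlonglongrightarrow> 0 * V z" using lam_lim by (rule tendsto_mult_right)
    then have "\<forall>\<^sub>F j in sequentially. - (a / 3) < lam j * V z" using \<open>a > 0\<close> by (intro order_tendstoD(1)[of _ 0]) auto
    with integral_lagrangian_eventually_le[OF \<open>a / 3 > 0\<close>]
    show "\<forall>\<^sub>F j in sequentially. (\<integral>y. \<eta> * (1 - cutoff R (fst y)) \<partial>\<mu> j) \<le> a"
    proof eventually_elim
      case (elim j)
      then show ?case using main[of j] by linarith
    qed
  next
    fix \<delta> :: real assume "\<delta> > 0"
    obtain V K where VK: "K \<ge> 0" "locally_lipschitz V"
      "\<And>x. \<exists>p. (V has_derivative (\<lambda>h. p \<bullet> h)) (at x) \<and>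
          (\<forall>q. p \<bullet> q \<le> truncated_lagrangian H K (x, q) + \<delta> - \<eta> * (1 - cutoff R x))"
      using V'[OF \<open>\<delta> > 0\<close>] by metis
    have "\<exists>D. (V has_derivative D) (at x) \<and> (\<forall>q. D q \<le> truncated_lagrangian H K (x, q) + \<delta>)" for x
      using VK(3)[of x] reward_bounds(1)[of x] by (metis (no_types, lifting) diff_ge_0_iff_ge diff_le_eq le_add_same_cancel1 order_trans)
    then show "\<exists>V K. K \<ge> 0 \<and> subsolution_for (\<lambda>y. truncated_lagrangian H K y + \<delta>) V"
      using VK(1,2) unfolding subsolution_for_def by (intro exI[of _ V] exI[of _ K]) auto
  qed
qed

text \<open>
  Large \<open>|x|\<close> is ruled out by the vanishing mass outside a ball. Large \<open>|q|\<close> is ruled out by the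
  bound \<open>\<kappa> |q| - c \<le> L\<close> and the upper bound on \<open>\<langle>\<mu>\<^sub>j, L\<rangle>\<close>, as in Markov's inequality.
\<close>

lemma tight_sequence:
  assumes "\<epsilon> > 0"
  shows "\<exists>R. \<forall>\<^sub>F j in sequentially. measure (\<mu> j) {y. norm y > R} < \<epsilon>"
proof -
  obtain R \<eta> where R: "R > 0" "\<eta> > 0"
    "\<And>a. a > 0 \<Longrightarrow> \<forall>\<^sub>F j in sequentially. (\<integral>y. \<eta> * (1 - cutoff R (fst y)) \<partial>\<mu> j) \<le> a"
    using mass_outside_vanishes by metis
  obtain \<kappa> c where c: "\<kappa> > 0" "c \<ge> 0" "\<And>x q. \<kappa> * norm q - c \<le> lagrangian H (x, q)"
    using lagrangian_bounds by metis
  define \<rho> where "\<rho> = 4 * (1 + c) / (\<kappa> * \<epsilon>)"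
  have \<rho>: "\<rho> > 0" using c assms by (simp add: \<rho>_def)
  have "\<eta> * \<epsilon> / 4 > 0" using R assms by simp
  from R(3)[OF this] integral_lagrangian_eventually_le[OF zero_less_one]
  have "\<forall>\<^sub>F j in sequentially. measure (\<mu> j) {y. norm y > (R + 1) + \<rho>} < \<epsilon>"
  proof eventually_elim
    case (elim j)
    interpret prob_space "\<mu> j" using radon_probabilityD(1)[OF radon_\<mu>] .
    define r where "r y = \<eta> * (1 - cutoff R (fst y))" for y :: "'a \<times> 'a"
    have cont_r: "continuous_on UNIV r" unfolding r_def by (intro continuous_intros)
    have r0: "0 \<le> r y" "r y \<le> \<eta>" for y
      using R(2) cutoff_bounds[of R "fst y"] by (auto simp: r_def mult_left_le)
    have int_r: "integrable (\<mu> j) r"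
      using r0 by (intro integrable_continuous_bounded[OF radon_\<mu> cont_r, of \<eta>]) (simp add: abs_le_iff)
    let ?A = "{y :: 'a \<times> 'a. norm y > (R + 1) + \<rho>}"
    have A: "?A \<in> sets (\<mu> j)"
      unfolding radon_probabilityD(2)[OF radon_\<mu>] by (intro borel_open open_Collect_less continuous_intros)
    have "measure (\<mu> j) ?A = (\<integral>y. indicator ?A y \<partial>\<mu> j)" using A radon_probabilityD(3)[OF radon_\<mu>] by simp
    also have "\<dots> \<le> (\<integral>y. r y / \<eta> + (lagrangian H y + c) / (\<kappa> * \<rho>) \<partial>\<mu> j)"
    proof (rule integral_mono)
      show "integrable (\<mu> j) (indicator ?A :: _ \<Rightarrow> real)" using A by (simp add: emeasure_eq_measure)
      show "integrable (\<mu> j) (\<lambda>y. r y / \<eta> + (lagrangian H y + c) / (\<kappa> * \<rho>))"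
        using int_r integrable_lagrangian by simp
      fix y :: "'a \<times> 'a"
      obtain x q where y: "y = (x, q)" by (cases y)
      have n1: "0 \<le> r y / \<eta>" using r0(1)[of y] R(2) by simp
      have "0 \<le> \<kappa> * norm q" using c(1) by simp
      then have "0 \<le> lagrangian H y + c" using c(3)[of q x] unfolding y by linarith
      then have n2: "0 \<le> (lagrangian H y + c) / (\<kappa> * \<rho>)" using c(1) \<rho> by simp
      show "indicator ?A y \<le> r y / \<eta> + (lagrangian H y + c) / (\<kappa> * \<rho>)"
      proof (cases "y \<in> ?A")
        case True
        have "norm y \<le> norm x + norm q" unfolding y by (rule norm_Pair_le)
        then consider "norm x \<ge> R + 1" | "norm q \<ge> \<rho>" using True by fastforce
        then show ?thesis
        proof cases
          case 1
          then have "r y / \<eta> = 1" using R(2) by (simp add: y r_def cutoff_eq_0)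
          then show ?thesis using True n2 by simp
        next
          case 2
          then have "\<kappa> * \<rho> \<le> \<kappa> * norm q" using c(1) by simp
          also have "\<dots> \<le> lagrangian H y + c" using c(3)[of q x] unfolding y by linarith
          finally have "1 \<le> (lagrangian H y + c) / (\<kappa> * \<rho>)" using c(1) \<rho> by (simp add: le_divide_eq)
          then show ?thesis using True n1 by simp
        qed
      next
        case False
        then show ?thesis using n1 n2 by simp
      qed
    qed
    also have "\<dots> = (\<integral>y. r y \<partial>\<mu> j) / \<eta> + ((\<integral>y. lagrangian H y \<partial>\<mu> j) + c) / (\<kappa> * \<rho>)"
      using int_r integrable_lagrangian[of j] by (simp add: prob_space)
    also have "\<dots> \<le> (\<eta> * \<epsilon> / 4) / \<eta> + (1 + c) / (\<kappa> * \<rho>)"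
      using elim(1)[folded r_def] elim(2) R(2) c(1) \<rho> by (intro add_mono divide_right_mono) auto
    also have "\<dots> = \<epsilon> / 4 + \<epsilon> / 4"
    proof -
      have "\<kappa> * \<rho> = 4 * (1 + c) / \<epsilon>" using c(1) by (simp add: \<rho>_def)
      moreover have "d / (4 * d / \<epsilon>) = \<epsilon> / 4" if "d > 0" for d
        using that by simp
      ultimately have "(1 + c) / (\<kappa> * \<rho>) = \<epsilon> / 4" using c(2) by (metis add_pos_nonneg zero_less_one)
      moreover have "\<eta> * \<epsilon> / 4 / \<eta> = \<epsilon> / 4" using R(2) by simp
      ultimately show ?thesis by (simp only:)
    qed
    also have "\<dots> < \<epsilon>" using assms by simp
    finally show ?case .
  qed
  then show ?thesis by blast
qed

end

section \<open>Narrow limits\<close>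

locale mather_limit = discounted_mather_sequence H lam z \<mu>
  for H :: "'a::euclidean_space \<Rightarrow> 'a \<Rightarrow> real" and lam z \<mu> +
  fixes \<nu> :: "('a \<times> 'a) measure"
  assumes radon_\<nu>: "radon_probability \<nu>" and narrow: "narrowly_converges \<mu> \<nu>"
begin

lemma integral_limit:
  fixes f :: "'a \<times> 'a \<Rightarrow> real"
  assumes "continuous_on UNIV f" "\<And>y. \<bar>f y\<bar> \<le> B"
  shows "(\<lambda>j. \<integral>y. f y \<partial>\<mu> j) \<longlonglongrightarrow> (\<integral>y. f y \<partial>\<nu>)"
proof -
  have "bounded (range f)"
  proof (rule boundedI)
    fix v assume "v \<in> range f"
    then obtain y where "v = f y" by blast
    then show "norm v \<le> B" using assms(2)[of y] by simp
  qed
  then show ?thesis using narrow assms(1) unfolding narrowly_converges_def by blast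
qed

text \<open>
  The gain \<open>\<eta> (1 - cutoff R)\<close> is positive outside the ball and bounded continuous, so its integrals,
  which tend to \<open>0\<close>, pass to the limit.
\<close>

lemma limit_support:
  obtains R where "R > 0" "AE y in \<nu>. norm (fst y) \<le> R"
proof -
  obtain R \<eta> where R: "R > 0" "\<eta> > 0"
    "\<And>a. a > 0 \<Longrightarrow> \<forall>\<^sub>F j in sequentially. (\<integral>y. \<eta> * (1 - cutoff R (fst y)) \<partial>\<mu> j) \<le> a"
    using mass_outside_vanishes by metis
  let ?r = "\<lambda>y :: 'a \<times> 'a. \<eta> * (1 - cutoff R (fst y))"
  have cont: "continuous_on UNIV ?r" by (intro continuous_intros)
  have r0: "0 \<le> ?r y" "\<bar>?r y\<bar> \<le> \<eta>" for y
    using R(2) cutoff_bounds[of R "fst y"] by (auto simp: mult_left_le abs_mult)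
  have "(\<integral>y. ?r y \<partial>\<nu>) \<le> 0"
  proof (rule field_le_epsilon)
    fix a :: real assume "a > 0"
    from integral_limit[OF cont r0(2)] R(3)[OF this] show "(\<integral>y. ?r y \<partial>\<nu>) \<le> 0 + a"
      by (intro tendsto_upperbound[of "\<lambda>j. \<integral>y. ?r y \<partial>\<mu> j"]) auto
  qed
  moreover have int: "integrable \<nu> ?r" by (rule integrable_continuous_bounded[OF radon_\<nu> cont r0(2)])
  moreover have "(\<integral>y. ?r y \<partial>\<nu>) \<ge> 0" by (intro integral_nonneg_AE AE_I2 r0)
  ultimately have "AE y in \<nu>. ?r y = 0"
    using integral_nonneg_eq_0_iff_AE[OF int] r0(1) by simp
  then have "AE y in \<nu>. norm (fst y) \<le> R"
  proof eventually_elim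
    case (elim y)
    then have "cutoff R (fst y) = 1" using R(2) by simp
    then show ?case by (auto simp: cutoff_def max_def min_def split: if_splits)
  qed
  then show ?thesis using that R(1) by blast
qed

text \<open>
  After the cutoff, \<open>\<Psi> \<le> 0\<close> for \<open>x\<close> outside a ball, and \<open>\<Psi> \<le> M|q|\<close> on it, where \<open>M|q| \<le> (M/K) (L\<^sub>K + const)\<close> for every \<open>K\<close>. So
  \<open>\<Psi>\<close> is at most its truncation \<open>min \<Psi> n\<close> plus \<open>M/K\<close> times the nonnegative function \<open>L\<^sub>K + c\<close>,
  whose integrals are bounded along the sequence. Testing \<open>\<mu>\<^sub>j\<close> with this sum and letting \<open>j\<close> tend to
  infinity bounds the integral of the bounded function \<open>min \<Psi> n\<close> against \<open>\<nu>\<close> from below by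
  \<open>- (M/K) (1 + c)\<close>. As \<open>\<Psi> \<le> \<Phi>\<close> on the support of \<open>\<nu>\<close>, it remains to let \<open>K\<close> tend to infinity.
\<close>

lemma test_limit:
  assumes cont: "continuous_on UNIV \<Phi>" and bdd: "bdd_below (range \<Phi>)" and u: "subsolution_for \<Phi> u"
  shows "pairing \<nu> \<Phi> \<ge> 0"
proof -
  obtain R where R: "R > 0" "AE y in \<nu>. norm (fst y) \<le> R" by (rule limit_support)
  obtain w \<Psi> B M where w: "subsolution_for \<Psi> w" "continuous_on UNIV \<Psi>" "bdd_below (range \<Psi>)" "M \<ge> 0"
    "\<And>x. \<bar>w x\<bar> \<le> B" "\<And>x q. norm x \<le> R \<Longrightarrow> \<Psi> (x, q) \<le> \<Phi> (x, q)"
    "\<And>x q. \<Psi> (x, q) \<le> M * norm q" "\<And>x q. norm x \<ge> R + 3 \<Longrightarrow> \<Psi> (x, q) \<le> 0"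
    by (rule cutoff_subsolution[OF R(1) cont bdd u], rule that)
  obtain c where c: "c \<ge> 0" "\<And>K y. K \<ge> 0 \<Longrightarrow> - c \<le> truncated_lagrangian H K y"
    using lagrangian_bounds by metis
  obtain b where b: "\<And>y. b \<le> \<Psi> y" using w(3) unfolding bdd_below_def by auto
  have key: "pairing \<nu> \<Phi> \<ge> ereal (- (M / K * (1 + c)))" if K: "K > 0" for K
  proof -
    obtain B' where "\<And>y. norm y \<le> R + 3 + K \<Longrightarrow> \<bar>(\<lambda>(x, p). H x p) y\<bar> \<le> B'" and B'0: "B' \<ge> 0"
      using continuous_bounded_on_cball[OF cont_H] by blast
    then have B': "H x p \<le> B'" if "norm x \<le> R + 3" "norm p \<le> K" for x p
      using that norm_Pair_le[of x p] by (fastforce simp: abs_le_iff)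
    \<comment> \<open>the constant in \<open>M|q| \<le> (M/K) L\<^sub>K + n\<close> over \<open>|x| \<le> R + 3\<close>\<close>
    define n where "n = M / K * B'"
    have n0: "n \<ge> 0" using w(4) K B'0 by (simp add: n_def)
    have MK: "M / K \<ge> 0" using w(4) K by simp
    define \<Psi>n where "\<Psi>n y = min (\<Psi> y) n" for y
    have cont_\<Psi>n: "continuous_on UNIV \<Psi>n" unfolding \<Psi>n_def by (intro continuous_intros w)
    have \<Psi>n_bd: "\<bar>\<Psi>n y\<bar> \<le> \<bar>b\<bar> + n" for y
      using b[of y] n0 unfolding \<Psi>n_def by linarith
    have \<Psi>_le: "\<Psi> y \<le> \<Psi>n y + M / K * (truncated_lagrangian H K y + c)" for y
    proof (cases "\<Psi> y \<le> n")
      case True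
      have "0 \<le> M / K * (truncated_lagrangian H K y + c)"
        using MK c(2)[of K y] K by (intro mult_nonneg_nonneg) auto
      then show ?thesis using True by (simp add: \<Psi>n_def)
    next
      case False
      obtain x q where y: "y = (x, q)" by (cases y)
      have "norm x \<le> R + 3" using w(8)[of x q] False n0 unfolding y by fastforce
      then have "K * norm q - B' \<le> truncated_lagrangian H K y"
        unfolding y using K B' by (intro truncated_lagrangian_growth) auto
      then have "M / K * (K * norm q) \<le> M / K * (truncated_lagrangian H K y + c + B')"
        using c(1) MK by (intro mult_left_mono) auto
      moreover have "\<Psi> y \<le> M / K * (K * norm q)" using w(7)[of x q] K unfolding y by simp
      ultimately show ?thesis using False by (simp add: \<Psi>n_def n_def algebra_simps)
    qed
    have lower: "- (2 * lam j * B) - M / K * ((\<integral>y. lagrangian H y \<partial>\<mu> j) + c) \<le> (\<integral>y. \<Psi>n y \<partial>\<mu> j)" for j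
    proof -
      interpret prob_space "\<mu> j" using radon_probabilityD(1)[OF radon_\<mu>] .
      define \<Phi>' where "\<Phi>' y = \<Psi>n y + M / K * (truncated_lagrangian H K y + c) + lam j * B" for y
      have int_\<Psi>n: "integrable (\<mu> j) \<Psi>n" by (rule integrable_continuous_bounded[OF radon_\<mu> cont_\<Psi>n \<Psi>n_bd])
      have int_T: "integrable (\<mu> j) (truncated_lagrangian H K)" using K by (intro integrable_truncated_lagrangian) simp
      have cont': "continuous_on UNIV \<Phi>'"
        unfolding \<Phi>'_def using K by (intro continuous_on_add continuous_on_mult continuous_on_const cont_\<Psi>n
          continuous_on_truncated_lagrangian) simp
      have "b + lam j * B \<le> \<Phi>' y" for y
        using \<Psi>_le[of y] b[of y] unfolding \<Phi>'_def by linarith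
      then have bdd': "bdd_below (range \<Phi>')" by (intro bdd_belowI[of _ "b + lam j * B"]) auto
      have disc: "discounted_subsolution_for (lam j) \<Phi>' w"
        unfolding discounted_subsolution_for_def
      proof
        show "locally_lipschitz w" using w(1) by (simp add: subsolution_for_def)
        have "AE x in lborel. \<exists>D. (w has_derivative D) (at x) \<and> (\<forall>q. D q \<le> \<Psi> (x, q))"
          using w(1) by (simp add: subsolution_for_def)
        then show "AE x in lborel. \<exists>D. (w has_derivative D) (at x) \<and> (\<forall>q. lam j * w x + D q \<le> \<Phi>' (x, q))"
        proof eventually_elim
          case (elim x)
          then obtain D where D: "(w has_derivative D) (at x)" "\<And>q. D q \<le> \<Psi> (x, q)" by blast
          have "lam j * w x \<le> lam j * B" using w(5)[of x] lam_pos[of j] by (intro mult_left_mono) auto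
          then have "lam j * w x + D q \<le> \<Phi>' (x, q)" for q
            using D(2)[of q] \<Psi>_le[of "(x, q)"] unfolding \<Phi>'_def by linarith
          then show ?case using D(1) by blast
        qed
      qed
      have "integrable (\<mu> j) \<Phi>'" unfolding \<Phi>'_def using int_\<Psi>n int_T by simp
      then have "lam j * w z \<le> (\<integral>y. \<Phi>' y \<partial>\<mu> j)" by (rule test_discounted[OF cont' bdd' disc])
      also have "\<dots> = (\<integral>y. \<Psi>n y \<partial>\<mu> j) + M / K * ((\<integral>y. truncated_lagrangian H K y \<partial>\<mu> j) + c) + lam j * B"
        unfolding \<Phi>'_def using int_\<Psi>n int_T by (simp add: prob_space)
      also have "\<dots> \<le> (\<integral>y. \<Psi>n y \<partial>\<mu> j) + M / K * ((\<integral>y. lagrangian H y \<partial>\<mu> j) + c) + lam j * B"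
        using integral_truncated_le[of K j] K MK by (intro add_right_mono add_left_mono mult_left_mono) auto
      finally have "lam j * w z \<le> \<dots>" .
      moreover have "lam j * (- B) \<le> lam j * w z" using w(5)[of z] lam_pos[of j] by (intro mult_left_mono) auto
      ultimately show ?thesis by simp
    qed
    have "- (M / K * (1 + c)) \<le> (\<integral>y. \<Psi>n y \<partial>\<nu>)"
    proof (rule tendsto_le[OF _ integral_limit[OF cont_\<Psi>n \<Psi>n_bd]])
      have "(\<lambda>j. - (2 * lam j * B) - M / K * (1 + c)) \<longlonglongrightarrow> - (2 * 0 * B) - M / K * (1 + c)"
        by (intro tendsto_intros lam_lim)
      then show "(\<lambda>j. - (2 * lam j * B) - M / K * (1 + c)) \<longlonglongrightarrow> - (M / K * (1 + c))" by simp
      show "\<forall>\<^sub>F j in sequentially. - (2 * lam j * B) - M / K * (1 + c) \<le> (\<integral>y. \<Psi>n y \<partial>\<mu> j)"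
        using integral_lagrangian_eventually_le[OF zero_less_one]
      proof eventually_elim
        case (elim j)
        then have "M / K * ((\<integral>y. lagrangian H y \<partial>\<mu> j) + c) \<le> M / K * (1 + c)"
          using MK by (intro mult_left_mono) auto
        then show ?case using lower[of j] by linarith
      qed
    qed simp
    then have "ereal (- (M / K * (1 + c))) \<le> pairing \<nu> \<Psi>n"
      by (simp add: pairing_eq_integral[OF integrable_continuous_bounded[OF radon_\<nu> cont_\<Psi>n \<Psi>n_bd]])
    also have "\<dots> \<le> pairing \<nu> \<Phi>"
    proof (rule pairing_mono)
      show "AE y in \<nu>. \<Psi>n y \<le> \<Phi> y"
        using R(2) by eventually_elim (use w(6) in \<open>auto simp: \<Psi>n_def min_le_iff_disj\<close>)
    qed
    finally show ?thesis .
  qed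
  show ?thesis
  proof (rule ereal_nonneg_of_epsilon)
    fix e :: real assume e: "e > 0"
    define K where "K = (M + 1) * (1 + c) / e"
    have K: "K > 0" using e w(4) c(1) by (simp add: K_def)
    have "M * (1 + c) \<le> (M + 1) * (1 + c)" using c(1) by (intro mult_right_mono) auto
    also have "\<dots> = e * K" using e by (simp add: K_def)
    finally have "M / K * (1 + c) \<le> e" using K by (simp add: pos_divide_le_eq)
    then show "ereal (- e) \<le> pairing \<nu> \<Phi>"
      using key[OF K] by (meson ereal_less_eq(3) neg_le_iff_le order_trans)
  qed
qed

text \<open>
  The bounded continuous functions \<open>min L\<^sub>n n\<close> increase to \<open>L\<close>. Their integrals against \<open>\<nu>\<close> are limits of
  integrals that are at most \<open>\<langle>\<mu>\<^sub>j, L\<rangle>\<close>, hence nonpositive, and monotone convergence gives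
  \<open>\<langle>\<nu>, L\<rangle> \<le> 0\<close>. The opposite inequality holds because \<open>L + \<delta>\<close> admits a subsolution for every \<open>\<delta> > 0\<close>.
\<close>

lemma pairing_lagrangian_limit: "pairing \<nu> (lagrangian H) = 0"
proof -
  interpret prob_space \<nu> using radon_probabilityD(1)[OF radon_\<nu>] .
  obtain c where c: "c \<ge> 0" "\<And>K y. K \<ge> 0 \<Longrightarrow> - c \<le> truncated_lagrangian H K y"
    using lagrangian_bounds by metis
  define \<Lambda> where "\<Lambda> n y = min (truncated_lagrangian H (real n) y) (real n)" for n y
  have cont: "continuous_on UNIV (\<Lambda> n)" for n
    unfolding \<Lambda>_def by (intro continuous_on_min continuous_on_truncated_lagrangian continuous_on_const) simp
  have bd: "\<bar>\<Lambda> n y\<bar> \<le> c + real n" for n y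
    using c(1) c(2)[of "real n" y] unfolding \<Lambda>_def by linarith
  have int: "integrable \<nu> (\<Lambda> n)" for n by (rule integrable_continuous_bounded[OF radon_\<nu> cont bd])
  have mono: "\<Lambda> m y \<le> \<Lambda> n y" if "m \<le> n" for m n y
    using truncated_lagrangian_mono[of "real m" "real n" y] that unfolding \<Lambda>_def by (intro min.mono) auto
  have upper: "(\<integral>y. \<Lambda> n y \<partial>\<nu>) \<le> 0" for n
  proof (rule field_le_epsilon)
    fix a :: real assume "a > 0"
    from integral_lagrangian_eventually_le[OF this]
    have "\<forall>\<^sub>F j in sequentially. (\<integral>y. \<Lambda> n y \<partial>\<mu> j) \<le> 0 + a"
    proof eventually_elim
      case (elim j)
      have "(\<integral>y. \<Lambda> n y \<partial>\<mu> j) \<le> (\<integral>y. lagrangian H y \<partial>\<mu> j)"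
      proof (rule integral_mono[OF integrable_continuous_bounded[OF radon_\<mu> cont bd] integrable_lagrangian])
        fix y show "\<Lambda> n y \<le> lagrangian H y"
          using truncated_le_lagrangian[of "real n" y] by (simp add: \<Lambda>_def min_le_iff_disj)
      qed
      then show ?case using elim by simp
    qed
    then show "(\<integral>y. \<Lambda> n y \<partial>\<nu>) \<le> 0 + a"
      by (rule tendsto_upperbound[OF integral_limit[OF cont bd]]) simp
  qed
  have inc: "incseq (\<lambda>n. \<integral>y. \<Lambda> n y \<partial>\<nu>)"
    unfolding incseq_def by (auto intro!: integral_mono int mono)
  then obtain l where l: "(\<lambda>n. \<integral>y. \<Lambda> n y \<partial>\<nu>) \<longlonglongrightarrow> l"
    using incseq_convergent[OF inc, of 0] upper by metis
  then have "l \<le> 0" using upper by (intro tendsto_upperbound[OF l]) auto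
  have "(\<lambda>n. \<Lambda> n y) \<longlonglongrightarrow> lagrangian H y" for y
  proof -
    obtain n0 where n0: "lagrangian H y \<le> real n0" using real_arch_simple by blast
    have "\<forall>\<^sub>F n in sequentially. truncated_lagrangian H (real n) y = \<Lambda> n y"
      using eventually_ge_at_top[of n0]
    proof eventually_elim
      case (elim n)
      then have "truncated_lagrangian H (real n) y \<le> real n"
        using truncated_le_lagrangian[of "real n" y] n0 by (meson of_nat_0_le_iff of_nat_le_iff order_trans)
      then show ?case by (simp add: \<Lambda>_def)
    qed
    then show ?thesis using truncated_tendsto_lagrangian by (rule Lim_transform_eventually[rotated])
  qed
  then have lim: "AE y in \<nu>. (\<lambda>n. \<Lambda> n y) \<longlonglongrightarrow> lagrangian H y" by simp
  have mono': "AE y in \<nu>. mono (\<lambda>n. \<Lambda> n y)" using mono by (auto simp: mono_def)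
  have meas: "lagrangian H \<in> borel_measurable \<nu>"
    using borel_measurable_lagrangian radon_probabilityD(2)[OF radon_\<nu>] by (simp cong: measurable_cong_sets)
  have int_L: "integrable \<nu> (lagrangian H)"
    by (rule integrable_monotone_convergence[OF int mono' lim l meas])
  have "(\<integral>y. lagrangian H y \<partial>\<nu>) = l"
    by (rule integral_monotone_convergence[OF int mono' lim l meas])
  moreover have "0 \<le> (\<integral>y. lagrangian H y \<partial>\<nu>)"
  proof (rule field_le_epsilon)
    fix \<delta> :: real assume "\<delta> > 0"
    then obtain V K where VK: "K \<ge> 0" "subsolution_for (\<lambda>y. truncated_lagrangian H K y + \<delta>) V"
      using mass_outside_vanishes by metis
    have "continuous_on UNIV (\<lambda>y. truncated_lagrangian H K y + \<delta>)"
      by (intro continuous_on_add continuous_on_truncated_lagrangian VK(1) continuous_on_const)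
    moreover have "bdd_below (range (\<lambda>y. truncated_lagrangian H K y + \<delta>))"
      using c(2)[OF VK(1)] by (intro bdd_belowI[of _ "- c + \<delta>"]) auto
    ultimately have "0 \<le> pairing \<nu> (\<lambda>y. truncated_lagrangian H K y + \<delta>)" using VK(2) by (rule test_limit)
    also have "\<dots> \<le> pairing \<nu> (\<lambda>y. lagrangian H y + \<delta>)"
      by (intro pairing_mono AE_I2 add_right_mono truncated_le_lagrangian VK(1))
    also have "\<dots> = ereal ((\<integral>y. lagrangian H y \<partial>\<nu>) + \<delta>)"
      using int_L by (subst pairing_eq_integral) (simp_all add: prob_space)
    finally show "0 \<le> (\<integral>y. lagrangian H y \<partial>\<nu>) + \<delta>" by simp
  qed
  ultimately have "(\<integral>y. lagrangian H y \<partial>\<nu>) = 0" using \<open>l \<le> 0\<close> by simp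
  then show ?thesis by (simp add: pairing_eq_integral[OF int_L])
qed

lemma limit_in_mather_measures: "\<nu> \<in> mather_measures H"
  unfolding mather_measures_def using radon_\<nu> pairing_lagrangian_limit test_limit by blast

end

theorem theorem10p1:
  fixes H :: "real ^ 'n \<Rightarrow> real ^ 'n \<Rightarrow> real"
    and z :: "real ^ 'n"
    and lamz :: real
    and lam :: "nat \<Rightarrow> real"
    and \<mu> :: "nat \<Rightarrow> ((real ^ 'n) \<times> (real ^ 'n)) measure"
  assumes "continuous_on UNIV (\<lambda>(x, p). H x p)"
    and "\<And>x. convex_on UNIV (H x)"
    and "locally_coercive H"
    and "nondegenerate_at_infinity H"
    and "superlinear H"
    and "critical_value H = 0"
    and "lamz > 0"
    and "\<And>l. 0 < l \<Longrightarrow> l < lamz \<Longrightarrow>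
           \<exists>y r. z \<in> ball y r \<and>
             maximal_subsolution UNIV H l z = maximal_subsolution (ball y r) H l z"
    and "\<And>j. 0 < lam j \<and> lam j < lamz"
    and "lam \<longlonglongrightarrow> 0"
    and "\<And>j. discounted_mather_measure H (lam j) z (\<mu> j)"
  shows "\<exists>s \<nu>. strict_mono s \<and> \<nu> \<in> mather_measures H \<and> narrowly_converges (\<lambda>k. \<mu> (s k)) \<nu>"
proof -
  interpret discounted_mather_sequence H lam z \<mu>
    using assms by unfold_locales auto
  obtain s \<nu> where s: "strict_mono (s :: nat \<Rightarrow> nat)" and \<nu>: "radon_probability \<nu>"
    and conv: "narrowly_converges (\<lambda>k. \<mu> (s k)) \<nu>"
    using prokhorov_euclidean[of \<mu>] radon_\<mu> tight_sequence by blast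
  have "(\<lambda>k. lam (s k)) \<longlonglongrightarrow> 0"
    using LIMSEQ_subseq_LIMSEQ[OF lam_lim s] by (simp add: o_def)
  then interpret limit: mather_limit H "\<lambda>k. lam (s k)" z "\<lambda>k. \<mu> (s k)" \<nu>
    using \<nu> conv lam_pos mather by unfold_locales auto
  show ?thesis using s conv limit.limit_in_mather_measures by blast
qed

end
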